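(* Let $T>1$. If $f\in L^2(-1,1)$ is uniformly Dini--Lipschitz in $[a,b]\subseteq[-1,1]$, then $$\|f-f_N\|_{L^\infty(c,d)}\to 0\quad\text{as }N\to\infty,$$ for all $[c,d]\subset(a,b)$.
   Context: Fix $T>1$. For each odd positive integer $N=2n+1$ let $\mathcal{H}_N=\mathrm{span}\{e^{\frac{i\pi}{T}kx}\}_{k=-n}^{n}$, regarded as a space of functions on $[-1,1]$. For $f\in L^2(-1,1)$, the Fourier extension $f_N\in\mathcal{H}_N$ is the unique minimizer of $\|f-r\|_{L^2(-1,1)}$ over $r\in\mathcal{H}_N$, i.e. the $L^2(-1,1)$-orthogonal projection of $f$ onto $\mathcal{H}_N$. The limit $N\to\infty$ is through odd integers. A function $f$ is uniformly Dini--Lipschitz in $[a,b]$ if $$\lim_{\delta\searrow 0}\ \sup_{x,y\in[a,b],\,|x-y|<\delta}\left|(f(x)-f(y))\log\delta\right|=0.$$ *)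

theory Defs
  imports "HOL-Analysis.Analysis" "HOL-Probability.Essential_Supremum"
begin

definition L2_function :: "(real \<Rightarrow> complex) \<Rightarrow> bool" where
  "L2_function f \<longleftrightarrow>
     f \<in> borel_measurable (lebesgue_on {-1<..<1}) \<and>
     integrable (lebesgue_on {-1<..<1}) (\<lambda>x. (cmod (f x))\<^sup>2)"

definition L2_norm :: "(real \<Rightarrow> complex) \<Rightarrow> real" where
  "L2_norm f = sqrt (LINT x|lebesgue_on {-1<..<1}. (cmod (f x))\<^sup>2)"

text \<open>The value in \<open>ennreal\<close> makes the essential supremum of the modulus meaningful without a
  boundedness hypothesis: it is infinite for functions that are not essentially bounded.\<close>

definition Linf_norm :: "real \<Rightarrow> real \<Rightarrow> (real \<Rightarrow> complex) \<Rightarrow> ennreal" where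
  "Linf_norm c d f = esssup (lebesgue_on {c<..<d}) (\<lambda>x. ennreal (cmod (f x)))"

text \<open>The space \<open>H\<^sub>N\<close>, for odd \<open>N = 2 * n + 1\<close>, is the complex span of the exponentials with
  frequencies \<open>-n, \<dots>, n\<close>. Its elements are represented by their defining formula on the whole
  real line; since they are entire, they are determined by their restriction to \<open>[-1, 1]\<close>.\<close>

definition fourier_space :: "real \<Rightarrow> nat \<Rightarrow> (real \<Rightarrow> complex) set" where
  "fourier_space T N =
     (let n = int ((N - 1) div 2) in
      {r. \<exists>c :: int \<Rightarrow> complex.
            r = (\<lambda>x. \<Sum>k = -n..n. c k * exp (\<i> * of_real (pi / T * of_int k * x)))})"

definition fourier_extension :: "real \<Rightarrow> nat \<Rightarrow> (real \<Rightarrow> complex) \<Rightarrow> real \<Rightarrow> complex" where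
  "fourier_extension T N f =
     (THE r. is_arg_min (\<lambda>r. L2_norm (\<lambda>x. f x - r x)) (\<lambda>r. r \<in> fourier_space T N) r)"

text \<open>The supremum is taken in \<open>ennreal\<close>, so that it is infinite when \<open>f\<close> is unbounded,
  rather than an unspecified real number.\<close>

definition uniformly_Dini_Lipschitz :: "real \<Rightarrow> real \<Rightarrow> (real \<Rightarrow> complex) \<Rightarrow> bool" where
  "uniformly_Dini_Lipschitz a b f \<longleftrightarrow>
     ((\<lambda>\<delta>. SUP (x, y) \<in> {(x, y). x \<in> {a..b} \<and> y \<in> {a..b} \<and> \<bar>x - y\<bar> < \<delta>}.
             ennreal (cmod ((f x - f y) * of_real (ln \<delta>))))
       \<longlongrightarrow> 0) (at_right 0)"

end

theory Submission
  imports Defs "HOL-Real_Asymp.Real_Asymp"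
begin

text \<open>
  The theorem follows from a comparison of the Fourier extension with a partial sum of an ordinary
  cosine series.

  Put \<open>sin (\<pi> x / 2 T) = sin (\<pi> / 2 T) cos \<phi>\<close>. This maps \<open>[-1, 1]\<close> onto \<open>[0, \<pi>]\<close>, and it
  turns the even trigonometric polynomials of degree \<open>n\<close> into the span of the \<open>cos (2 j \<phi>)\<close>, and the odd
  ones into \<open>\<rho>\<close> times the span of the \<open>cos ((2 j + 1) \<phi>)\<close>, where \<open>\<rho> = cos (\<pi> x / 2 T)\<close> is bounded away
  from zero. The inner product \<open>dx\<close> becomes \<open>d\<phi>\<close> with the weight \<open>sin \<phi> / \<rho>\<close> up to a constant. The
  cosine kernel \<open>L(x, y) = 1 + 2 \<Sum>\<^sub>j cos (j \<phi>(x)) cos (j \<phi>(y))\<close>, \<open>1 \<le> j \<le> 2 n\<close>, reproduces cosine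
  polynomials in the measure \<open>d\<phi>\<close>. By the Christoffel--Darboux formula, its product with
  \<open>g(x) - g(y)\<close> is bounded independently of \<open>n\<close> for the factors \<open>g\<close> that are needed: \<open>\<rho>\<close>, and
  \<open>sin \<phi>\<close> for \<open>x\<close> away from the endpoints. Hence weights can be moved in and out of integrals against \<open>L\<close>
  at a cost proportional to the norm. Since the projection \<open>f\<^sub>N\<close> is reproduced by \<open>L\<close> after multiplication
  by \<open>sin\<^sup>2 \<phi>\<close>, and since \<open>f\<^sub>N\<close> and \<open>f\<close> have the same inner products with the even part of \<open>L\<close> and with
  \<open>\<rho>\<close> times its odd part, \<open>f\<^sub>N(x)\<close> equals an explicit multiple of \<open>\<integral> L(x, y) f(y) dy\<close> up to
  \<open>O(\<parallel>f\<parallel>)\<close>, uniformly on compact subsets of \<open>(-1, 1)\<close> (\<open>projection_vs_kernel\<close>). No asymptotics of the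
  orthogonal polynomials on the arc are needed.

  The integral against \<open>L\<close> is bounded by \<open>\<parallel>f\<parallel>\<close> far from \<open>x\<close>. Near \<open>x\<close> the classical shift by half a
  period of the Dirichlet kernel bounds it by the local supremum of \<open>f\<close> plus \<open>log n\<close> times its local
  modulus of continuity at scale \<open>1/n\<close> (\<open>dirichlet_oscillation\<close>, \<open>kernel_integral_bound\<close>). Together this
  bounds \<open>f\<^sub>N\<close> locally (\<open>projection_local_bound\<close>). Finally, trigonometric polynomials of period \<open>2 T\<close>
  are dense, simultaneously in \<open>L\<^sup>2(-1, 1)\<close> and uniformly where \<open>f\<close> is continuous (\<open>H_dense_local\<close>).
  Such a polynomial \<open>q\<close> is its own projection, so \<open>f - f\<^sub>N = (f - q) - (f - q)\<^sub>N\<close> for large \<open>N\<close>, and the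
  local bound applied to \<open>f - q\<close> makes the right-hand side small.
\<close>

section \<open>The Dirichlet kernel and the cosine kernel\<close>

text \<open>The Dirichlet kernel \<open>sin ((m + 1/2) t) / sin (t/2)\<close>, written as a sum so that it is also defined at
  the zeros of the denominator.\<close>

definition dirichlet :: "nat \<Rightarrow> real \<Rightarrow> real" where
  "dirichlet m t = 1 + 2 * (\<Sum>j=1..m. cos (real j * t))"

text \<open>The reproducing kernel of \<open>span {1, cos \<phi>, \<dots>, cos (m \<phi>)}\<close> in \<open>L\<^sup>2(0, \<pi>)\<close>, multiplied by \<open>\<pi>\<close>. In the
  variables \<open>cos u\<close>, \<open>cos v\<close> it is the Christoffel--Darboux kernel of the Chebyshev polynomials.\<close>

definition cos_kernel :: "nat \<Rightarrow> real \<Rightarrow> real \<Rightarrow> real" where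
  "cos_kernel m u v = 1 + 2 * (\<Sum>j=1..m. cos (real j * u) * cos (real j * v))"

lemma cos_kernel_Suc:
  "cos_kernel (Suc m) u v = cos_kernel m u v + 2 * (cos (real (Suc m) * u) * cos (real (Suc m) * v))"
  by (simp add: cos_kernel_def algebra_simps)

lemma cos_kernel_dirichlet:
  "2 * cos_kernel m u v = dirichlet m (u - v) + dirichlet m (u + v)"
proof -
  have "2 * (cos (real j * u) * cos (real j * v)) = cos (real j * (u - v)) + cos (real j * (u + v))" for j
    by (simp add: cos_add cos_diff ring_distribs)
  hence "(\<Sum>j=1..m. 2 * (cos (real j * u) * cos (real j * v)))
     = (\<Sum>j=1..m. cos (real j * (u - v))) + (\<Sum>j=1..m. cos (real j * (u + v)))"
    by (simp add: sum.distrib)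
  thus ?thesis
    unfolding cos_kernel_def dirichlet_def by (simp flip: sum_distrib_left)
qed

lemma abs_dirichlet_le: "\<bar>dirichlet m t\<bar> \<le> 2 * real m + 1"
proof -
  have "\<bar>\<Sum>j=1..m. cos (real j * t)\<bar> \<le> (\<Sum>j=1..m. \<bar>cos (real j * t)\<bar>)"
    by (rule sum_abs)
  also have "\<dots> \<le> (\<Sum>j=1..m. 1)"
    by (intro sum_mono) simp
  finally show ?thesis by (simp add: dirichlet_def)
qed

lemma sin_half_times_dirichlet: "sin (t / 2) * dirichlet m t = sin ((real m + 1/2) * t)"
proof (induction m)
  case 0 show ?case by (simp add: dirichlet_def)
next
  case (Suc m)
  have "dirichlet (Suc m) t = dirichlet m t + 2 * cos (real (Suc m) * t)"
    by (simp add: dirichlet_def algebra_simps)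
  hence "sin (t / 2) * dirichlet (Suc m) t
        = sin ((real m + 1/2) * t) + 2 * sin (t / 2) * cos (real (Suc m) * t)"
    using Suc by (simp add: algebra_simps)
  also have "(real m + 1/2) * t = real (Suc m) * t - t / 2"
    by (simp add: algebra_simps)
  also have "sin (real (Suc m) * t - t / 2) + 2 * sin (t / 2) * cos (real (Suc m) * t)
        = sin (real (Suc m) * t + t / 2)"
    by (simp only: sin_diff sin_add) simp
  also have "real (Suc m) * t + t / 2 = (real (Suc m) + 1/2) * t"
    by (simp add: algebra_simps)
  finally show ?case .
qed

text \<open>The Christoffel--Darboux formula for the Chebyshev polynomials of the first kind.\<close>

lemma cos_kernel_Christoffel_Darboux:
  "(cos u - cos v) * cos_kernel m u v
     = cos (real (Suc m) * u) * cos (real m * v) - cos (real m * u) * cos (real (Suc m) * v)"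
proof (induction m)
  case 0 show ?case by (simp add: cos_kernel_def)
next
  case (Suc m)
  have rec: "2 * cos w * cos (real (Suc m) * w) = cos (real (Suc (Suc m)) * w) + cos (real m * w)" for w
  proof -
    have "real (Suc (Suc m)) * w = real (Suc m) * w + w" "real m * w = real (Suc m) * w - w"
      by (simp_all add: algebra_simps)
    thus ?thesis by (simp only: cos_add cos_diff) simp
  qed
  have "(cos u - cos v) * cos_kernel (Suc m) u v = (cos u - cos v) * cos_kernel m u v
        + (2 * cos u * cos (real (Suc m) * u)) * cos (real (Suc m) * v)
        - (2 * cos v * cos (real (Suc m) * v)) * cos (real (Suc m) * u)"
    by (simp add: cos_kernel_Suc algebra_simps)
  thus ?case
    unfolding rec Suc.IH by (simp add: algebra_simps)
qed

lemma cos_kernel_bound: "\<bar>cos u - cos v\<bar> * \<bar>cos_kernel m u v\<bar> \<le> 2"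
proof -
  have b: "\<bar>cos x * cos y\<bar> \<le> 1" for x y :: real
    by (simp add: abs_mult mult_le_one)
  show ?thesis
    unfolding abs_mult[symmetric] cos_kernel_Christoffel_Darboux
    using b[of "real (Suc m) * u" "real m * v"] b[of "real m * u" "real (Suc m) * v"] by linarith
qed

lemma cos_kernel_add2_diff: "\<bar>cos_kernel (m + 2) u v - cos_kernel m u v\<bar> \<le> 4"
proof -
  have b: "\<bar>cos x * cos y\<bar> \<le> 1" for x y :: real
    by (simp add: abs_mult mult_le_one)
  show ?thesis
    using cos_kernel_Suc[of "Suc m" u v] cos_kernel_Suc[of m u v]
      b[of "real (Suc m) * u" "real (Suc m) * v"] b[of "real (Suc (Suc m)) * u" "real (Suc (Suc m)) * v"]
    by simp
qed

lemma continuous_on_cos_kernel [continuous_intros]: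
  fixes f g :: "'a::t2_space \<Rightarrow> real"
  assumes "continuous_on S f" "continuous_on S g"
  shows "continuous_on S (\<lambda>x. cos_kernel m (f x) (g x))"
  unfolding cos_kernel_def by (intro continuous_intros assms)

lemma continuous_on_dirichlet [continuous_intros]:
  fixes f :: "'a::t2_space \<Rightarrow> real"
  assumes "continuous_on S f"
  shows "continuous_on S (\<lambda>x. dirichlet m (f x))"
  unfolding dirichlet_def by (intro continuous_intros assms)

lemma abs_sin_diff_le: "\<bar>sin w - sin z\<bar> \<le> \<bar>w - z\<bar>" for w z :: real
proof -
  have "\<bar>sin w - sin z\<bar> = 2 * \<bar>sin ((w - z) / 2)\<bar> * \<bar>cos ((w + z) / 2)\<bar>"
    by (simp add: sin_diff_sin abs_mult)
  also have "\<dots> \<le> 2 * \<bar>(w - z) / 2\<bar> * 1"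
    by (intro mult_mono abs_sin_x_le_abs_x) auto
  finally show ?thesis by simp
qed

lemma sin_half_ge: 
  assumes "0 \<le> t" "t \<le> pi" shows "t / pi \<le> sin (t / 2)"
proof -
  have c: "concave_on {0..pi} sin"
  proof -
    have "convex_on {0..pi} (\<lambda>x. - sin x)"
    proof (rule f''_ge0_imp_convex)
      show "convex {0..pi}" by simp
      show "((\<lambda>x. - sin x) has_real_derivative - cos x) (at x)" for x :: real
        by (auto intro!: derivative_eq_intros)
      show "((\<lambda>x. - cos x) has_real_derivative sin x) (at x)" for x :: real
        by (auto intro!: derivative_eq_intros)
      show "0 \<le> sin x" if "x \<in> {0..pi}" for x :: real using that by (simp add: sin_ge_zero)
    qed
    thus ?thesis by (simp add: concave_on_def)
  qed
  have "sin ((1 - t / pi) *\<^sub>R 0 + (t / pi) *\<^sub>R (pi / 2)) \<ge> (1 - t / pi) * sin 0 + (t / pi) * sin (pi / 2)"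
    using assms by (intro concave_onD[OF c]) (auto simp: field_simps)
  thus ?thesis by simp
qed

text \<open>The kernel alone has integral norm of order \<open>log m\<close>. The lemma replaces the factor \<open>\<epsilon>\<close> of this
  logarithm by the modulus of continuity \<open>W\<close> of \<open>G\<close> at the scale of half a period \<open>h\<close> of
  \<open>sin ((m + 1/2) t)\<close>: a shift by \<open>h\<close> changes the sign of the sine, so that twice the integral
  is the integral of the sine against a difference of the remaining factor at two points at distance
  \<open>h\<close>, up to short end pieces.\<close>

lemma dirichlet_oscillation:
  fixes G :: "real \<Rightarrow> complex"
  assumes cont: "continuous_on {0..\<eta>} G" and \<eta>: "0 < \<eta>" "\<eta> \<le> 1"
    and bd: "\<And>t. t \<in> {0..\<eta>} \<Longrightarrow> norm (G t) \<le> \<epsilon>"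
    and osc: "\<And>t t'. t \<in> {0..\<eta>} \<Longrightarrow> t' \<in> {0..\<eta>} \<Longrightarrow> \<bar>t - t'\<bar> \<le> pi / (real m + 1/2) \<Longrightarrow> norm (G t - G t') \<le> W"
  shows "norm (integral {0..\<eta>} (\<lambda>t. dirichlet m t *\<^sub>R G t)) \<le> 4 * pi * \<epsilon> + pi * W * ln (real m + 2)"
proof -
  define M where "M = real m + 1/2"
  define h where "h = pi / M"
  have M0: "M > 0" by (simp add: M_def)
  have h0: "h > 0" using M0 by (simp add: h_def)
  have e0: "\<epsilon> \<ge> 0" using bd[of 0] \<eta> norm_ge_zero[of "G 0"] by (auto simp del: norm_ge_zero)
  have W0: "W \<ge> 0" using osc[of 0 0] \<eta> by auto
  have l0: "ln (real m + 2) \<ge> 0" by simp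
  have Dbound: "norm (integral {0..c} (\<lambda>t. dirichlet m t *\<^sub>R G t)) \<le> 2 * pi * (c / h) * \<epsilon>"
    if c: "0 \<le> c" "c \<le> \<eta>" for c
  proof -
    have "norm (integral {0..c} (\<lambda>t. dirichlet m t *\<^sub>R G t)) \<le> ((2 * real m + 1) * \<epsilon>) * (c - 0)"
    proof (rule integral_bound)
      show "continuous_on {0..c} (\<lambda>t. dirichlet m t *\<^sub>R G t)"
        by (intro continuous_intros continuous_on_subset[OF cont]) (use c in auto)
      show "norm (dirichlet m t *\<^sub>R G t) \<le> (2 * real m + 1) * \<epsilon>" if "t \<in> {0..c}" for t
        using that c abs_dirichlet_le[of m t] bd[of t] by (auto intro!: mult_mono)
    qed (use c in auto)
    also have "\<dots> = 2 * pi * (c / h) * \<epsilon>"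
      by (simp add: h_def M_def field_simps)
    finally show ?thesis .
  qed
  show ?thesis
  proof (cases "\<eta> \<le> 2 * h")
    case True
    hence "\<eta> / h \<le> 2" using h0 by (simp add: field_simps)
    have "2 * pi * (\<eta> / h) * \<epsilon> \<le> 2 * pi * 2 * \<epsilon>"
      by (intro mult_right_mono mult_left_mono) (use \<open>\<eta> / h \<le> 2\<close> e0 in auto)
    with Dbound[of \<eta>] \<eta> have "norm (integral {0..\<eta>} (\<lambda>t. dirichlet m t *\<^sub>R G t)) \<le> 4 * pi * \<epsilon>" by auto
    moreover have "pi * W * ln (real m + 2) \<ge> 0" using W0 l0 by simp
    ultimately show ?thesis by linarith
  next
    case False
    define k where "k = (\<lambda>t::real. 1 / sin (t / 2))"
    define u where "u = (\<lambda>t. k t *\<^sub>R G t)"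
    define v where "v = (\<lambda>t. sin (M * t) *\<^sub>R u t)"
    have \<eta>pi: "t \<le> pi" if "t \<le> \<eta>" for t using that \<eta> pi_gt3 by linarith
    have sinpos: "sin (t / 2) > 0" if "t \<in> {h..\<eta>}" for t
      using that h0 \<eta>pi[of t] by (intro sin_gt_zero) auto
    have kle: "k t \<le> pi / t" if "t \<in> {h..\<eta>}" for t
    proof -
      have t: "t > 0" "t \<le> pi" using that h0 \<eta>pi by auto
      have "1 / sin (t / 2) \<le> 1 / (t / pi)"
        by (rule divide_left_mono) (use sin_half_ge[of t] sinpos[OF that] t in auto)
      thus ?thesis by (simp add: k_def)
    qed
    have kpos: "k t > 0" if "t \<in> {h..\<eta>}" for t using sinpos[OF that] by (simp add: k_def)
    have ccu: "continuous_on {h..\<eta>} u"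
      unfolding u_def k_def
      by (intro continuous_intros continuous_on_subset[OF cont]) (use h0 sinpos in force)+
    have ccv: "continuous_on {h..\<eta>} v"
      unfolding v_def by (intro continuous_intros ccu)
    have ule: "norm (u t) \<le> pi * \<epsilon> / h" if "t \<in> {h..\<eta>}" for t
    proof -
      have "norm (u t) \<le> (pi / t) * \<epsilon>"
        unfolding u_def norm_scaleR
        by (intro mult_mono) (use kpos[OF that] kle[OF that] bd[of t] that h0 in auto)
      also have "\<dots> \<le> (pi / h) * \<epsilon>"
        by (intro mult_right_mono divide_left_mono) (use that h0 e0 in auto)
      finally show ?thesis by (simp add: field_simps)
    qed
    have sinshift: "sin (M * (t + h)) = - sin (M * t)" for t
    proof -
      have "M * (t + h) = M * t + pi" using M0 by (simp add: h_def field_simps)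
      thus ?thesis by simp
    qed
    have vle: "norm (v t) \<le> pi * \<epsilon> / h" if "t \<in> {h..\<eta>}" for t
    proof -
      have "norm (v t) \<le> 1 * (pi * \<epsilon> / h)"
        unfolding v_def norm_scaleR by (intro mult_mono ule that) auto
      thus ?thesis by simp
    qed
    have le: "h \<le> \<eta> - h" using False by simp
    have shift: "integral {h..\<eta>} v = - integral {0..\<eta> - h} (\<lambda>t. sin (M * t) *\<^sub>R u (t + h))"
    proof -
      have "integral {0 + h..\<eta> - h + h} v = integral {0..\<eta> - h} (v \<circ> (\<lambda>x. x + h))"
        by (rule integral_shift[symmetric]) (use ccv in simp)
      also have "(v \<circ> (\<lambda>x. x + h)) = (\<lambda>t. - (sin (M * t) *\<^sub>R u (t + h)))"
        by (auto simp: v_def sinshift)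
      finally show ?thesis by simp
    qed
    have ccs: "continuous_on {0..\<eta>-h} (\<lambda>t. sin (M * t) *\<^sub>R u (t + h))"
      by (intro continuous_intros continuous_on_compose2[OF ccu]) auto
    have int_v: "v integrable_on {h..\<eta>}" using ccv by (rule integrable_continuous_real)
    have split1: "integral {h..\<eta>} v = integral {h..\<eta>-h} v + integral {\<eta>-h..\<eta>} v"
      by (rule Henstock_Kurzweil_Integration.integral_combine[symmetric]) (use le h0 int_v in auto)
    have split2: "integral {0..\<eta>-h} (\<lambda>t. sin (M * t) *\<^sub>R u (t + h))
        = integral {0..h} (\<lambda>t. sin (M * t) *\<^sub>R u (t + h)) + integral {h..\<eta>-h} (\<lambda>t. sin (M * t) *\<^sub>R u (t + h))"
      by (rule Henstock_Kurzweil_Integration.integral_combine[symmetric])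
         (use le h0 integrable_continuous_real[OF ccs] in auto)
    have i1: "v integrable_on {h..\<eta>-h}"
      by (rule integrable_continuous_real continuous_on_subset[OF ccv])+ (use h0 in auto)
    have i2: "(\<lambda>t. sin (M * t) *\<^sub>R u (t + h)) integrable_on {h..\<eta>-h}"
      by (rule integrable_continuous_real continuous_on_subset[OF ccs])+ (use h0 in auto)
    have two: "2 * integral {h..\<eta>} v = integral {h..\<eta>-h} (\<lambda>t. v t - sin (M * t) *\<^sub>R u (t + h))
        + integral {\<eta>-h..\<eta>} v - integral {0..h} (\<lambda>t. sin (M * t) *\<^sub>R u (t + h))"
    proof -
      have "2 * integral {h..\<eta>} v = integral {h..\<eta>} v + integral {h..\<eta>} v" by simp
      also have "\<dots> = (integral {h..\<eta>-h} v + integral {\<eta>-h..\<eta>} v)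
          - (integral {0..h} (\<lambda>t. sin (M * t) *\<^sub>R u (t + h)) + integral {h..\<eta>-h} (\<lambda>t. sin (M * t) *\<^sub>R u (t + h)))"
        by (metis split1 shift split2 diff_conv_add_uminus)
      finally show ?thesis
        unfolding Henstock_Kurzweil_Integration.integral_diff[OF i1 i2] by simp
    qed
    have b1: "norm (integral {\<eta>-h..\<eta>} v) \<le> pi * \<epsilon>"
    proof -
      have "norm (integral {\<eta>-h..\<eta>} v) \<le> (pi * \<epsilon> / h) * (\<eta> - (\<eta> - h))"
        by (rule integral_bound) (use h0 le in \<open>auto intro!: vle continuous_on_subset[OF ccv]\<close>)
      thus ?thesis using h0 by simp
    qed
    have b2: "norm (integral {0..h} (\<lambda>t. sin (M * t) *\<^sub>R u (t + h))) \<le> pi * \<epsilon>"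
    proof -
      have "norm (integral {0..h} (\<lambda>t. sin (M * t) *\<^sub>R u (t + h))) \<le> (pi * \<epsilon> / h) * (h - 0)"
      proof (rule integral_bound)
        show "continuous_on {0..h} (\<lambda>t. sin (M * t) *\<^sub>R u (t + h))"
          by (rule continuous_on_subset[OF ccs]) (use le in auto)
        fix t assume t: "t \<in> {0..h}"
        have "norm (sin (M * t) *\<^sub>R u (t + h)) \<le> 1 * (pi * \<epsilon> / h)"
          unfolding norm_scaleR by (intro mult_mono ule) (use t le in auto)
        thus "norm (sin (M * t) *\<^sub>R u (t + h)) \<le> pi * \<epsilon> / h" by simp
      qed (use h0 in auto)
      thus ?thesis using h0 by simp
    qed
    have b3: "norm (integral {h..\<eta>-h} (\<lambda>t. v t - sin (M * t) *\<^sub>R u (t + h)))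
        \<le> pi * W * ln (real m + 2) + \<epsilon> * pi\<^sup>2 / 2"
    proof -
      \<comment> \<open>\<open>B\<close> dominates the difference: the first term comes from the modulus of \<open>G\<close>, the second
        from the variation of \<open>k\<close>, and the latter has a bounded integral.\<close>
      define B where "B = (\<lambda>t. pi * W / t + \<epsilon> * pi\<^sup>2 * h / 2 / t\<^sup>2)"
      have "(B has_integral ((pi * W * ln (\<eta>-h) - \<epsilon> * pi\<^sup>2 * h / 2 / (\<eta>-h)) -
                   (pi * W * ln h - \<epsilon> * pi\<^sup>2 * h / 2 / h))) {h..\<eta>-h}"
        by (rule fundamental_theorem_of_calculus[OF le])
           (use h0 in \<open>auto intro!: derivative_eq_intros simp: has_real_derivative_iff_has_vector_derivative[symmetric] B_def field_simps power2_eq_square\<close>)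
      hence Bint: "B integrable_on {h..\<eta>-h}" and
        Bval: "integral {h..\<eta>-h} B = pi * W * (ln (\<eta>-h) - ln h) - \<epsilon> * pi\<^sup>2 * h / 2 / (\<eta>-h) + \<epsilon> * pi\<^sup>2 / 2"
        using h0 by (auto simp: has_integral_integrable_integral field_simps)
      have "norm (integral {h..\<eta>-h} (\<lambda>t. v t - sin (M * t) *\<^sub>R u (t + h))) \<le> integral {h..\<eta>-h} B"
      proof (rule integral_norm_bound_integral)
        show "(\<lambda>t. v t - sin (M * t) *\<^sub>R u (t + h)) integrable_on {h..\<eta>-h}"
          using integrable_diff[OF i1 i2] .
        fix t assume t: "t \<in> {h..\<eta>-h}"
        have t1: "t \<in> {h..\<eta>}" "t + h \<in> {h..\<eta>}" "t > 0" using t h0 by auto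
        have kd: "\<bar>k t - k (t + h)\<bar> \<le> pi\<^sup>2 * h / 2 / t\<^sup>2"
        proof -
          have "\<bar>sin ((t + h) / 2) - sin (t / 2)\<bar> \<le> \<bar>(t + h) / 2 - t / 2\<bar>"
            by (rule abs_sin_diff_le)
          hence s: "\<bar>sin ((t + h) / 2) - sin (t / 2)\<bar> \<le> h / 2" using h0 by (simp add: field_simps)
          have "k t - k (t + h) = (sin ((t + h) / 2) - sin (t / 2)) * (k t * k (t + h))"
            using sinpos[OF t1(1)] sinpos[OF t1(2)] unfolding k_def by (simp add: field_simps)
          hence "\<bar>k t - k (t + h)\<bar> = \<bar>sin ((t + h) / 2) - sin (t / 2)\<bar> * (k t * k (t + h))"
            using kpos[OF t1(1)] kpos[OF t1(2)] by (simp add: abs_mult)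
          also have "\<dots> \<le> (h / 2) * ((pi / t) * (pi / t))"
          proof (intro mult_mono s)
            show "k t \<le> pi / t" by (rule kle[OF t1(1)])
            have "k (t + h) \<le> pi / (t + h)" by (rule kle[OF t1(2)])
            also have "\<dots> \<le> pi / t" by (rule divide_left_mono) (use h0 t1 in auto)
            finally show "k (t + h) \<le> pi / t" .
          qed (use h0 kpos[OF t1(1)] kpos[OF t1(2)] t1 in \<open>auto intro!: mult_nonneg_nonneg\<close>)
          finally show ?thesis by (simp add: power2_eq_square field_simps)
        qed
        have "v t - sin (M * t) *\<^sub>R u (t + h) =
            sin (M * t) *\<^sub>R (k t *\<^sub>R (G t - G (t + h)) + (k t - k (t + h)) *\<^sub>R G (t + h))"
          by (simp add: v_def u_def algebra_simps)
        also have "norm \<dots> \<le> 1 * (pi / t * W + (pi\<^sup>2 * h / 2 / t\<^sup>2) * \<epsilon>)"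
          unfolding norm_scaleR
        proof (intro mult_mono norm_triangle_le)
          have "norm (k t *\<^sub>R (G t - G (t + h))) \<le> pi / t * W"
            unfolding norm_scaleR
            by (intro mult_mono) (use kle[OF t1(1)] kpos[OF t1(1)] t1 t h0 in \<open>auto intro!: osc simp: h_def M_def\<close>)
          moreover have "norm ((k t - k (t + h)) *\<^sub>R G (t + h)) \<le> (pi\<^sup>2 * h / 2 / t\<^sup>2) * \<epsilon>"
            unfolding norm_scaleR
            by (intro mult_mono kd bd) (use t h0 in auto)
          ultimately show "norm (k t *\<^sub>R (G t - G (t + h))) + norm ((k t - k (t + h)) *\<^sub>R G (t + h))
            \<le> pi / t * W + (pi\<^sup>2 * h / 2 / t\<^sup>2) * \<epsilon>" by linarith
        qed auto
        finally show "norm (v t - sin (M * t) *\<^sub>R u (t + h)) \<le> B t"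
          by (simp add: B_def field_simps)
      qed (rule Bint)
      also have "\<dots> \<le> pi * W * ln (real m + 2) + \<epsilon> * pi\<^sup>2 / 2"
      proof -
        have "ln (\<eta> - h) \<le> ln 1" by (subst ln_le_cancel_iff) (use \<eta> h0 le in auto)
        moreover have "- ln h \<le> ln (real m + 2)"
        proof -
          have "- ln h = ln (inverse h)" using h0 by (simp add: ln_inverse)
          also have "inverse h = M / pi" by (simp add: h_def)
          also have "ln (M / pi) \<le> ln (real m + 2)"
          proof (subst ln_le_cancel_iff)
            have "M / pi \<le> M / 1" by (rule divide_left_mono) (use pi_gt3 M0 in auto)
            thus "M / pi \<le> real m + 2" by (simp add: M_def)
          qed (use M0 in auto)
          finally show ?thesis .
        qed
        ultimately have "ln (\<eta>-h) - ln h \<le> ln (real m + 2)" by simp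
        hence "pi * W * (ln (\<eta>-h) - ln h) \<le> pi * W * ln (real m + 2)"
          by (intro mult_left_mono) (use W0 in auto)
        moreover have "\<epsilon> * pi\<^sup>2 * h / 2 / (\<eta>-h) \<ge> 0" using e0 h0 le by auto
        ultimately show ?thesis unfolding Bval by linarith
      qed
      finally show ?thesis .
    qed
    have "2 * norm (integral {h..\<eta>} v) = norm (2 * integral {h..\<eta>} v)" by (simp add: norm_mult)
    also have "\<dots> \<le> (pi * W * ln (real m + 2) + \<epsilon> * pi\<^sup>2 / 2) + pi * \<epsilon> + pi * \<epsilon>"
      unfolding two by (intro norm_triangle_le_diff norm_triangle_le add_mono b1 b2 b3) 
    finally have far: "norm (integral {h..\<eta>} v) \<le> pi * W * ln (real m + 2) / 2 + \<epsilon> * pi\<^sup>2 / 4 + pi * \<epsilon>" by simp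
    have "integral {0..\<eta>} (\<lambda>t. dirichlet m t *\<^sub>R G t)
        = integral {0..h} (\<lambda>t. dirichlet m t *\<^sub>R G t) + integral {h..\<eta>} (\<lambda>t. dirichlet m t *\<^sub>R G t)"
      by (rule Henstock_Kurzweil_Integration.integral_combine[symmetric])
         (use le h0 in \<open>auto intro!: integrable_continuous_real continuous_intros cont\<close>)
    also have "integral {h..\<eta>} (\<lambda>t. dirichlet m t *\<^sub>R G t) = integral {h..\<eta>} v"
    proof (rule integral_cong)
      fix t assume t: "t \<in> {h..\<eta>}"
      have "dirichlet m t = sin (M * t) * k t"
        using sin_half_times_dirichlet[of t m] sinpos[OF t] by (simp add: k_def M_def field_simps)
      thus "dirichlet m t *\<^sub>R G t = v t" by (simp add: v_def u_def)
    qed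
    finally have "norm (integral {0..\<eta>} (\<lambda>t. dirichlet m t *\<^sub>R G t))
       \<le> 2 * pi * (h / h) * \<epsilon> + (pi * W * ln (real m + 2) / 2 + \<epsilon> * pi\<^sup>2 / 4 + pi * \<epsilon>)"
      using Dbound[of h] far h0 le by (auto intro!: norm_triangle_le)
    also have "\<dots> \<le> 4 * pi * \<epsilon> + pi * W * ln (real m + 2)"
    proof -
      have "pi\<^sup>2 \<le> 4 * pi" using pi_less_4 by (simp add: power2_eq_square)
      hence "\<epsilon> * pi\<^sup>2 \<le> \<epsilon> * (4 * pi)" using e0 by (intro mult_left_mono) auto
      moreover have "pi * W * ln (real m + 2) \<ge> 0" using W0 l0 by simp
      ultimately show ?thesis using h0 by (simp add: algebra_simps)
    qed
    finally show ?thesis .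
  qed
qed

section \<open>Reproducing property of the cosine kernel\<close>

lemma integral_cos_nat:
  "((\<lambda>v. cos (real n * v)) has_integral (if n = 0 then pi else 0)) {0..pi}"
proof (cases "n = 0")
  case True
  thus ?thesis using has_integral_const_real[of "1::real" 0 pi] by simp
next
  case False
  have "((\<lambda>v. cos (real n * v)) has_integral (sin (real n * pi) / real n - sin (real n * 0) / real n)) {0..pi}"
    by (rule fundamental_theorem_of_calculus)
       (use False in \<open>auto intro!: derivative_eq_intros simp: has_real_derivative_iff_has_vector_derivative[symmetric]\<close>)
  thus ?thesis using False by simp
qed

lemma integral_cos_cos:
  "((\<lambda>v. cos (real i * v) * cos (real j * v)) has_integral
      (if i = j then if i = 0 then pi else pi / 2 else 0)) {0..pi}"
proof -
  define d where "d = (if i \<le> j then j - i else i - j)"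
  have prod: "cos (real i * v) * cos (real j * v) = (cos (real (i + j) * v) + cos (real d * v)) / 2" for v
  proof -
    have "cos (real d * v) = cos (real i * v - real j * v)"
    proof (cases "i \<le> j")
      case True
      hence "real d * v = - (real i * v - real j * v)" by (simp add: d_def of_nat_diff algebra_simps)
      thus ?thesis by (simp only: cos_minus)
    next
      case False
      hence "real d * v = real i * v - real j * v" by (simp add: d_def of_nat_diff algebra_simps)
      thus ?thesis by (simp only:)
    qed
    moreover have "cos (real (i + j) * v) = cos (real i * v + real j * v)" by (simp add: algebra_simps)
    ultimately show ?thesis by (simp only: cos_add cos_diff) simp
  qed
  have int: "((\<lambda>v. (cos (real (i + j) * v) + cos (real d * v)) / 2) has_integral
       ((if i + j = 0 then pi else 0) + (if d = 0 then pi else 0)) / 2) {0..pi}"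
    by (intro has_integral_divide has_integral_add integral_cos_nat)
  have val: "((if i + j = 0 then pi else 0) + (if d = 0 then pi else 0)) / 2
      = (if i = j then if i = 0 then pi else pi / 2 else 0)" by (auto simp: d_def)
  show ?thesis unfolding prod using int unfolding val .
qed

lemma cos_kernel_reproduces:
  assumes "i \<le> m"
  shows "((\<lambda>v. cos (real i * v) * cos_kernel m u v) has_integral pi * cos (real i * u)) {0..pi}"
proof -
  have "((\<lambda>v. cos (real i * v) * cos (real 0 * v) + 2 * (\<Sum>j=1..m. cos (real j * u) * (cos (real i * v) * cos (real j * v))))
     has_integral ((if i = 0 then if i = 0 then pi else pi / 2 else 0)
       + 2 * (\<Sum>j=1..m. cos (real j * u) * (if i = j then if i = 0 then pi else pi / 2 else 0)))) {0..pi}"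
    by (intro has_integral_add has_integral_mult_right has_integral_sum integral_cos_cos) auto
  moreover have "cos (real i * v) * cos (real 0 * v) + 2 * (\<Sum>j=1..m. cos (real j * u) * (cos (real i * v) * cos (real j * v)))
     = cos (real i * v) * cos_kernel m u v" for v
    by (simp add: cos_kernel_def algebra_simps sum_distrib_left)
  moreover have "(if i = 0 then if i = 0 then pi else pi / 2 else 0)
       + 2 * (\<Sum>j=1..m. cos (real j * u) * (if i = j then if i = 0 then pi else pi / 2 else 0)) = pi * cos (real i * u)"
  proof -
    have "(\<Sum>j=1..m. cos (real j * u) * (if i = j then if i = 0 then pi else pi / 2 else 0))
       = (\<Sum>j=1..m. if i = j then cos (real j * u) * (pi / 2) else 0)"
      by (intro sum.cong) auto
    also have "\<dots> = (if i \<in> {1..m} then cos (real i * u) * (pi / 2) else 0)"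
      by (rule sum.delta'[OF finite_atLeastAtMost])
    finally show ?thesis using assms by auto
  qed
  ultimately show ?thesis by simp
qed

text \<open>The factor \<open>sin\<^sup>2\<close> raises the degree by two only. It compensates the singularity of the
  measure \<open>d\<phi>\<close> at the endpoints when \<open>\<phi>\<close> is replaced by the original variable.\<close>

lemma cos_kernel_reproduces_sin_squared:
  assumes "i \<le> m"
  shows "((\<lambda>v. (sin v)\<^sup>2 * cos (real i * v) * cos_kernel (m + 2) u v)
           has_integral pi * ((sin u)\<^sup>2 * cos (real i * u))) {0..pi}"
proof -
  define i' where "i' = (if i \<ge> 2 then i - 2 else if i = 1 then 1 else 2)"
  have i': "i' \<le> m + 2" using assms by (auto simp: i'_def)
  have eq: "(sin v)\<^sup>2 * cos (real i * v)
      = cos (real i * v) / 2 - (cos (real (i + 2) * v) + cos (real i' * v)) / 4" for v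
  proof -
    have "cos (real i' * v) = cos (real i * v - 2 * v)"
    proof -
      consider "i = 0" | "i = 1" | "i \<ge> 2" by linarith
      thus ?thesis
      proof cases
        case 1 thus ?thesis by (simp add: i'_def)
      next
        case 2
        hence "real i * v - 2 * v = - v" by simp
        thus ?thesis using 2 by (simp add: i'_def)
      next
        case 3
        hence "real i' * v = real i * v - 2 * v" by (simp add: i'_def of_nat_diff algebra_simps)
        thus ?thesis by (simp only:)
      qed
    qed
    moreover have "cos (real (i + 2) * v) = cos (real i * v + 2 * v)" by (simp add: algebra_simps)
    ultimately have A: "cos (real (i + 2) * v) + cos (real i' * v) = 2 * cos (real i * v) * cos (2 * v)"
      by (simp only: cos_add cos_diff)
    have B: "(sin v)\<^sup>2 = (1 - cos (2 * v)) / 2" by (simp add: cos_double_sin)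
    show ?thesis unfolding A B by (simp add: field_simps)
  qed
  have "((\<lambda>v. (cos (real i * v) * cos_kernel (m + 2) u v) / 2
      - ((cos (real (i + 2) * v) * cos_kernel (m + 2) u v) + (cos (real i' * v) * cos_kernel (m + 2) u v)) / 4)
      has_integral (pi * cos (real i * u)) / 2 - (pi * cos (real (i + 2) * u) + pi * cos (real i' * u)) / 4) {0..pi}"
    by (intro has_integral_diff has_integral_divide has_integral_add cos_kernel_reproduces) (use assms i' in auto)
  thus ?thesis unfolding eq by (simp add: field_simps)
qed

section \<open>A change of variables adapted to the extension problem\<close>

text \<open>The geometry for a fixed \<open>T > 1\<close>. The substitution \<open>sin (\<pi> x / 2 T) = sin (\<pi> / 2 T) cos \<phi>\<close> maps
  \<open>[-1, 1]\<close> to \<open>[0, \<pi>]\<close>, reversing the orientation.\<close>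

locale extension =
  fixes T :: real
  assumes T_gt_1: "T > 1"
begin

text \<open>Half of the fundamental frequency \<open>\<pi> / T\<close>; it lies strictly between \<open>0\<close> and \<open>\<pi> / 2\<close>.\<close>

definition al where "al = pi / (2 * T)"

text \<open>The modulus of the substitution.\<close>

definition kk where "kk = sin al"

text \<open>The sine variable, scaled so that it maps \<open>[-1, 1]\<close> onto itself.\<close>

definition s where "s x = sin (al * x) / kk"

text \<open>The cosine that accompanies \<open>s\<close>; it is bounded away from zero on \<open>[-1, 1]\<close>, and this uses \<open>T > 1\<close>.\<close>

definition rho where "rho x = cos (al * x)"

text \<open>The angle \<open>\<phi>\<close> as a function of the original variable.\<close>

definition th where "th x = arccos (s x)"

text \<open>The sine of that angle, which vanishes exactly at the endpoints of \<open>[-1, 1]\<close>.\<close>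

definition sg where "sg x = sqrt (1 - (s x)\<^sup>2)"

text \<open>The original variable as a function of the angle; it inverts \<open>th\<close> and is smooth on the whole line.\<close>

definition X where "X \<phi> = arcsin (kk * cos \<phi>) / al"

lemma al: "0 < al" "al < pi / 2"
  using T_gt_1 by (auto simp: al_def field_simps)

lemma kk: "0 < kk" "kk < 1" "cos al > 0"
proof -
  show "0 < kk" unfolding kk_def using al by (intro sin_gt_zero) auto
  show c: "cos al > 0" using al by (intro cos_gt_zero_pi) auto
  show "kk < 1"
    unfolding kk_def using sin_monotone_2pi[of al "pi/2"] al by simp
qed

lemma abs_al_le: "x \<in> {-1..1} \<Longrightarrow> \<bar>al * x\<bar> \<le> al"
  using al by (auto simp: abs_mult)

lemma al_range: assumes "x \<in> {-1..1}" shows "- al \<le> al * x" "al * x \<le> al"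
  using abs_al_le[OF assms] by auto

lemma abs_s_le: assumes "x \<in> {-1..1}" shows "\<bar>s x\<bar> \<le> 1"
proof -
  have "sin (al * x) \<le> sin al"
    by (rule sin_monotone_2pi_le) (use al_range[OF assms] al in linarith)+
  moreover have "sin (- al) \<le> sin (al * x)"
    by (rule sin_monotone_2pi_le) (use al_range[OF assms] al in linarith)+
  ultimately show ?thesis using kk unfolding s_def kk_def by (auto simp: abs_le_iff field_simps)
qed

lemma rho_ge: assumes "x \<in> {-1..1}" shows "rho x \<ge> cos al"
proof -
  have "cos \<bar>al * x\<bar> \<ge> cos al" using abs_al_le[OF assms] al by (intro cos_monotone_0_pi_le) auto
  thus ?thesis by (simp add: rho_def)
qed

lemma rho_pos: "x \<in> {-1..1} \<Longrightarrow> rho x > 0"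
  using rho_ge kk(3) by fastforce

lemma rho_le_1: "rho x \<le> 1" by (simp add: rho_def)

lemma rho_squared: "(rho x)\<^sup>2 = 1 - kk\<^sup>2 * (s x)\<^sup>2"
  using kk by (simp add: rho_def s_def cos_squared_eq field_simps)

lemma s_minus [simp]: "s (- x) = - s x" and rho_minus [simp]: "rho (- x) = rho x"
  by (simp_all add: s_def rho_def)

lemma cos_th: "x \<in> {-1..1} \<Longrightarrow> cos (th x) = s x"
  using abs_s_le[of x] by (auto simp: th_def abs_le_iff intro!: cos_arccos)

lemma sin_th: "x \<in> {-1..1} \<Longrightarrow> sin (th x) = sg x"
  using abs_s_le[of x] by (auto simp: th_def sg_def abs_le_iff sin_arccos)

lemma th_range: "x \<in> {-1..1} \<Longrightarrow> th x \<in> {0..pi}"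
  using abs_s_le[of x] by (auto simp: th_def abs_le_iff intro!: arccos_lbound arccos_ubound)

lemma th_minus: "x \<in> {-1..1} \<Longrightarrow> th (- x) = pi - th x"
  using abs_s_le[of x] by (auto simp: th_def abs_le_iff arccos_minus)

lemma sg_nonneg: "x \<in> {-1..1} \<Longrightarrow> sg x \<ge> 0"
  using sin_ge_zero[of "th x"] th_range[of x] sin_th[of x] by auto

lemma sg_le_1: "x \<in> {-1..1} \<Longrightarrow> sg x \<le> 1"
  by (metis sin_th sin_le_one)

lemma sg_squared: "x \<in> {-1..1} \<Longrightarrow> (sg x)\<^sup>2 = 1 - (s x)\<^sup>2"
  using sin_th[of x] cos_th[of x] sin_squared_eq[of "th x"] by auto

lemma s_strict_mono: assumes "x \<in> {-1..1}" "y \<in> {-1..1}" "x < y" shows "s x < s y"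
proof -
  have "al * x < al * y" using assms al by simp
  hence "sin (al * x) < sin (al * y)"
    by (intro sin_monotone_2pi) (use al_range[OF assms(1)] al_range[OF assms(2)] al in linarith)+
  thus ?thesis using kk by (simp add: s_def field_simps)
qed

lemma abs_kk_cos: "\<bar>kk * cos \<phi>\<bar> \<le> kk" "\<bar>kk * cos \<phi>\<bar> < 1"
proof -
  show a: "\<bar>kk * cos \<phi>\<bar> \<le> kk" using kk by (simp add: abs_mult mult_left_le)
  show "\<bar>kk * cos \<phi>\<bar> < 1" using kk(2) a by linarith
qed

lemma al_X: "al * X \<phi> = arcsin (kk * cos \<phi>)"
  using al by (simp add: X_def)

lemma X_range: "X \<phi> \<in> {-1..1}"
proof -
  have "arcsin (kk * cos \<phi>) \<le> arcsin kk" "arcsin (- kk) \<le> arcsin (kk * cos \<phi>)"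
    using abs_kk_cos[of \<phi>] kk by (auto intro!: arcsin_le_arcsin)
  moreover have "arcsin kk = al" using al unfolding kk_def by (intro arcsin_sin) auto
  moreover have "arcsin (- kk) = - al" using calculation(3) kk by (simp add: arcsin_minus)
  ultimately show ?thesis using al by (auto simp: X_def field_simps)
qed

lemma s_X: "s (X \<phi>) = cos \<phi>"
  using abs_kk_cos[of \<phi>] kk by (simp add: s_def al_X sin_arcsin)

lemma X_th: assumes "x \<in> {-1..1}" shows "X (th x) = x"
  using s_strict_mono[OF X_range assms, of "th x"] s_strict_mono[OF assms X_range, of "th x"]
   cos_th[OF assms] s_X[of "th x"] by force

lemma th_X: "\<phi> \<in> {0..pi} \<Longrightarrow> th (X \<phi>) = \<phi>"
  by (simp add: th_def s_X arccos_cos)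

lemma X_deriv: "(X has_real_derivative - (kk * sin \<phi> / (al * rho (X \<phi>)))) (at \<phi> within A)"
proof -
  have c: "cos (arcsin (kk * cos \<phi>)) = rho (X \<phi>)" by (simp add: rho_def al_X)
  have r: "sqrt (1 - (kk * cos \<phi>)\<^sup>2) = rho (X \<phi>)"
    using c cos_arcsin[of "kk * cos \<phi>"] abs_kk_cos[of \<phi>] by auto
  have "((\<lambda>\<phi>. arcsin (kk * cos \<phi>)) has_real_derivative inverse (rho (X \<phi>)) * (kk * - sin \<phi>)) (at \<phi>)"
    unfolding r[symmetric]
    by (rule DERIV_chain'[OF _ DERIV_arcsin]) (use abs_kk_cos[of \<phi>] in \<open>auto intro!: derivative_eq_intros simp: abs_less_iff\<close>)
  hence "((\<lambda>\<phi>. arcsin (kk * cos \<phi>) / al) has_real_derivative inverse (rho (X \<phi>)) * (kk * - sin \<phi>) / al) (at \<phi>)"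
    by (rule DERIV_cdivide)
  hence "(X has_real_derivative - (kk * sin \<phi> / (al * rho (X \<phi>)))) (at \<phi>)"
    unfolding X_def[abs_def] by (simp add: field_simps)
  thus ?thesis by (rule has_field_derivative_at_within)
qed

lemma continuous_on_X [continuous_intros]:
  fixes f :: "'a::t2_space \<Rightarrow> real"
  assumes "continuous_on A f" shows "continuous_on A (\<lambda>x. X (f x))"
proof -
  have "continuous_on UNIV X" by (rule DERIV_continuous_on[OF X_deriv])
  from continuous_on_compose2[OF this assms] show ?thesis by simp
qed

lemma continuous_on_s [continuous_intros]:
  fixes f :: "'a::t2_space \<Rightarrow> real"
  assumes "continuous_on A f" shows "continuous_on A (\<lambda>x. s (f x))"
  unfolding s_def by (intro continuous_intros assms) (use kk in auto)

lemma continuous_on_rho [continuous_intros]: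
  fixes f :: "'a::t2_space \<Rightarrow> real"
  assumes "continuous_on A f" shows "continuous_on A (\<lambda>x. rho (f x))"
  unfolding rho_def by (intro continuous_intros assms)

lemma continuous_on_sg [continuous_intros]:
  fixes f :: "'a::t2_space \<Rightarrow> real"
  assumes "continuous_on A f" shows "continuous_on A (\<lambda>x. sg (f x))"
  unfolding sg_def by (intro continuous_intros assms)

lemma continuous_on_th: assumes "A \<subseteq> {-1..1}" shows "continuous_on A th"
proof -
  have "- 1 \<le> s x \<and> s x \<le> 1" if "x \<in> A" for x
    using abs_s_le[of x] that assms by (auto simp: abs_le_iff)
  thus ?thesis unfolding th_def by (intro continuous_intros) auto
qed

text \<open>A Lipschitz constant of \<open>X\<close>.\<close>

definition XL where "XL = kk / (al * cos al)"

lemma XL_pos: "XL > 0" using kk al by (simp add: XL_def)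

lemma X_Lipschitz: "\<bar>X u - X v\<bar> \<le> XL * \<bar>u - v\<bar>"
proof -
  have "norm (X u - X v) \<le> XL * norm (u - v)"
  proof (rule field_differentiable_bound[OF convex_UNIV X_deriv])
    fix \<phi>
    have "kk * \<bar>sin \<phi>\<bar> / (al * rho (X \<phi>)) \<le> kk * 1 / (al * cos al)"
      by (intro frac_le mult_mono rho_ge X_range) (use kk al in auto)
    thus "norm (- (kk * sin \<phi> / (al * rho (X \<phi>)))) \<le> XL"
      using kk al rho_pos[OF X_range] by (simp add: XL_def abs_mult abs_of_pos)
  qed auto
  thus ?thesis by simp
qed

lemma X_antimono: assumes "0 \<le> u" "u \<le> v" "v \<le> pi" shows "X v \<le> X u"
proof -
  have "cos v \<le> cos u" using assms by (intro cos_monotone_0_pi_le) auto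
  hence "arcsin (kk * cos v) \<le> arcsin (kk * cos u)"
    using abs_kk_cos[of u] abs_kk_cos[of v] kk by (intro arcsin_le_arcsin) (auto simp: abs_le_iff)
  thus ?thesis using al by (simp add: X_def divide_right_mono)
qed

lemma X_ends: "X 0 = 1" "X pi = - 1"
  using al kk by (auto simp: X_def kk_def arcsin_minus arcsin_sin)

text \<open>The substitution rule in the form \<open>rho y dy = - (kk / al) sin \<phi> d\<phi>\<close>.\<close>

lemma integral_X:
  fixes g :: "real \<Rightarrow> complex"
  assumes "0 \<le> u" "u \<le> v" "v \<le> pi" and g: "continuous_on {X v..X u} g"
  shows "integral {X v..X u} (\<lambda>y. rho y *\<^sub>R g y) = (kk / al) *\<^sub>R integral {u..v} (\<lambda>\<phi>. sin \<phi> *\<^sub>R g (X \<phi>))"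
proof -
  have "((\<lambda>\<phi>. - (kk * sin \<phi> / (al * rho (X \<phi>))) *\<^sub>R (rho (X \<phi>) *\<^sub>R g (X \<phi>))) has_integral
      integral {X u..X v} (\<lambda>y. rho y *\<^sub>R g y) - integral {X v..X u} (\<lambda>y. rho y *\<^sub>R g y)) {u..v}"
  proof (rule has_integral_substitution_general[where s = "{}" and c = "X v" and d = "X u"])
    show "X ` {u..v} \<subseteq> {X v..X u}" using assms by (auto intro!: X_antimono)
    show "continuous_on {u..v} X" by (intro continuous_intros)
    show "continuous_on {X v..X u} (\<lambda>y. rho y *\<^sub>R g y)" by (intro continuous_intros g)
    show "(X has_real_derivative - (kk * sin \<phi> / (al * rho (X \<phi>)))) (at \<phi> within {u..v})" for \<phi>
      by (rule X_deriv)
  qed (use assms in auto)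
  moreover have "integral {X u..X v} (\<lambda>y. rho y *\<^sub>R g y) = 0"
  proof -
    have "X v \<le> X u" by (rule X_antimono) (use assms in auto)
    thus ?thesis by (cases "X u = X v") auto
  qed
  moreover have eq: "- (kk * sin \<phi> / (al * rho (X \<phi>))) *\<^sub>R (rho (X \<phi>) *\<^sub>R g (X \<phi>)) = - ((kk / al) *\<^sub>R (sin \<phi> *\<^sub>R g (X \<phi>)))" for \<phi>
    using rho_pos[OF X_range, of \<phi>] al by (simp add: less_imp_neq[symmetric])
  ultimately have "((\<lambda>\<phi>. - ((kk / al) *\<^sub>R (sin \<phi> *\<^sub>R g (X \<phi>)))) has_integral - integral {X v..X u} (\<lambda>y. rho y *\<^sub>R g y)) {u..v}"
    unfolding eq by simp
  from has_integral_neg[OF this] have "((\<lambda>\<phi>. (kk / al) *\<^sub>R (sin \<phi> *\<^sub>R g (X \<phi>))) has_integral integral {X v..X u} (\<lambda>y. rho y *\<^sub>R g y)) {u..v}"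
    by simp
  from integral_unique[OF this] show ?thesis by (simp only: integral_cmul)
qed

text \<open>The cosine kernel in the original variables.\<close>

definition K where "K m x y = cos_kernel m (th x) (th y)"

lemma K_bound: 
  assumes "x \<in> {-1..1}" "y \<in> {-1..1}"
  shows "\<bar>s x - s y\<bar> * \<bar>K m x y\<bar> \<le> 2"
  using cos_kernel_bound[of "th x" "th y" m] assms by (simp add: cos_th K_def)

lemma continuous_on_K:
  assumes "A \<subseteq> {-1..1}" shows "continuous_on A (K m x)"
  unfolding K_def by (intro continuous_intros continuous_on_th assms)

text \<open>A difference of values of \<open>rho\<close> or \<open>sg\<close> compensates the growth of the kernel near the diagonal:
  the Christoffel--Darboux formula bounds the product independently of \<open>m\<close>. For \<open>sg\<close>, which is not
  Lipschitz at the endpoints, the bound depends on \<open>x\<close>.\<close>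

lemma rho_commutator:
  assumes "x \<in> {-1..1}" "y \<in> {-1..1}"
  shows "\<bar>rho y - rho x\<bar> * \<bar>K m x y\<bar> \<le> 2 / cos al"
proof -
  have "(rho y - rho x) * (rho y + rho x) = kk\<^sup>2 * (s x + s y) * (s x - s y)"
    using rho_squared[of x] rho_squared[of y] by (simp add: algebra_simps power2_eq_square)
  hence "\<bar>rho y - rho x\<bar> * (rho y + rho x) = kk\<^sup>2 * \<bar>s x + s y\<bar> * \<bar>s x - s y\<bar>"
    using rho_pos[OF assms(1)] rho_pos[OF assms(2)] by (metis abs_mult abs_of_pos abs_power2 add_pos_pos)
  moreover have "\<bar>rho y - rho x\<bar> * (2 * cos al) \<le> \<bar>rho y - rho x\<bar> * (rho y + rho x)"
    using rho_ge[OF assms(1)] rho_ge[OF assms(2)] by (intro mult_left_mono) auto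
  moreover have "kk\<^sup>2 * \<bar>s x + s y\<bar> * \<bar>s x - s y\<bar> \<le> 1 * 2 * \<bar>s x - s y\<bar>"
    using abs_s_le[OF assms(1)] abs_s_le[OF assms(2)] kk
    by (intro mult_right_mono mult_mono) (auto simp: power_le_one)
  ultimately have "\<bar>rho y - rho x\<bar> * cos al \<le> \<bar>s x - s y\<bar>" by simp
  hence "(\<bar>rho y - rho x\<bar> * cos al) * \<bar>K m x y\<bar> \<le> \<bar>s x - s y\<bar> * \<bar>K m x y\<bar>"
    by (intro mult_right_mono) auto
  also have "\<dots> \<le> 2" by (rule K_bound[OF assms])
  finally show ?thesis using kk(3) by (simp add: field_simps)
qed

lemma sg_commutator:
  assumes "x \<in> {-1..1}" "y \<in> {-1..1}" "sg x > 0"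
  shows "\<bar>sg y - sg x\<bar> * \<bar>K m x y\<bar> \<le> 4 / sg x"
proof -
  have "(sg y - sg x) * (sg y + sg x) = (s x + s y) * (s x - s y)"
    using sg_squared[OF assms(1)] sg_squared[OF assms(2)] by (simp add: algebra_simps power2_eq_square)
  hence "\<bar>sg y - sg x\<bar> * (sg y + sg x) = \<bar>s x + s y\<bar> * \<bar>s x - s y\<bar>"
    using sg_nonneg[OF assms(2)] assms(3) by (metis abs_mult abs_of_pos add_nonneg_pos)
  moreover have "\<bar>sg y - sg x\<bar> * sg x \<le> \<bar>sg y - sg x\<bar> * (sg y + sg x)"
    using sg_nonneg[OF assms(2)] by (intro mult_left_mono) auto
  moreover have "\<bar>s x + s y\<bar> * \<bar>s x - s y\<bar> \<le> 2 * \<bar>s x - s y\<bar>"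
    using abs_s_le[OF assms(1)] abs_s_le[OF assms(2)] by (intro mult_right_mono) auto
  ultimately have "\<bar>sg y - sg x\<bar> * sg x \<le> 2 * \<bar>s x - s y\<bar>" by simp
  hence "(\<bar>sg y - sg x\<bar> * sg x) * \<bar>K m x y\<bar> \<le> (2 * \<bar>s x - s y\<bar>) * \<bar>K m x y\<bar>"
    by (intro mult_right_mono) auto
  also have "\<dots> \<le> 4" using K_bound[OF assms(1,2), of m] by linarith 
  finally show ?thesis using assms(3) by (simp add: field_simps)
qed

end

section \<open>Three-term recurrences and equality of spans\<close>

text \<open>The real span of \<open>d 0, \<dots>, d n\<close> as functions on \<open>[-1, 1]\<close>; values elsewhere are irrelevant.\<close>

definition rspan :: "(nat \<Rightarrow> real \<Rightarrow> real) \<Rightarrow> nat \<Rightarrow> (real \<Rightarrow> real) set" where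
  "rspan d n = {g. \<exists>a. \<forall>x\<in>{-1..1}. g x = (\<Sum>j\<le>n. a j * d j x)}"

lemma rspanI: "(\<And>x. x \<in> {-1..1} \<Longrightarrow> g x = (\<Sum>j\<le>n. a j * d j x)) \<Longrightarrow> g \<in> rspan d n"
  by (auto simp: rspan_def)

lemma rspanE:
  assumes "g \<in> rspan d n"
  obtains a where "\<And>x. x \<in> {-1..1} \<Longrightarrow> g x = (\<Sum>j\<le>n. a j * d j x)"
  using assms by (auto simp: rspan_def)

lemma rspan_cong:
  assumes "g \<in> rspan d n" "\<And>x. x \<in> {-1..1} \<Longrightarrow> f x = g x" shows "f \<in> rspan d n"
  using assms by (auto simp: rspan_def)

lemma rspan_base: assumes "j \<le> n" shows "d j \<in> rspan d n"
proof (rule rspanI[where a = "\<lambda>i. if i = j then 1 else 0"])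
  fix x
  have "(\<Sum>i\<le>n. (if i = j then 1 else 0) * d i x) = (\<Sum>i\<le>n. if i = j then d j x else 0)"
    by (intro sum.cong) auto
  thus "d j x = (\<Sum>i\<le>n. (if i = j then 1 else 0) * d i x)" using assms by simp
qed

lemma rspan_mono: assumes "g \<in> rspan d n" "n \<le> m" shows "g \<in> rspan d m"
proof -
  from assms(1) obtain a where a: "\<And>x. x \<in> {-1..1} \<Longrightarrow> g x = (\<Sum>j\<le>n. a j * d j x)" by (rule rspanE) blast
  show ?thesis
  proof (rule rspanI[where a = "\<lambda>i. if i \<le> n then a i else 0"])
    fix x :: real assume "x \<in> {-1..1}"
    have "(\<Sum>j\<le>m. (if j \<le> n then a j else 0) * d j x) = (\<Sum>j\<le>n. a j * d j x)"
      by (rule sum.mono_neutral_cong_right) (use assms(2) in auto)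
    thus "g x = (\<Sum>j\<le>m. (if j \<le> n then a j else 0) * d j x)" using a \<open>x \<in> {-1..1}\<close> by simp
  qed
qed

lemma rspan_lincomb: assumes "f \<in> rspan d n" "g \<in> rspan d n" shows "(\<lambda>x. p * f x + q * g x) \<in> rspan d n"
proof -
  from assms(1) obtain a where a: "\<And>x. x \<in> {-1..1} \<Longrightarrow> f x = (\<Sum>j\<le>n. a j * d j x)" by (rule rspanE) blast
  from assms(2) obtain b where b: "\<And>x. x \<in> {-1..1} \<Longrightarrow> g x = (\<Sum>j\<le>n. b j * d j x)" by (rule rspanE) blast
  show ?thesis
    by (rule rspanI[where a = "\<lambda>i. p * a i + q * b i"])
       (simp add: a b sum_distrib_left sum.distrib algebra_simps)
qed

lemma rspan_zero: "(\<lambda>x. 0) \<in> rspan d n"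
  by (rule rspanI[where a = "\<lambda>i. 0"]) simp

lemma rspan_sum:
  assumes "finite S" "\<And>i. i \<in> S \<Longrightarrow> f i \<in> rspan d n"
  shows "(\<lambda>x. \<Sum>i\<in>S. a i * f i x) \<in> rspan d n"
  using assms
proof (induction S rule: finite_induct)
  case empty thus ?case by (simp add: rspan_zero)
next
  case (insert i S)
  have "(\<lambda>x. a i * f i x + 1 * (\<Sum>i\<in>S. a i * f i x)) \<in> rspan d n"
    by (rule rspan_lincomb) (use insert in auto)
  thus ?case using insert by simp
qed

lemma rspan_mult:
  assumes D: "\<And>j. (\<lambda>x. D x * d j x) \<in> rspan d (Suc j)" and g: "g \<in> rspan d n"
  shows "(\<lambda>x. D x * g x) \<in> rspan d (Suc n)"
proof -
  from g obtain a where a: "\<And>x. x \<in> {-1..1} \<Longrightarrow> g x = (\<Sum>j\<le>n. a j * d j x)" by (rule rspanE) blast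
  have "(\<lambda>x. \<Sum>j\<in>{..n}. a j * (D x * d j x)) \<in> rspan d (Suc n)"
    by (rule rspan_sum) (auto intro: rspan_mono[OF D])
  thus ?thesis by (rule rspan_cong) (simp add: a sum_distrib_left algebra_simps)
qed

text \<open>A sequence \<open>c\<close> with a three-term recurrence lies in the spans of another sequence \<open>d\<close> if its
  multiplier \<open>C\<close> is an affine function of a multiplier \<open>D\<close> that raises the degree in \<open>d\<close> by one. As
  the roles can be exchanged, this gives equality of the spans.\<close>

lemma rspan_three_term:
  assumes D: "\<And>j. (\<lambda>x. D x * d j x) \<in> rspan d (Suc j)"
    and C: "\<And>x. x \<in> {-1..1} \<Longrightarrow> C x = p * D x + q"
    and c0: "c 0 \<in> rspan d 0" and c1: "c 1 \<in> rspan d 1"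
    and rec: "\<And>m x. x \<in> {-1..1} \<Longrightarrow> c (Suc (Suc m)) x = 2 * C x * c (Suc m) x - c m x"
  shows "c m \<in> rspan d m"
proof (induction m rule: less_induct)
  case (less m)
  consider "m = 0" | "m = 1" | k where "m = Suc (Suc k)"
    by (metis One_nat_def not0_implies_Suc)
  thus ?case
  proof cases
    case 3
    have "(\<lambda>x. D x * c (Suc k) x) \<in> rspan d m" 
      using rspan_mult[OF D less(1)[of "Suc k"]] 3 by simp
    from rspan_lincomb[OF this rspan_mono[OF less(1)[of "Suc k"]], of "2 * p" "2 * q"] 3
    have "(\<lambda>x. 2 * p * (D x * c (Suc k) x) + 2 * q * c (Suc k) x) \<in> rspan d m" by simp
    from rspan_lincomb[OF this rspan_mono[OF less(1)[of k]], of 1 "-1"] 3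
    have "(\<lambda>x. 1 * (2 * p * (D x * c (Suc k) x) + 2 * q * c (Suc k) x) + (-1) * c k x) \<in> rspan d m" by simp
    thus ?thesis by (rule rspan_cong) (simp add: 3 rec C algebra_simps)
  qed (use c0 c1 in simp_all)
qed

context extension begin

lemma cos_2al: "x \<in> {-1..1} \<Longrightarrow> cos (2 * al * x) = - kk\<^sup>2 * cos (2 * th x) + (1 - kk\<^sup>2)"
  using cos_double_cos[of "th x"] cos_double_sin[of "al * x"] kk
  by (simp add: cos_th s_def field_simps)

lemma sin_2al: "x \<in> {-1..1} \<Longrightarrow> sin (2 * al * x) = 2 * kk * (rho x * cos (th x))"
  using sin_double[of "al * x"] kk by (simp add: cos_th s_def rho_def field_simps)

lemma trig_rec:
  fixes a w :: real
  shows "cos (a + 2 * w) = 2 * cos w * cos (a + w) - cos a" "sin (a + 2 * w) = 2 * cos w * sin (a + w) - sin a"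
proof -
  have *: "a + 2 * w = (a + w) + w" "a = (a + w) - w" by simp_all
  show "cos (a + 2 * w) = 2 * cos w * cos (a + w) - cos a"
    by (subst (1) *(1), subst (3) *(2)) (simp only: cos_add[of "a + w"] cos_diff[of "a + w"], simp add: algebra_simps)
  show "sin (a + 2 * w) = 2 * cos w * sin (a + w) - sin a"
    by (subst (1) *(1), subst (3) *(2)) (simp only: sin_add[of "a + w"] sin_diff[of "a + w"], simp add: algebra_simps)
qed

text \<open>The even and the odd basis functions in the angle variable.\<close>

definition "cE j x = cos (real (2 * j) * th x)"
definition "cO j x = rho x * cos (real (2 * j + 1) * th x)"

text \<open>The even and the odd trigonometric functions of period \<open>2 T\<close>; the sines start at frequency one.\<close>

definition "tE j x = cos (real j * (2 * al * x))"
definition "tO j x = sin (real (Suc j) * (2 * al * x))"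

lemma cE_rec: "cE (Suc (Suc j)) x = 2 * cos (2 * th x) * cE (Suc j) x - cE j x"
  using trig_rec(1)[of "real (2 * j) * th x" "2 * th x"] by (simp add: cE_def algebra_simps)

lemma cO_rec: "cO (Suc (Suc j)) x = 2 * cos (2 * th x) * cO (Suc j) x - cO j x"
  using arg_cong[OF trig_rec(1)[of "real (2 * j + 1) * th x" "2 * th x"], of "\<lambda>z. rho x * z"]
  by (simp add: cO_def algebra_simps)

lemma tE_rec: "tE (Suc (Suc j)) x = 2 * cos (2 * al * x) * tE (Suc j) x - tE j x"
  using trig_rec(1)[of "real j * (2 * al * x)" "2 * al * x"] by (simp add: tE_def algebra_simps)

lemma tO_rec: "tO (Suc (Suc j)) x = 2 * cos (2 * al * x) * tO (Suc j) x - tO j x"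
  using trig_rec(2)[of "real (Suc j) * (2 * al * x)" "2 * al * x"] by (simp add: tO_def algebra_simps)

lemma rec_mult:
  assumes rec: "\<And>j x. d (Suc (Suc j)) x = 2 * D x * d (Suc j) x - d j x"
    and one: "(\<lambda>x. D x * d 0 x) \<in> rspan d 1"
  shows "(\<lambda>x. D x * d j x) \<in> rspan d (Suc j)"
proof (cases j)
  case 0 thus ?thesis using one by simp
next
  case (Suc i)
  have "(\<lambda>x. (1/2) * d (Suc (Suc i)) x + (1/2) * d i x) \<in> rspan d (Suc (Suc i))"
    by (intro rspan_lincomb rspan_base) auto
  thus ?thesis unfolding Suc by (rule rspan_cong) (simp add: rec field_simps)
qed

lemma cE_mult: "(\<lambda>x. cos (2 * th x) * cE j x) \<in> rspan cE (Suc j)"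
  by (rule rec_mult[where d = cE and D = "\<lambda>x. cos (2 * th x)", OF cE_rec], rule rspan_cong[OF rspan_base[of 1]]) (auto simp: cE_def)

lemma cO_mult: "(\<lambda>x. cos (2 * th x) * cO j x) \<in> rspan cO (Suc j)"
proof (rule rec_mult[where d = cO and D = "\<lambda>x. cos (2 * th x)", OF cO_rec])
  have "(\<lambda>x. (1/2) * cO 1 x + (1/2) * cO 0 x) \<in> rspan cO 1"
    by (intro rspan_lincomb rspan_base) auto
  moreover have "2 * (cos (2 * t) * cos t) = cos (3 * t) + cos t" for t :: real
    using trig_rec(1)[of t t] trig_rec(1)[of "- t" "2 * t"] by (simp add: algebra_simps)
  hence "rho x * (2 * (cos (2 * th x) * cos (th x))) = rho x * (cos (3 * th x) + cos (th x))" for x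
    by simp
  hence "2 * (cos (2 * th x) * cO 0 x) = cO 1 x + cO 0 x" for x
    by (simp add: cO_def algebra_simps)
  ultimately show "(\<lambda>x. cos (2 * th x) * cO 0 x) \<in> rspan cO 1"
    by (elim rspan_cong) (simp add: field_simps)
qed

lemma tE_mult: "(\<lambda>x. cos (2 * al * x) * tE j x) \<in> rspan tE (Suc j)"
  by (rule rec_mult[where d = tE and D = "\<lambda>x. cos (2 * al * x)", OF tE_rec], rule rspan_cong[OF rspan_base[of 1]]) (auto simp: tE_def)

lemma tO_mult: "(\<lambda>x. cos (2 * al * x) * tO j x) \<in> rspan tO (Suc j)"
proof (rule rec_mult[where d = tO and D = "\<lambda>x. cos (2 * al * x)", OF tO_rec])
  have "(\<lambda>x. (1/2) * tO 1 x + 0 * tO 1 x) \<in> rspan tO 1"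
    by (intro rspan_lincomb rspan_base) auto
  thus "(\<lambda>x. cos (2 * al * x) * tO 0 x) \<in> rspan tO 1"
  proof (rule rspan_cong)
    show "cos (2 * al * x) * tO 0 x = 1/2 * tO 1 x + 0 * tO 1 x" for x
      using sin_double[of "2 * al * x"] by (simp add: tO_def algebra_simps)
  qed
qed

text \<open>The even and the odd trigonometric polynomials in the original variable are the same functions
  as the cosine polynomials of even degree and \<open>rho\<close> times those of odd degree in the angle. The next
  lemmas show both inclusions.\<close>

lemma tE_in_cE: "tE m \<in> rspan cE m"
proof (rule rspan_three_term[where d = cE and c = tE and D = "\<lambda>x. cos (2 * th x)"
    and C = "\<lambda>x. cos (2 * al * x)", OF cE_mult cos_2al _ _ tE_rec])
  show "tE 0 \<in> rspan cE 0" by (rule rspan_cong[OF rspan_base[of 0]]) (auto simp: cE_def tE_def)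
  have "(\<lambda>x. (- kk\<^sup>2) * cE 1 x + (1 - kk\<^sup>2) * cE 0 x) \<in> rspan cE 1"
    by (intro rspan_lincomb rspan_base) auto
  thus "tE 1 \<in> rspan cE 1" by (rule rspan_cong) (simp add: cE_def tE_def cos_2al)
qed

lemma tO_in_cO: "tO m \<in> rspan cO m"
proof (rule rspan_three_term[where d = cO and c = tO and D = "\<lambda>x. cos (2 * th x)"
    and C = "\<lambda>x. cos (2 * al * x)", OF cO_mult cos_2al _ _ tO_rec])
  have s: "(\<lambda>x. (2 * kk) * cO 0 x + 0 * cO 0 x) \<in> rspan cO n" for n
    by (intro rspan_lincomb rspan_base) auto
  have t0: "tO 0 \<in> rspan cO n" for n
    by (rule rspan_cong[OF s]) (simp add: cO_def tO_def sin_2al)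
  show "tO 0 \<in> rspan cO 0" by (rule t0)
  have "(\<lambda>x. (-2 * kk\<^sup>2) * (cos (2 * th x) * tO 0 x) + (2 * (1 - kk\<^sup>2)) * tO 0 x) \<in> rspan cO 1"
    using rspan_mult[OF cO_mult t0[of 0]] by (intro rspan_lincomb t0) simp
  thus "tO 1 \<in> rspan cO 1"
  proof (rule rspan_cong)
    fix x :: real assume x: "x \<in> {-1..1}"
    have "tO 1 x = 2 * cos (2 * al * x) * tO 0 x"
      using sin_double[of "2 * al * x"] by (simp add: tO_def algebra_simps)
    thus "tO 1 x = (-2 * kk\<^sup>2) * (cos (2 * th x) * tO 0 x) + (2 * (1 - kk\<^sup>2)) * tO 0 x"
      unfolding cos_2al[OF x] by (simp add: algebra_simps)
  qed
qed

lemma cos_2th: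
  assumes "x \<in> {-1..1}"
  shows "cos (2 * th x) = (- 1 / kk\<^sup>2) * cos (2 * al * x) + (1 - kk\<^sup>2) / kk\<^sup>2"
proof -
  have "kk\<^sup>2 > 0" using kk by simp
  thus ?thesis unfolding cos_2al[OF assms] by (simp add: divide_simps)
qed

lemma cE_in_tE: "cE m \<in> rspan tE m"
proof (rule rspan_three_term[where d = tE and c = cE and D = "\<lambda>x. cos (2 * al * x)"
    and C = "\<lambda>x. cos (2 * th x)", OF tE_mult cos_2th _ _ cE_rec])
  show "cE 0 \<in> rspan tE 0" by (rule rspan_cong[OF rspan_base[of 0]]) (auto simp: cE_def tE_def)
  have "(\<lambda>x. (- 1 / kk\<^sup>2) * tE 1 x + ((1 - kk\<^sup>2) / kk\<^sup>2) * tE 0 x) \<in> rspan tE 1"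
    by (intro rspan_lincomb rspan_base) auto
  thus "cE 1 \<in> rspan tE 1" by (rule rspan_cong) (simp add: cE_def tE_def cos_2th)
qed

lemma cO_in_tO: "cO m \<in> rspan tO m"
proof (rule rspan_three_term[where d = tO and c = cO and D = "\<lambda>x. cos (2 * al * x)"
    and C = "\<lambda>x. cos (2 * th x)", OF tO_mult cos_2th _ _ cO_rec])
  have s: "(\<lambda>x. (1 / (2 * kk)) * tO 0 x + 0 * tO 0 x) \<in> rspan tO n" for n
    by (intro rspan_lincomb rspan_base) auto
  have t0: "cO 0 \<in> rspan tO n" for n
    by (rule rspan_cong[OF s]) (use kk in \<open>simp add: cO_def tO_def sin_2al\<close>)
  show "cO 0 \<in> rspan tO 0" by (rule t0)
  have "(\<lambda>x. (- 2 / kk\<^sup>2) * (cos (2 * al * x) * cO 0 x) + (2 * (1 - kk\<^sup>2) / kk\<^sup>2 - 1) * cO 0 x) \<in> rspan tO 1"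
    using rspan_mult[OF tO_mult t0[of 0]] by (intro rspan_lincomb t0) simp
  thus "cO 1 \<in> rspan tO 1"
  proof (rule rspan_cong)
    fix x :: real assume x: "x \<in> {-1..1}"
    have "2 * (cos (2 * t) * cos t) = cos (3 * t) + cos t" for t :: real
      using trig_rec(1)[of t t] trig_rec(1)[of "- t" "2 * t"] by (simp add: algebra_simps)
    from this[of "th x"] have "cos (3 * th x) = (2 * cos (2 * th x) - 1) * cos (th x)" by (simp add: algebra_simps)
    hence "cO 1 x = (2 * cos (2 * th x) - 1) * cO 0 x"
      by (simp add: cO_def)
    thus "cO 1 x = (- 2 / kk\<^sup>2) * (cos (2 * al * x) * cO 0 x) + (2 * (1 - kk\<^sup>2) / kk\<^sup>2 - 1) * cO 0 x"
      unfolding cos_2th[OF x] using kk by (simp add: field_simps)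
  qed
qed

end

section \<open>The approximation space and its reproduction by the kernel\<close>

context extension begin

text \<open>The exponential with frequency \<open>k \<pi> / T\<close>.\<close>

definition ee :: "int \<Rightarrow> real \<Rightarrow> complex" where
  "ee k x = cis (real_of_int k * (2 * al * x))"

text \<open>The approximation space of dimension \<open>2 n + 1\<close>, indexed by its degree.\<close>

definition H :: "nat \<Rightarrow> (real \<Rightarrow> complex) set" where
  "H n = fourier_space T (2 * n + 1)"

lemma H_eq_span: "H n = {\<lambda>x. \<Sum>k\<in>{-int n..int n}. c k * ee k x | c. True}"
proof -
  have "exp (\<i> * of_real (pi / T * of_int k * x)) = ee k x" for k x
    by (simp add: ee_def cis_conv_exp al_def field_simps)
  thus ?thesis unfolding H_def fourier_space_def Let_def by auto
qed

lemma ee_mult: "ee k x * ee l x = ee (k + l) x"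
  by (simp add: ee_def cis_mult ring_distribs)

lemma HI: "(\<And>x. r x = (\<Sum>k\<in>{-int n..int n}. c k * ee k x)) \<Longrightarrow> r \<in> H n"
  unfolding H_eq_span by auto

lemma HE: assumes "r \<in> H n" obtains c where "\<And>x. r x = (\<Sum>k\<in>{-int n..int n}. c k * ee k x)"
  using assms unfolding H_eq_span by auto

lemma H_ee: assumes "\<bar>k\<bar> \<le> int n" shows "ee k \<in> H n"
proof (rule HI[where c = "\<lambda>i. if i = k then 1 else 0"])
  fix x
  have "(\<Sum>i\<in>{-int n..int n}. (if i = k then 1 else 0) * ee i x) = (\<Sum>i\<in>{-int n..int n}. if i = k then ee k x else 0)"
    by (intro sum.cong) auto
  thus "ee k x = (\<Sum>i\<in>{-int n..int n}. (if i = k then 1 else 0) * ee i x)" using assms by (auto simp: abs_le_iff)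
qed

lemma H_lincomb: assumes "f \<in> H n" "g \<in> H n" shows "(\<lambda>x. p * f x + q * g x) \<in> H n"
proof -
  from assms(1) obtain a where a: "\<And>x. f x = (\<Sum>k\<in>{-int n..int n}. a k * ee k x)" by (rule HE) blast
  from assms(2) obtain b where b: "\<And>x. g x = (\<Sum>k\<in>{-int n..int n}. b k * ee k x)" by (rule HE) blast
  show ?thesis
    by (rule HI[where c = "\<lambda>i. p * a i + q * b i"])
       (simp add: a b sum_distrib_left sum.distrib algebra_simps)
qed

lemma H_zero: "(\<lambda>x. 0) \<in> H n"
  by (rule HI[where c = "\<lambda>i. 0"]) simp

lemma H_add: "f \<in> H n \<Longrightarrow> g \<in> H n \<Longrightarrow> (\<lambda>x. f x + g x) \<in> H n"
  using H_lincomb[of f n g 1 1] by simp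

lemma H_diff: "f \<in> H n \<Longrightarrow> g \<in> H n \<Longrightarrow> (\<lambda>x. f x - g x) \<in> H n"
  using H_lincomb[of f n g 1 "-1"] by simp

lemma H_cmult: "f \<in> H n \<Longrightarrow> (\<lambda>x. c * f x) \<in> H n"
  using H_lincomb[of f n f c 0] by simp

lemma H_sum:
  assumes "finite S" "\<And>i. i \<in> S \<Longrightarrow> f i \<in> H n"
  shows "(\<lambda>x. \<Sum>i\<in>S. a i * f i x) \<in> H n"
  using assms
proof (induction S rule: finite_induct)
  case empty thus ?case by (simp add: H_zero)
next
  case (insert i S)
  have "(\<lambda>x. a i * f i x + 1 * (\<Sum>i\<in>S. a i * f i x)) \<in> H n"
    by (rule H_lincomb) (use insert in auto)
  thus ?case using insert by simp
qed

lemma H_mono: assumes "f \<in> H n" "n \<le> m" shows "f \<in> H m"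
proof -
  from assms(1) obtain a where a: "\<And>x. f x = (\<Sum>k\<in>{-int n..int n}. a k * ee k x)" by (rule HE) blast
  have "(\<lambda>x. \<Sum>k\<in>{-int n..int n}. a k * ee k x) \<in> H m"
    by (rule H_sum) (use assms(2) in \<open>auto intro: H_ee\<close>)
  thus ?thesis unfolding a[symmetric] by (simp add: eta_contract_eq)
qed

lemma H_mult: assumes "f \<in> H n" "g \<in> H m" shows "(\<lambda>x. f x * g x) \<in> H (n + m)"
proof -
  from assms(1) obtain a where a: "\<And>x. f x = (\<Sum>k\<in>{-int n..int n}. a k * ee k x)" by (rule HE) blast
  from assms(2) obtain b where b: "\<And>x. g x = (\<Sum>k\<in>{-int m..int m}. b k * ee k x)" by (rule HE) blast
  have "(\<lambda>x. \<Sum>l\<in>{-int m..int m}. b l * ee (k + l) x) \<in> H (n + m)" if "k \<in> {-int n..int n}" for k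
  proof (rule H_sum)
    fix l assume "l \<in> {-int m..int m}"
    with that show "ee (k + l) \<in> H (n + m)" by (intro H_ee) auto
  qed auto
  hence "(\<lambda>x. \<Sum>k\<in>{-int n..int n}. a k * (\<Sum>l\<in>{-int m..int m}. b l * ee (k + l) x)) \<in> H (n + m)"
    by (rule H_sum[rotated]) auto
  also have "(\<lambda>x. \<Sum>k\<in>{-int n..int n}. a k * (\<Sum>l\<in>{-int m..int m}. b l * ee (k + l) x)) = (\<lambda>x. f x * g x)"
  proof
    show "(\<Sum>k\<in>{-int n..int n}. a k * (\<Sum>l\<in>{-int m..int m}. b l * ee (k + l) x)) = f x * g x" for x
      unfolding a b sum_product unfolding sum_distrib_left
      by (intro sum.cong refl) (simp add: ee_mult[symmetric] mult_ac)
  qed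
  finally show ?thesis .
qed

lemma continuous_on_ee [continuous_intros]: "continuous_on A (ee k)"
  unfolding ee_def by (intro continuous_intros)

lemma H_continuous: assumes "f \<in> H n" shows "continuous_on A f"
proof -
  from assms obtain a where a: "f = (\<lambda>x. \<Sum>k\<in>{-int n..int n}. a k * ee k x)" by (auto simp: H_eq_span)
  show ?thesis unfolding a by (intro continuous_intros)
qed

lemma H_cos: assumes "j \<le> n" shows "(\<lambda>x. complex_of_real (cos (real j * (2 * al * x)))) \<in> H n"
proof -
  have "(\<lambda>x. (1/2) * ee (int j) x + (1/2) * ee (- int j) x) \<in> H n"
    by (intro H_lincomb H_ee) (use assms in auto)
  also have "(\<lambda>x. (1/2) * ee (int j) x + (1/2) * ee (- int j) x) = (\<lambda>x. complex_of_real (cos (real j * (2 * al * x))))"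
    by (auto simp: ee_def complex_eq_iff)
  finally show ?thesis .
qed

lemma H_sin: assumes "j \<le> n" shows "(\<lambda>x. complex_of_real (sin (real j * (2 * al * x)))) \<in> H n"
proof -
  have "(\<lambda>x. (1/(2*\<i>)) * ee (int j) x + (-1/(2*\<i>)) * ee (- int j) x) \<in> H n"
    by (intro H_lincomb H_ee) (use assms in auto)
  also have "(\<lambda>x. (1/(2*\<i>)) * ee (int j) x + (-1/(2*\<i>)) * ee (- int j) x) = (\<lambda>x. complex_of_real (sin (real j * (2 * al * x))))"
    by (auto simp: ee_def complex_eq_iff)
  finally show ?thesis .
qed

lemma H_rspan:
  assumes "g \<in> rspan d m" "\<And>j. j \<le> m \<Longrightarrow> (\<lambda>x. complex_of_real (d j x)) \<in> H n"
  obtains h where "h \<in> H n" "\<And>x. x \<in> {-1..1} \<Longrightarrow> h x = complex_of_real (g x)"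
proof -
  from assms(1) obtain a where a: "\<And>x. x \<in> {-1..1} \<Longrightarrow> g x = (\<Sum>j\<le>m. a j * d j x)" by (rule rspanE) blast
  have "(\<lambda>x. \<Sum>j\<in>{..m}. complex_of_real (a j) * complex_of_real (d j x)) \<in> H n"
    by (rule H_sum) (use assms(2) in auto)
  thus ?thesis by (rule that) (simp add: a)
qed

lemma H_cE: 
  assumes "j \<le> n" obtains h where "h \<in> H n" "\<And>x. x \<in> {-1..1} \<Longrightarrow> h x = complex_of_real (cE j x)"
proof (rule H_rspan[OF cE_in_tE[of j], of n])
  fix i assume "i \<le> j"
  thus "(\<lambda>x. complex_of_real (tE i x)) \<in> H n" unfolding tE_def using assms by (intro H_cos) auto
qed (use that in auto)

lemma H_cO: 
  assumes "j < n" obtains h where "h \<in> H n" "\<And>x. x \<in> {-1..1} \<Longrightarrow> h x = complex_of_real (cO j x)"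
proof (rule H_rspan[OF cO_in_tO[of j], of n])
  fix i assume "i \<le> j"
  thus "(\<lambda>x. complex_of_real (tO i x)) \<in> H n" unfolding tO_def using assms by (intro H_sin) auto
qed (use that in auto)

text \<open>\<open>reproduced w v m g\<close>: the kernel of degree \<open>m\<close>, integrated against \<open>g\<close> with weight \<open>w\<close>,
  gives \<open>g\<close> back up to the factor \<open>v\<close>.\<close>

definition reproduced :: "(real \<Rightarrow> real) \<Rightarrow> (real \<Rightarrow> real) \<Rightarrow> nat \<Rightarrow> (real \<Rightarrow> complex) \<Rightarrow> bool" where
  "reproduced w v m g \<longleftrightarrow>
     (\<forall>x\<in>{-1..1}. ((\<lambda>y. (w y * K m x y) *\<^sub>R g y) has_integral v x *\<^sub>R g x) {-1..1})"

lemma reproduced_cong: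
  assumes "reproduced w v m g" "\<And>x. x \<in> {-1..1} \<Longrightarrow> f x = g x"
  shows "reproduced w v m f"
  unfolding reproduced_def
proof
  fix x :: real assume x: "x \<in> {-1..1}"
  hence "((\<lambda>y. (w y * K m x y) *\<^sub>R g y) has_integral v x *\<^sub>R g x) {-1..1}"
    using assms(1) by (auto simp: reproduced_def)
  thus "((\<lambda>y. (w y * K m x y) *\<^sub>R f y) has_integral v x *\<^sub>R f x) {-1..1}"
    using assms(2)[OF x] by (subst has_integral_cong[where g = "\<lambda>y. (w y * K m x y) *\<^sub>R g y"]) (auto simp: assms(2))
qed

lemma reproduced_sum:
  assumes "finite S" "\<And>i. i \<in> S \<Longrightarrow> reproduced w v m (g i)"
  shows "reproduced w v m (\<lambda>x. \<Sum>i\<in>S. c i * g i x)"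
  unfolding reproduced_def
proof
  fix x :: real assume x: "x \<in> {-1..1}"
  have "((\<lambda>y. \<Sum>i\<in>S. c i * ((w y * K m x y) *\<^sub>R g i y)) has_integral (\<Sum>i\<in>S. c i * (v x *\<^sub>R g i x))) {-1..1}"
    using assms x by (intro has_integral_sum has_integral_mult_right) (auto simp: reproduced_def)
  thus "((\<lambda>y. (w y * K m x y) *\<^sub>R (\<Sum>i\<in>S. c i * g i y)) has_integral v x *\<^sub>R (\<Sum>i\<in>S. c i * g i x)) {-1..1}"
    by (simp add: scaleR_right.sum)
qed

lemma reproduced_rspan:
  assumes "g \<in> rspan d n" "\<And>j. j \<le> n \<Longrightarrow> reproduced w v m (\<lambda>x. complex_of_real (d j x))"
  shows "reproduced w v m (\<lambda>x. complex_of_real (g x))"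
proof -
  from assms(1) obtain a where a: "\<And>x. x \<in> {-1..1} \<Longrightarrow> g x = (\<Sum>j\<le>n. a j * d j x)" by (rule rspanE) blast
  have "reproduced w v m (\<lambda>x. \<Sum>j\<in>{..n}. complex_of_real (a j) * complex_of_real (d j x))"
    by (rule reproduced_sum) (use assms(2) in auto)
  thus ?thesis by (rule reproduced_cong) (simp add: a)
qed

text \<open>The factors that occur when the even and the odd basis functions are reproduced.\<close>

abbreviation "vE x \<equiv> kk / al * pi * (sg x)\<^sup>2"
abbreviation "vO x \<equiv> kk / al * pi * (sg x)\<^sup>2 / rho x"

lemma reproduced_cos:
  assumes "j \<le> m"
  shows "reproduced (\<lambda>y. rho y * sg y) vE (m + 2) (\<lambda>x. complex_of_real (cos (real j * th x)))"
  unfolding reproduced_def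
proof
  fix x :: real assume x: "x \<in> {-1..1}"
  define g where "g = (\<lambda>y. (sg y * K (m + 2) x y) *\<^sub>R complex_of_real (cos (real j * th y)))"
  have g: "continuous_on {-1..1} g"
    unfolding g_def by (intro continuous_intros continuous_on_K continuous_on_th) auto
  have "integral {X pi..X 0} (\<lambda>y. rho y *\<^sub>R g y) = (kk / al) *\<^sub>R integral {0..pi} (\<lambda>\<phi>. sin \<phi> *\<^sub>R g (X \<phi>))"
    by (rule integral_X) (use g in \<open>auto simp: X_ends\<close>)
  also have "integral {0..pi} (\<lambda>\<phi>. sin \<phi> *\<^sub>R g (X \<phi>))
     = integral {0..pi} (\<lambda>\<phi>. complex_of_real ((sin \<phi>)\<^sup>2 * cos (real j * \<phi>) * cos_kernel (m + 2) (th x) \<phi>))"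
  proof (rule integral_cong)
    fix \<phi> assume p: "\<phi> \<in> {0..pi}"
    have "sg (X \<phi>) = sin \<phi>" using sin_th[OF X_range, of \<phi>] th_X[OF p] by simp
    thus "sin \<phi> *\<^sub>R g (X \<phi>) = complex_of_real ((sin \<phi>)\<^sup>2 * cos (real j * \<phi>) * cos_kernel (m + 2) (th x) \<phi>)"
      by (simp add: g_def K_def th_X[OF p] power2_eq_square scaleR_conv_of_real)
  qed
  also have "\<dots> = complex_of_real (pi * ((sin (th x))\<^sup>2 * cos (real j * th x)))"
    by (intro integral_unique has_integral_of_real cos_kernel_reproduces_sin_squared assms)
  finally have "integral {-1..1} (\<lambda>y. rho y *\<^sub>R g y) = vE x *\<^sub>R complex_of_real (cos (real j * th x))"
    by (simp add: X_ends sin_th[OF x] scaleR_conv_of_real)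
  moreover have "(\<lambda>y. rho y *\<^sub>R g y) integrable_on {-1..1}"
    by (intro integrable_continuous_real continuous_intros g)
  ultimately have "((\<lambda>y. rho y *\<^sub>R g y) has_integral vE x *\<^sub>R complex_of_real (cos (real j * th x))) {-1..1}"
    by (simp add: has_integral_iff)
  thus "((\<lambda>y. (rho y * sg y * K (m + 2) x y) *\<^sub>R complex_of_real (cos (real j * th y))) has_integral
            vE x *\<^sub>R complex_of_real (cos (real j * th x))) {-1..1}"
    by (simp add: g_def mult.assoc)
qed

lemma reproduced_cE: "2 * j \<le> m \<Longrightarrow> reproduced (\<lambda>y. rho y * sg y) vE (m + 2) (\<lambda>x. complex_of_real (cE j x))"
  unfolding cE_def by (rule reproduced_cos)

lemma reproduced_cO:
  assumes "2 * j + 1 \<le> m"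
  shows "reproduced sg vO (m + 2) (\<lambda>x. complex_of_real (cO j x))"
  unfolding reproduced_def
proof
  fix x :: real assume x: "x \<in> {-1..1}"
  have "((\<lambda>y. (rho y * sg y * K (m + 2) x y) *\<^sub>R complex_of_real (cos (real (2 * j + 1) * th y))) has_integral
            vE x *\<^sub>R complex_of_real (cos (real (2 * j + 1) * th x))) {-1..1}"
    using reproduced_cos[OF assms] x by (auto simp: reproduced_def)
  moreover have "vO x *\<^sub>R complex_of_real (cO j x) = vE x *\<^sub>R complex_of_real (cos (real (2 * j + 1) * th x))"
    using rho_pos[OF x] by (simp add: cO_def scaleR_conv_of_real)
  ultimately show "((\<lambda>y. (sg y * K (m + 2) x y) *\<^sub>R complex_of_real (cO j y)) has_integral
      vO x *\<^sub>R complex_of_real (cO j x)) {-1..1}"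
    by (simp only:) (simp add: cO_def scaleR_conv_of_real mult_ac)
qed

lemma reproduced_even_part:
  assumes "r \<in> H n"
  shows "reproduced (\<lambda>y. rho y * sg y) vE (2 * n + 2) (\<lambda>x. (r x + r (- x)) / 2)"
proof -
  from assms obtain c where c: "\<And>x. r x = (\<Sum>k\<in>{-int n..int n}. c k * ee k x)" by (rule HE) blast
  have "reproduced (\<lambda>y. rho y * sg y) vE (2 * n + 2) (\<lambda>x. \<Sum>k\<in>{-int n..int n}. c k * complex_of_real (tE (nat \<bar>k\<bar>) x))"
  proof (rule reproduced_sum)
    fix k assume "k \<in> {-int n..int n}"
    thus "reproduced (\<lambda>y. rho y * sg y) vE (2 * n + 2) (\<lambda>x. complex_of_real (tE (nat \<bar>k\<bar>) x))"
      by (intro reproduced_rspan[OF tE_in_cE] reproduced_cE) auto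
  qed auto
  moreover have "(ee k x + ee k (- x)) / 2 = complex_of_real (tE (nat \<bar>k\<bar>) x)" for k x
    by (auto simp: ee_def tE_def complex_eq_iff abs_if)
  hence "(r x + r (- x)) / 2 = (\<Sum>k\<in>{-int n..int n}. c k * complex_of_real (tE (nat \<bar>k\<bar>) x))" for x
    unfolding c by (simp flip: sum.distrib add: sum_divide_distrib ring_distribs)
      (simp add: add_divide_distrib flip: ring_distribs)
  ultimately show ?thesis by simp
qed

lemma reproduced_odd_part:
  assumes "r \<in> H n"
  shows "reproduced sg vO (2 * n + 2) (\<lambda>x. (r x - r (- x)) / 2)"
proof -
  from assms obtain c where c: "\<And>x. r x = (\<Sum>k\<in>{-int n..int n}. c k * ee k x)" by (rule HE) blast
  define g where "g = (\<lambda>k x. if k = 0 then 0 else tO (nat \<bar>k\<bar> - 1) x)"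
  have "reproduced sg vO (2 * n + 2) (\<lambda>x. \<Sum>k\<in>{-int n..int n}. (c k * of_int (sgn k) * \<i>) * complex_of_real (g k x))"
  proof (rule reproduced_sum)
    fix k assume k: "k \<in> {-int n..int n}"
    show "reproduced sg vO (2 * n + 2) (\<lambda>x. complex_of_real (g k x))"
    proof (cases "k = 0")
      case True thus ?thesis by (simp add: g_def reproduced_def)
    next
      case False
      have "reproduced sg vO (2 * n + 2) (\<lambda>x. complex_of_real (tO (nat \<bar>k\<bar> - 1) x))"
        by (intro reproduced_rspan[OF tO_in_cO] reproduced_cO) (use False k in auto)
      thus ?thesis using False by (simp add: g_def)
    qed
  qed auto
  moreover have "(ee k x - ee k (- x)) / 2 = of_int (sgn k) * \<i> * complex_of_real (g k x)" for k x
  proof (cases "k = 0")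
    case False
    hence "real (Suc (nat \<bar>k\<bar> - 1)) = \<bar>real_of_int k\<bar>" by auto
    thus ?thesis using False by (auto simp: ee_def tO_def g_def complex_eq_iff abs_if simp del: of_nat_Suc)
  qed (simp add: ee_def g_def)
  hence "(r x - r (- x)) / 2 = (\<Sum>k\<in>{-int n..int n}. (c k * of_int (sgn k) * \<i>) * complex_of_real (g k x))" for x
    unfolding c by (simp flip: sum_subtractf add: sum_divide_distrib ring_distribs mult.assoc)
      (simp add: diff_divide_distrib mult.assoc flip: ring_distribs)
  ultimately show ?thesis by simp
qed

end

section \<open>Orthogonal projection in \<open>L\<^sup>2(-1, 1)\<close>\<close>

text \<open>Lebesgue measure on the open interval, which carries the space \<open>L\<^sup>2(-1, 1)\<close>.\<close>

abbreviation "LM \<equiv> lebesgue_on {-1<..<1::real}"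

text \<open>The inner product of \<open>L\<^sup>2(-1, 1)\<close>, linear in its first argument.\<close>

definition ip :: "(real \<Rightarrow> complex) \<Rightarrow> (real \<Rightarrow> complex) \<Rightarrow> complex" where
  "ip f g = (LINT x|LM. f x * cnj (g x))"

lemma finite_measure_LM: "finite_measure LM"
  by (rule finite_measureI) (simp add: emeasure_restrict_space)

lemma measure_LM: "measure LM (space LM) = 2"
  by (simp add: measure_restrict_space)

lemma L2_measurable: "L2_function f \<Longrightarrow> f \<in> borel_measurable LM"
  by (simp add: L2_function_def)

lemma L2_integrable_square: "L2_function f \<Longrightarrow> integrable LM (\<lambda>x. (cmod (f x))\<^sup>2)"
  by (simp add: L2_function_def)

lemma L2_integrable_mult:
  assumes "L2_function f" "L2_function g"
  shows "integrable LM (\<lambda>x. f x * g x)"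
proof (rule Bochner_Integration.integrable_bound)
  show "integrable LM (\<lambda>x. (cmod (f x))\<^sup>2 + (cmod (g x))\<^sup>2)"
    by (intro Bochner_Integration.integrable_add L2_integrable_square assms)
  show "(\<lambda>x. f x * g x) \<in> borel_measurable LM"
    by (intro borel_measurable_times L2_measurable assms)
  have "a * b \<le> \<bar>a\<^sup>2 + b\<^sup>2\<bar>" if "a \<ge> 0" "b \<ge> 0" for a b :: real
  proof -
    have "0 \<le> a * b" using that by simp
    thus ?thesis using sum_squares_bound[of a b] by simp
  qed
  thus "AE x in LM. norm (f x * g x) \<le> norm ((cmod (f x))\<^sup>2 + (cmod (g x))\<^sup>2)"
    by (simp add: norm_mult)
qed

lemma L2_cnj: assumes "L2_function f" shows "L2_function (\<lambda>x. cnj (f x))"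
proof -
  have "cnj \<in> borel_measurable borel"
    by (intro borel_measurable_continuous_onI continuous_intros)
  from measurable_compose[OF L2_measurable[OF assms] this] show ?thesis
    using L2_integrable_square[OF assms] by (simp add: L2_function_def)
qed

lemma L2_cmult: "L2_function f \<Longrightarrow> L2_function (\<lambda>x. c * f x)"
  by (auto simp: L2_function_def norm_mult power_mult_distrib)

lemma L2_add: assumes "L2_function f" "L2_function g" shows "L2_function (\<lambda>x. f x + g x)"
  unfolding L2_function_def
proof
  show m: "(\<lambda>x. f x + g x) \<in> borel_measurable LM"
    by (intro borel_measurable_add L2_measurable assms)
  show "integrable LM (\<lambda>x. (cmod (f x + g x))\<^sup>2)"
  proof (rule Bochner_Integration.integrable_bound)
    show "integrable LM (\<lambda>x. 2 * (cmod (f x))\<^sup>2 + 2 * (cmod (g x))\<^sup>2)"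
      by (intro Bochner_Integration.integrable_add integrable_mult_right L2_integrable_square assms)
    show "(\<lambda>x. (cmod (f x + g x))\<^sup>2) \<in> borel_measurable LM"
      using m by measurable
    have "(cmod (a + b))\<^sup>2 \<le> 2 * (cmod a)\<^sup>2 + 2 * (cmod b)\<^sup>2" for a b
    proof -
      have "(cmod (a + b))\<^sup>2 \<le> (cmod a + cmod b)\<^sup>2" by (intro power_mono norm_triangle_ineq) auto
      also have "\<dots> \<le> 2 * (cmod a)\<^sup>2 + 2 * (cmod b)\<^sup>2"
        using sum_squares_bound[of "cmod a" "cmod b"] by (simp add: power2_sum)
      finally show ?thesis .
    qed
    thus "AE x in LM. norm ((cmod (f x + g x))\<^sup>2) \<le> norm (2 * (cmod (f x))\<^sup>2 + 2 * (cmod (g x))\<^sup>2)"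
      by simp
  qed
qed

lemma L2_lincomb: "L2_function f \<Longrightarrow> L2_function g \<Longrightarrow> L2_function (\<lambda>x. a * f x + b * g x)"
  by (intro L2_add L2_cmult)

lemma L2_diff: "L2_function f \<Longrightarrow> L2_function g \<Longrightarrow> L2_function (\<lambda>x. f x - g x)"
  using L2_lincomb[of f g 1 "-1"] by simp

lemma L2_sum: "finite S \<Longrightarrow> (\<And>i. i \<in> S \<Longrightarrow> L2_function (f i)) \<Longrightarrow> L2_function (\<lambda>x. \<Sum>i\<in>S. c i * f i x)"
proof (induction S rule: finite_induct)
  case empty thus ?case by (simp add: L2_function_def)
next
  case (insert i S)
  thus ?case by (simp add: L2_add L2_cmult)
qed

lemma continuous_integrable_LM:
  fixes g :: "real \<Rightarrow> 'a::euclidean_space"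
  assumes "continuous_on {-1..1} g"
  shows "integrable LM g" "integral\<^sup>L LM g = integral {-1..1} g"
proof -
  have "integrable (lebesgue_on {-1..1}) g"
    by (rule continuous_imp_integrable_real[OF assms])
  hence "set_integrable lebesgue {-1..1} g"
    by (simp add: integrable_restrict_space set_integrable_def)
  hence "set_integrable lebesgue {-1<..<1} g"
    by (rule set_integrable_subset) auto
  thus i: "integrable LM g"
    by (simp add: integrable_restrict_space set_integrable_def)
  show "integral\<^sup>L LM g = integral {-1..1} g"
    by (simp add: lebesgue_integral_eq_integral[OF i] integral_open_interval_real)
qed

lemma L2_continuous:
  assumes "continuous_on {-1..1} g" shows "L2_function g"
proof -
  have "continuous_on {-1..1} (\<lambda>x. (cmod (g x))\<^sup>2)" by (intro continuous_intros assms)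
  thus ?thesis
    using continuous_integrable_LM(1)[OF assms] continuous_integrable_LM(1)[of "\<lambda>x. (cmod (g x))\<^sup>2"]
    by (simp add: L2_function_def)
qed

lemma ip_lincomb_left:
  assumes "L2_function f" "L2_function g" "L2_function h"
  shows "ip (\<lambda>x. a * f x + b * g x) h = a * ip f h + b * ip g h"
proof -
  have "integrable LM (\<lambda>x. f x * cnj (h x))" "integrable LM (\<lambda>x. g x * cnj (h x))"
    by (intro L2_integrable_mult L2_cnj assms)+
  thus ?thesis by (simp add: ip_def ring_distribs mult.assoc)
qed

lemma ip_commute: "ip g f = cnj (ip f g)"
proof -
  have "(LINT x|LM. cnj (f x * cnj (g x))) = cnj (ip f g)" unfolding ip_def
    by (rule Bochner_Integration.integral_cnj)
  moreover have "cnj (f x * cnj (g x)) = g x * cnj (f x)" for x by simp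
  ultimately show ?thesis by (simp only: ip_def)
qed

lemma ip_lincomb_right:
  assumes "L2_function f" "L2_function g" "L2_function h"
  shows "ip h (\<lambda>x. a * f x + b * g x) = cnj a * ip h f + cnj b * ip h g"
  using ip_lincomb_left[OF assms, of a b] by (simp add: ip_commute[of h])

lemma ip_diff_left: "L2_function f \<Longrightarrow> L2_function g \<Longrightarrow> L2_function h \<Longrightarrow> ip (\<lambda>x. f x - g x) h = ip f h - ip g h"
  using ip_lincomb_left[of f g h 1 "-1"] by simp

lemma ip_sum_right:
  assumes "finite S" "L2_function h" "\<And>i. i \<in> S \<Longrightarrow> L2_function (f i)"
  shows "ip h (\<lambda>x. \<Sum>i\<in>S. c i * f i x) = (\<Sum>i\<in>S. cnj (c i) * ip h (f i))"
  using assms(1,3)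
proof (induction S rule: finite_induct)
  case empty thus ?case by (simp add: ip_def)
next
  case (insert i S)
  have "ip h (\<lambda>x. c i * f i x + 1 * (\<Sum>i\<in>S. c i * f i x)) = cnj (c i) * ip h (f i) + cnj 1 * ip h (\<lambda>x. \<Sum>i\<in>S. c i * f i x)"
    by (rule ip_lincomb_right) (use insert assms(2) in \<open>auto intro!: L2_sum\<close>)
  thus ?case using insert by simp
qed

lemma ip_self: "ip f f = of_real ((L2_norm f)\<^sup>2)"
proof -
  have "ip f f = (LINT x|LM. complex_of_real ((cmod (f x))\<^sup>2))"
    unfolding ip_def by (intro Bochner_Integration.integral_cong refl) (metis complex_norm_square)
  also have "\<dots> = of_real (LINT x|LM. (cmod (f x))\<^sup>2)"
    by (rule integral_complex_of_real)
  also have "(LINT x|LM. (cmod (f x))\<^sup>2) = (L2_norm f)\<^sup>2"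
    by (simp add: L2_norm_def)
  finally show ?thesis .
qed

lemma L2_norm_nonneg: "L2_norm f \<ge> 0" by (simp add: L2_norm_def)

lemma L2_norm_eq_0_ip:
  assumes "L2_function g" "L2_function f" "L2_norm f = 0"
  shows "ip g f = 0"
proof -
  have "(LINT x|LM. (cmod (f x))\<^sup>2) = 0" using assms(3) by (simp add: L2_norm_def)
  hence "AE x in LM. (cmod (f x))\<^sup>2 = 0"
    using L2_integrable_square[OF assms(2)] by (subst (asm) integral_nonneg_eq_0_iff_AE) auto
  hence "ip g f = (LINT x|LM. 0)"
    unfolding ip_def
    by (intro integral_cong_AE borel_measurable_integrable[OF L2_integrable_mult] L2_cnj assms) auto
  thus ?thesis by simp
qed

lemma pythagoras:
  assumes "L2_function f" "L2_function g" "ip f g = 0"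
  shows "(L2_norm (\<lambda>x. f x + g x))\<^sup>2 = (L2_norm f)\<^sup>2 + (L2_norm g)\<^sup>2"
proof -
  have s: "L2_function (\<lambda>x. 1 * f x + 1 * g x)" by (intro L2_lincomb assms)
  have "ip (\<lambda>x. 1 * f x + 1 * g x) (\<lambda>x. 1 * f x + 1 * g x) = ip f f + ip g g + (ip f g + ip g f)"
    by (simp only: ip_lincomb_left[OF assms(1,2) s] ip_lincomb_right[OF assms(1,2,1)] ip_lincomb_right[OF assms(1,2,2)]) simp
  also have "ip f g + ip g f = 0" using assms(3) ip_commute[of g f] by simp
  finally have "complex_of_real ((L2_norm (\<lambda>x. f x + g x))\<^sup>2) = of_real ((L2_norm f)\<^sup>2 + (L2_norm g)\<^sup>2)"
    by (simp add: ip_self)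
  thus ?thesis using of_real_eq_iff by blast
qed

text \<open>The Cauchy--Schwarz inequality against the constant function, with a constant that is not optimal.\<close>

lemma L1_le:
  assumes "L2_function f" "L2_norm f \<le> \<epsilon>" "\<epsilon> > 0"
  shows "integrable LM (\<lambda>x. cmod (f x))" "(LINT x|LM. cmod (f x)) \<le> 2 * \<epsilon>"
proof -
  interpret finite_measure LM by (rule finite_measure_LM)
  have p: "t \<le> (\<epsilon> + t\<^sup>2 / \<epsilon>) / 2" for t
  proof -
    have "2 * t * \<epsilon> \<le> \<epsilon>\<^sup>2 + t\<^sup>2" using sum_squares_bound[of t \<epsilon>] by (simp add: mult_ac)
    thus ?thesis using assms(3) by (simp add: field_simps power2_eq_square)
  qed
  have i: "integrable LM (\<lambda>x. (\<epsilon> + (cmod (f x))\<^sup>2 / \<epsilon>) / 2)"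
    by (intro integrable_divide Bochner_Integration.integrable_add L2_integrable_square assms integrable_const)
  show j: "integrable LM (\<lambda>x. cmod (f x))"
    by (rule Bochner_Integration.integrable_bound[OF i])
       (use L2_measurable[OF assms(1)] p assms(3) in \<open>auto intro!: AE_I2 borel_measurable_norm intro: order_trans[OF p] abs_ge_self\<close>)
  have "(LINT x|LM. cmod (f x)) \<le> (LINT x|LM. (\<epsilon> + (cmod (f x))\<^sup>2 / \<epsilon>) / 2)"
    by (intro integral_mono i j p)
  also have "\<dots> = (2 * \<epsilon> + (L2_norm f)\<^sup>2 / \<epsilon>) / 2"
    using L2_integrable_square[OF assms(1)]
    by (simp add: Bochner_Integration.integral_add integrable_const measure_LM[simplified] L2_norm_def)
  also have "\<dots> \<le> (2 * \<epsilon> + \<epsilon>\<^sup>2 / \<epsilon>) / 2"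
    by (intro divide_right_mono add_mono power_mono assms L2_norm_nonneg) (use assms(3) in auto)
  also have "\<dots> \<le> 2 * \<epsilon>" using assms(3) by (simp add: power2_eq_square)
  finally show "(LINT x|LM. cmod (f x)) \<le> 2 * \<epsilon>" .
qed

context extension begin

lemma L2_H: "r \<in> H n \<Longrightarrow> L2_function r"
  by (intro L2_continuous H_continuous)

lemma L2_ee: "L2_function (ee k)"
  by (intro L2_continuous continuous_intros)

text \<open>\<open>r\<close> is the orthogonal projection of \<open>f\<close> onto the approximation space.\<close>

definition is_proj :: "nat \<Rightarrow> (real \<Rightarrow> complex) \<Rightarrow> (real \<Rightarrow> complex) \<Rightarrow> bool" where
  "is_proj n f r \<longleftrightarrow> r \<in> H n \<and> (\<forall>h\<in>H n. ip (\<lambda>x. f x - r x) h = 0)"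

text \<open>One Gram--Schmidt step in each induction step; the coefficient vanishes if the new vector has norm
  zero.\<close>

lemma proj_coeffs_exist:
  assumes "finite S" "L2_function f"
  shows "\<exists>c. \<forall>j\<in>S. ip (\<lambda>x. f x - (\<Sum>k\<in>S. c k * ee k x)) (ee j) = 0"
  using assms
proof (induction S arbitrary: f rule: finite_induct)
  case empty thus ?case by simp
next
  case (insert k S)
  obtain c where c: "\<And>j. j \<in> S \<Longrightarrow> ip (\<lambda>x. ee k x - (\<Sum>i\<in>S. c i * ee i x)) (ee j) = 0"
    using insert.IH[OF L2_ee[of k]] by auto
  obtain d where d: "\<And>j. j \<in> S \<Longrightarrow> ip (\<lambda>x. f x - (\<Sum>i\<in>S. d i * ee i x)) (ee j) = 0"
    using insert.IH[OF insert.prems] by auto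
  define e where "e = (\<lambda>x. ee k x - (\<Sum>i\<in>S. c i * ee i x))"
  define g where "g = (\<lambda>x. f x - (\<Sum>i\<in>S. d i * ee i x))"
  define l where "l = (if L2_norm e = 0 then 0 else ip g e / ip e e)"
  have Le: "L2_function e" and Lg: "L2_function g"
    unfolding e_def g_def by (intro L2_diff L2_sum L2_ee insert)+
  have orth: "ip (\<lambda>x. 1 * g x + (- l) * e x) (ee j) = 0" if "j \<in> S" for j
    using ip_lincomb_left[OF Lg Le L2_ee, of 1 "-l" j] c[OF that] d[OF that] by (simp add: e_def g_def)
  have "ip (\<lambda>x. 1 * g x + (- l) * e x) e = 0"
    unfolding ip_lincomb_left[OF Lg Le Le]
    using L2_norm_eq_0_ip[OF Lg Le] ip_self[of e] by (auto simp: l_def)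
  moreover have "ee k = (\<lambda>x. 1 * e x + 1 * (\<Sum>i\<in>S. c i * ee i x))" by (simp add: e_def)
  ultimately have orthk: "ip (\<lambda>x. 1 * g x + (- l) * e x) (ee k) = 0"
  proof -
    have L: "L2_function (\<lambda>x. \<Sum>i\<in>S. c i * ee i x)" by (intro L2_sum L2_ee insert)
    have G: "L2_function (\<lambda>x. 1 * g x + (- l) * e x)" by (intro L2_lincomb Lg Le)
    have "ip (\<lambda>x. 1 * g x + (- l) * e x) (\<lambda>x. 1 * e x + 1 * (\<Sum>i\<in>S. c i * ee i x)) =
       cnj 1 * ip (\<lambda>x. 1 * g x + (- l) * e x) e + cnj 1 * ip (\<lambda>x. 1 * g x + (- l) * e x) (\<lambda>x. \<Sum>i\<in>S. c i * ee i x)"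
      by (rule ip_lincomb_right[OF Le L G])
    also have "ip (\<lambda>x. 1 * g x + (- l) * e x) (\<lambda>x. \<Sum>i\<in>S. c i * ee i x) = (\<Sum>i\<in>S. cnj (c i) * ip (\<lambda>x. 1 * g x + (- l) * e x) (ee i))"
      by (rule ip_sum_right[OF _ G]) (use insert in \<open>auto intro: L2_ee\<close>)
    finally show ?thesis
      using \<open>ip (\<lambda>x. 1 * g x + (- l) * e x) e = 0\<close> orth \<open>ee k = _\<close> by simp
  qed
  define b where "b = (\<lambda>i. if i = k then l else d i - l * c i)"
  have "f x - (\<Sum>i\<in>insert k S. b i * ee i x) = 1 * g x + (- l) * e x" for x
  proof -
    have "(\<Sum>i\<in>S. b i * ee i x) = (\<Sum>i\<in>S. (d i - l * c i) * ee i x)"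
      by (intro sum.cong) (use insert in \<open>auto simp: b_def\<close>)
    also have "\<dots> = (\<Sum>i\<in>S. d i * ee i x) - l * (\<Sum>i\<in>S. c i * ee i x)"
      unfolding sum_distrib_left sum_subtractf[symmetric] by (simp add: algebra_simps)
    finally show ?thesis
      by (simp add: insert(1,2) g_def e_def) (simp add: b_def algebra_simps)
  qed
  thus ?case using orth orthk by (intro exI[of _ b]) auto
qed

lemma is_proj_exists: assumes "L2_function f" shows "\<exists>r. is_proj n f r"
proof -
  obtain c where c: "\<And>j. j \<in> {-int n..int n} \<Longrightarrow> ip (\<lambda>x. f x - (\<Sum>k\<in>{-int n..int n}. c k * ee k x)) (ee j) = 0"
    using proj_coeffs_exist[OF _ assms, of "{-int n..int n}"] by blast
  define r where "r = (\<lambda>x. \<Sum>k\<in>{-int n..int n}. c k * ee k x)"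
  have r: "r \<in> H n" by (rule HI) (simp add: r_def)
  have "ip (\<lambda>x. f x - r x) h = 0" if "h \<in> H n" for h
  proof -
    from that obtain a where a: "h = (\<lambda>x. \<Sum>k\<in>{-int n..int n}. a k * ee k x)" by (auto simp: H_eq_span)
    have "ip (\<lambda>x. f x - r x) h = (\<Sum>k\<in>{-int n..int n}. cnj (a k) * ip (\<lambda>x. f x - r x) (ee k))"
      unfolding a by (intro ip_sum_right L2_diff assms L2_H[OF r] L2_ee) auto
    also have "\<dots> = 0" by (intro sum.neutral ballI) (simp add: c r_def)
    finally show ?thesis .
  qed
  thus ?thesis using r by (auto simp: is_proj_def)
qed

lemma is_proj_pythagoras:
  assumes "L2_function f" "is_proj n f r" "q \<in> H n"
  shows "(L2_norm (\<lambda>x. f x - q x))\<^sup>2 = (L2_norm (\<lambda>x. f x - r x))\<^sup>2 + (L2_norm (\<lambda>x. r x - q x))\<^sup>2"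
proof -
  have r: "r \<in> H n" using assms(2) by (simp add: is_proj_def)
  have "(L2_norm (\<lambda>x. (f x - r x) + (r x - q x)))\<^sup>2 = (L2_norm (\<lambda>x. f x - r x))\<^sup>2 + (L2_norm (\<lambda>x. r x - q x))\<^sup>2"
    by (intro pythagoras L2_diff assms L2_H[OF r] L2_H[OF assms(3)])
       (use assms r in \<open>auto simp: is_proj_def intro!: H_diff\<close>)
  thus ?thesis by simp
qed

lemma is_proj_norm_le:
  assumes "L2_function f" "is_proj n f r" shows "L2_norm r \<le> L2_norm f"
proof (rule power2_le_imp_le)
  show "(L2_norm r)\<^sup>2 \<le> (L2_norm f)\<^sup>2"
    using is_proj_pythagoras[OF assms H_zero] by simp
qed (rule L2_norm_nonneg)

lemma inj_on_ee_1: "inj_on (ee 1) {-1..1}"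
proof (rule inj_onI)
  fix x y :: real assume xy: "x \<in> {-1..1}" "y \<in> {-1..1}" "ee 1 x = ee 1 y"
  have "2 * al * t \<in> {-pi<..pi}" if t: "t \<in> {-1..1}" for t
    unfolding greaterThanAtMost_iff using al_range[OF t] al by linarith
  hence "Arg (ee 1 t) = 2 * al * t" if "t \<in> {-1..1}" for t
    using that by (simp add: ee_def Arg_cis del: greaterThanAtMost_iff)
  hence "2 * al * x = 2 * al * y" using xy by metis
  thus "x = y" using al by simp
qed

text \<open>After multiplication by \<open>ee n\<close>, an element of the space is a polynomial in \<open>ee 1\<close>. This gives
  uniqueness of the minimizer as a function on the whole line.\<close>

lemma H_eq_0_of_vanishing:
  assumes r: "r \<in> H n" and z: "\<And>x. x \<in> {-1<..<1} \<Longrightarrow> r x = 0"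
  shows "r = (\<lambda>x. 0)"
proof
  fix x
  from r obtain c where c: "\<And>x. r x = (\<Sum>k\<in>{-int n..int n}. c k * ee k x)" by (rule HE) blast
  define p where "p = (\<Sum>j\<le>2 * n. monom (c (int j - int n)) j)"
  have p: "poly p (ee 1 x) = ee (int n) x * r x" for x
  proof -
    have e: "ee 1 x ^ j = ee (int j) x" for j
      by (induction j) (auto simp: ee_mult, simp add: ee_def)
    have "(\<Sum>k\<in>{-int n..int n}. c k * ee (int n + k) x) = (\<Sum>j\<le>2 * n. c (int j - int n) * ee (int j) x)"
      by (rule sum.reindex_bij_witness[of _ "\<lambda>j. int j - int n" "\<lambda>k. nat (int n + k)"]) auto
    thus ?thesis by (simp add: p_def poly_sum poly_monom e c sum_distrib_left ee_mult[symmetric] mult_ac)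
  qed
  have "ee 1 ` {-1<..<1} \<subseteq> {w. poly p w = 0}" using p z by auto
  moreover have "inj_on (ee 1) {-1<..<1}"
    by (rule inj_on_subset[OF inj_on_ee_1]) auto
  hence "infinite (ee 1 ` {-1<..<1})" by (simp add: finite_image_iff)
  ultimately have "p = 0" using poly_roots_finite[of p] finite_subset by blast
  hence "ee (int n) x * r x = 0" using p[of x] by simp
  thus "r x = 0" by (simp add: ee_def)
qed

lemma H_eq_0_of_norm:
  assumes r: "r \<in> H n" and z: "L2_norm r = 0"
  shows "r = (\<lambda>x. 0)"
proof (rule H_eq_0_of_vanishing[OF r])
  fix x :: real assume x: "x \<in> {-1<..<1}"
  have c: "continuous_on {-1..1} (\<lambda>x. (cmod (r x))\<^sup>2)" by (intro continuous_intros H_continuous[OF r])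
  have "integral {-1..1} (\<lambda>x. (cmod (r x))\<^sup>2) = 0"
    using z continuous_integrable_LM(2)[OF c] by (simp add: L2_norm_def)
  hence "((\<lambda>x. (cmod (r x))\<^sup>2) has_integral 0) (cbox (-1) 1)"
    using integrable_continuous_real[OF c] by (simp add: has_integral_iff)
  from has_integral_0_cbox_imp_0[OF _ _ this, of x] c x have "(cmod (r x))\<^sup>2 = 0" by auto
  thus "r x = 0" by simp
qed

lemma fourier_extension_is_proj:
  assumes "L2_function f" shows "is_proj n f (fourier_extension T (2 * n + 1) f)"
proof -
  obtain r where r: "is_proj n f r" using is_proj_exists[OF assms] by blast
  have rH: "r \<in> H n" using r by (simp add: is_proj_def)
  have "fourier_extension T (2 * n + 1) f = r"
    unfolding fourier_extension_def H_def[symmetric]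
  proof (rule the_equality)
    show "is_arg_min (\<lambda>r. L2_norm (\<lambda>x. f x - r x)) (\<lambda>r. r \<in> H n) r"
      unfolding is_arg_min_def
    proof (intro conjI rH notI)
      assume "\<exists>y. y \<in> H n \<and> L2_norm (\<lambda>x. f x - y x) < L2_norm (\<lambda>x. f x - r x)"
      then obtain y where y: "y \<in> H n" "L2_norm (\<lambda>x. f x - y x) < L2_norm (\<lambda>x. f x - r x)" by blast
      have "(L2_norm (\<lambda>x. f x - y x))\<^sup>2 < (L2_norm (\<lambda>x. f x - r x))\<^sup>2"
        by (rule power_strict_mono[OF y(2)]) (auto simp: L2_norm_nonneg)
      with is_proj_pythagoras[OF assms r y(1)] show False by (smt (verit) zero_le_power2)
    qed
    fix q assume "is_arg_min (\<lambda>r. L2_norm (\<lambda>x. f x - r x)) (\<lambda>r. r \<in> H n) q"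
    hence q: "q \<in> H n" "L2_norm (\<lambda>x. f x - q x) \<le> L2_norm (\<lambda>x. f x - r x)"
      using rH by (auto simp: is_arg_min_def not_less)
    have "(L2_norm (\<lambda>x. f x - q x))\<^sup>2 \<le> (L2_norm (\<lambda>x. f x - r x))\<^sup>2"
      by (rule power_mono[OF q(2)]) (rule L2_norm_nonneg)
    with is_proj_pythagoras[OF assms r q(1)] have "L2_norm (\<lambda>x. r x - q x) = 0"
      by (smt (verit) zero_le_power2 zero_eq_power2)
    from H_eq_0_of_norm[OF H_diff[OF rH q(1)] this] show "q = r"
      by (auto simp: fun_eq_iff)
  qed
  thus ?thesis using r by simp
qed

lemma is_proj_diff:
  assumes "is_proj n f r" "q \<in> H n" shows "is_proj n (\<lambda>x. f x - q x) (\<lambda>x. r x - q x)"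
  using assms by (auto simp: is_proj_def H_diff)

end

section \<open>Comparison of the projection with a cosine partial sum\<close>

lemma integral_reflect_symmetric: "integral {-1..1} (\<lambda>x::real. f (- x)) = integral {-1..1} f"
  using Henstock_Kurzweil_Integration.integral_reflect_real[where a = "-1" and b = 1 and f = f] by simp

lemma integral_symmetrize:
  fixes r :: "real \<Rightarrow> complex" and w :: "real \<Rightarrow> real" and c :: real
  assumes w: "continuous_on {-1..1} w" and r: "continuous_on {-1..1} r"
  shows "integral {-1..1} (\<lambda>y. w y *\<^sub>R ((r y + c *\<^sub>R r (- y)) / 2))
       = integral {-1..1} (\<lambda>y. ((w y + c * w (- y)) / 2) *\<^sub>R r y)"
proof -
  have w': "continuous_on {-1..1} (\<lambda>y. w (- y))" and r': "continuous_on {-1..1} (\<lambda>y. r (- y))"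
    by (rule continuous_on_compose2[OF w] continuous_on_compose2[OF r]; auto intro!: continuous_intros)+
  have i: "(\<lambda>y. (w y / 2) *\<^sub>R r y) integrable_on {-1..1}"
    "(\<lambda>y. (c / 2) *\<^sub>R (w y *\<^sub>R r (- y))) integrable_on {-1..1}"
    "(\<lambda>y. (c / 2) *\<^sub>R (w (- y) *\<^sub>R r y)) integrable_on {-1..1}"
    by (intro integrable_continuous_real continuous_intros w w' r r'; simp)+
  have refl: "integral {-1..1} (\<lambda>y. (c / 2) *\<^sub>R (w y *\<^sub>R r (- y))) = integral {-1..1} (\<lambda>y. (c / 2) *\<^sub>R (w (- y) *\<^sub>R r y))"
    using integral_reflect_symmetric[of "\<lambda>y. (c / 2) *\<^sub>R (w (- y) *\<^sub>R r y)"] by simp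
  have "integral {-1..1} (\<lambda>y. w y *\<^sub>R ((r y + c *\<^sub>R r (- y)) / 2))
      = integral {-1..1} (\<lambda>y. (w y / 2) *\<^sub>R r y + (c / 2) *\<^sub>R (w y *\<^sub>R r (- y)))"
    by (intro integral_cong) (simp add: scaleR_conv_of_real field_simps)
  also have "\<dots> = integral {-1..1} (\<lambda>y. (w y / 2) *\<^sub>R r y + (c / 2) *\<^sub>R (w (- y) *\<^sub>R r y))"
    unfolding Henstock_Kurzweil_Integration.integral_add[OF i(1,2)]
      Henstock_Kurzweil_Integration.integral_add[OF i(1,3)] refl ..
  also have "\<dots> = integral {-1..1} (\<lambda>y. ((w y + c * w (- y)) / 2) *\<^sub>R r y)"
    by (intro integral_cong) (simp add: scaleR_conv_of_real field_simps)
  finally show ?thesis .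
qed

lemma cos_nat_times_pi_minus: "cos (real j * (pi - t)) = (-1) ^ j * cos (real j * t)"
proof -
  have "real j * (pi - t) = real j * pi - real j * t" by (simp add: algebra_simps)
  thus ?thesis by (simp only: cos_diff cos_npi sin_npi)
qed

context extension begin

lemma is_proj_pairing:
  assumes f: "L2_function f" and r: "is_proj n f r" and h: "h \<in> H n"
    and g: "\<And>x. x \<in> {-1..1} \<Longrightarrow> h x = complex_of_real (g x)" and cg: "continuous_on {-1..1} g"
  shows "(LINT x|LM. g x *\<^sub>R f x) = integral {-1..1} (\<lambda>x. g x *\<^sub>R r x)"
proof -
  have rH: "r \<in> H n" using r by (simp add: is_proj_def)
  have "ip (\<lambda>x. f x - r x) h = 0" using r h by (simp add: is_proj_def)
  hence "ip f h = ip r h" by (simp add: ip_diff_left[OF f L2_H[OF rH] L2_H[OF h]])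
  moreover have "ip u h = (LINT x|LM. g x *\<^sub>R u x)" for u
    unfolding ip_def by (rule Bochner_Integration.integral_cong) (auto simp: g scaleR_conv_of_real)
  moreover have "(LINT x|LM. g x *\<^sub>R r x) = integral {-1..1} (\<lambda>x. g x *\<^sub>R r x)"
    by (intro continuous_integrable_LM continuous_intros cg H_continuous[OF rH])
  ultimately show ?thesis by simp
qed

text \<open>The parts of the kernel that are even and odd in each variable.\<close>

definition K_even where "K_even m x y = (K m x y + K m x (- y)) / 2"
definition K_odd where "K_odd m x y = (K m x y - K m x (- y)) / 2"

lemma K_reflect:
  assumes "y \<in> {-1..1}"
  shows "K m x (- y) = 1 + 2 * (\<Sum>j=1..m. (-1) ^ j * (cos (real j * th x) * cos (real j * th y)))"
  by (simp add: K_def cos_kernel_def th_minus[OF assms] cos_nat_times_pi_minus mult_ac)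

lemma K_even_eq:
  assumes "y \<in> {-1..1}"
  shows "K_even m x y = 1 + (\<Sum>j=1..m. cos (real j * th x) * ((1 + (-1) ^ j) * cos (real j * th y)))"
proof -
  have "K_even m x y = 1 + ((\<Sum>j=1..m. cos (real j * th x) * cos (real j * th y))
      + (\<Sum>j=1..m. (-1) ^ j * (cos (real j * th x) * cos (real j * th y))))"
    unfolding K_even_def K_reflect[OF assms] by (simp add: K_def cos_kernel_def)
  thus ?thesis unfolding sum.distrib[symmetric] by (simp add: algebra_simps)
qed

lemma K_odd_eq:
  assumes "y \<in> {-1..1}"
  shows "K_odd m x y = (\<Sum>j=1..m. cos (real j * th x) * ((1 - (-1) ^ j) * cos (real j * th y)))"
proof -
  have "K_odd m x y = (\<Sum>j=1..m. cos (real j * th x) * cos (real j * th y))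
      - (\<Sum>j=1..m. (-1) ^ j * (cos (real j * th x) * cos (real j * th y)))"
    unfolding K_odd_def K_reflect[OF assms] by (simp add: K_def cos_kernel_def)
  thus ?thesis unfolding sum_subtractf[symmetric] by (simp add: algebra_simps)
qed

lemma K_even_in_H:
  obtains h where "h \<in> H n" "\<And>y. y \<in> {-1..1} \<Longrightarrow> h y = complex_of_real (K_even (2 * n) x y)"
proof -
  have "\<exists>h. h \<in> H n \<and> (\<forall>y\<in>{-1..1}. h y = complex_of_real ((1 + (-1) ^ j) * cos (real j * th y)))" if "j \<le> 2 * n" for j
  proof (cases "even j")
    case True
    then obtain i where i: "j = 2 * i" by blast
    have "i \<le> n" using that i by simp
    then obtain h where h: "h \<in> H n" "\<And>y. y \<in> {-1..1} \<Longrightarrow> h y = complex_of_real (cE i y)"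
      by (rule H_cE) blast
    show ?thesis
      by (rule exI[of _ "\<lambda>y. 2 * h y"]) (use h in \<open>auto simp: H_cmult i cE_def\<close>)
  next
    case False
    thus ?thesis by (intro exI[of _ "\<lambda>y. 0"]) (auto simp: H_zero)
  qed
  then obtain h where h: "\<And>j. j \<le> 2 * n \<Longrightarrow> h j \<in> H n"
    "\<And>j y. j \<le> 2 * n \<Longrightarrow> y \<in> {-1..1} \<Longrightarrow> h j y = complex_of_real ((1 + (-1) ^ j) * cos (real j * th y))" 
    by metis
  have one: "(\<lambda>x. 1) \<in> H n" using H_cos[of 0 n] by simp
  have "(\<lambda>y. 1 + (\<Sum>j=1..2 * n. complex_of_real (cos (real j * th x)) * h j y)) \<in> H n"
    by (intro H_add one H_sum) (auto intro: h)
  thus ?thesis by (rule that) (simp add: K_even_eq h)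
qed

lemma K_odd_in_H:
  obtains h where "h \<in> H n" "\<And>y. y \<in> {-1..1} \<Longrightarrow> h y = complex_of_real (rho y * K_odd (2 * n) x y)"
proof -
  have "\<exists>h. h \<in> H n \<and> (\<forall>y\<in>{-1..1}. h y = complex_of_real (rho y * ((1 - (-1) ^ j) * cos (real j * th y))))" if "j \<le> 2 * n" for j
  proof (cases "even j")
    case False
    then obtain i where i: "j = 2 * i + 1" by (elim oddE)
    have "i < n" using that i by simp
    then obtain h where h: "h \<in> H n" "\<And>y. y \<in> {-1..1} \<Longrightarrow> h y = complex_of_real (cO i y)"
      by (rule H_cO) blast
    show ?thesis
      by (rule exI[of _ "\<lambda>y. 2 * h y"]) (use h in \<open>auto simp: H_cmult i cO_def\<close>)
  next
    case True
    thus ?thesis by (intro exI[of _ "\<lambda>y. 0"]) (auto simp: H_zero)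
  qed
  then obtain h where h: "\<And>j. j \<le> 2 * n \<Longrightarrow> h j \<in> H n"
    "\<And>j y. j \<le> 2 * n \<Longrightarrow> y \<in> {-1..1} \<Longrightarrow> h j y = complex_of_real (rho y * ((1 - (-1) ^ j) * cos (real j * th y)))" 
    by metis
  have "(\<lambda>y. \<Sum>j\<in>{1..2 * n}. complex_of_real (cos (real j * th x)) * h j y) \<in> H n"
    by (rule H_sum) (auto intro: h)
  thus ?thesis by (rule that) (simp add: K_odd_eq h sum_distrib_left mult_ac)
qed

lemma continuous_on_K_minus: "continuous_on {-1..1} (\<lambda>y. K m x (- y))"
  by (rule continuous_on_compose2[OF continuous_on_K[of "{-1..1}"]]) (auto intro!: continuous_intros)

lemma continuous_on_K_even_odd: "continuous_on {-1..1} (K_even m x)" "continuous_on {-1..1} (K_odd m x)"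
  unfolding K_even_def K_odd_def by (intro continuous_intros continuous_on_K_minus continuous_on_K; simp)+

lemma LM_integrable_scaleR:
  fixes w :: "real \<Rightarrow> real"
  assumes "continuous_on {-1..1} w" "L2_function f"
  shows "integrable LM (\<lambda>y. w y *\<^sub>R f y)"
proof -
  have "L2_function (\<lambda>y. complex_of_real (w y))" by (intro L2_continuous continuous_intros assms)
  from L2_integrable_mult[OF this assms(2)] show ?thesis by (simp add: scaleR_conv_of_real)
qed

text \<open>Up to an error controlled by the norm of \<open>f\<close>, the projection is a partial sum of a cosine
  expansion in the angle. Both parities are treated in the same way: reproduce the even or odd part of
  \<open>r\<close> by the kernel, exchange the weights \<open>rho\<close> and \<open>sg\<close> inside the integral for their values at \<open>x\<close>
  at the cost of commutators, and use that \<open>r\<close> and \<open>f\<close> have the same inner products with the even part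
  of the kernel and with \<open>rho\<close> times its odd part. The even part leaves \<open>rho\<close> outside the integral and the
  odd part leaves it inside; \<open>E3\<close> accounts for this difference.\<close>

lemma projection_vs_kernel:
  assumes f: "L2_function f" and r: "is_proj n f r" and \<epsilon>: "L2_norm f \<le> \<epsilon>" "\<epsilon> > 0"
    and x: "x \<in> {-1..1}" "sg x > 0"
  shows "cmod (vE x *\<^sub>R r x - (sg x * rho x) *\<^sub>R (LINT y|LM. K (2 * n) x y *\<^sub>R f y))
          \<le> (16 + 12 / cos al + 16 / sg x) * \<epsilon>"
proof -
  define m where "m = 2 * n"
  define C1 where "C1 = 4 + 2 / cos al + 4 / sg x"
  define re where "re = (\<lambda>y. (r y + r (- y)) / 2)"
  define ro where "ro = (\<lambda>y. (r y - r (- y)) / 2)"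
  have rH: "r \<in> H n" using r by (simp add: is_proj_def)
  have cr: "continuous_on A r" for A by (rule H_continuous[OF rH])
  have cr': "continuous_on A (\<lambda>y. r (- y))" for A
    by (rule continuous_on_compose2[OF cr[of UNIV]]) (auto intro!: continuous_intros)
  have cre: "continuous_on {-1..1} re" and cro: "continuous_on {-1..1} ro"
    unfolding re_def ro_def by (intro continuous_intros cr cr'; simp)+
  have C1: "C1 \<ge> 0" using x kk by (simp add: C1_def)
  have cK: "continuous_on {-1..1} (K m' x)" for m' by (rule continuous_on_K) simp
  have L1r: "integral {-1..1} (\<lambda>y. cmod (r y)) \<le> 2 * \<epsilon>"
  proof -
    have "L2_norm r \<le> \<epsilon>" using is_proj_norm_le[OF f r] \<epsilon> by simp
    from L1_le(2)[OF L2_H[OF rH] this \<epsilon>(2)] show ?thesis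
      by (subst (asm) continuous_integrable_LM(2)) (intro continuous_intros cr)
  qed
  have L1r': "integral {-1..1} (\<lambda>y. cmod (r (- y))) \<le> 2 * \<epsilon>"
    using L1r integral_reflect_symmetric[of "\<lambda>y. cmod (r y)"] by simp
  have half: "integral {-1..1} (\<lambda>y. (cmod (r y) + cmod (r (- y))) / 2) \<le> 2 * \<epsilon>"
  proof -
    have "integral {-1..1} (\<lambda>y. (cmod (r y) + cmod (r (- y))) / 2)
        = (integral {-1..1} (\<lambda>y. cmod (r y)) + integral {-1..1} (\<lambda>y. cmod (r (- y)))) / 2"
      by (simp add: Henstock_Kurzweil_Integration.integral_add[symmetric] integrable_continuous_real continuous_intros cr cr')
    thus ?thesis using L1r L1r' by simp
  qed
  have part: "cmod (integral {-1..1} (\<lambda>y. w y *\<^sub>R g y)) \<le> C1 * (2 * \<epsilon>)"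
    if w: "continuous_on {-1..1} w" "\<And>y. y \<in> {-1..1} \<Longrightarrow> \<bar>w y\<bar> \<le> C1"
      and g: "continuous_on {-1..1} g" "\<And>y. cmod (g y) \<le> (cmod (r y) + cmod (r (- y))) / 2"
    for w :: "real \<Rightarrow> real" and g :: "real \<Rightarrow> complex"
  proof -
    have "cmod (integral {-1..1} (\<lambda>y. w y *\<^sub>R g y)) \<le> integral {-1..1} (\<lambda>y. C1 * ((cmod (r y) + cmod (r (- y))) / 2))"
    proof (rule integral_norm_bound_integral)
      show "(\<lambda>y. w y *\<^sub>R g y) integrable_on {-1..1}"
        by (intro integrable_continuous_real continuous_intros w g)
      show "(\<lambda>y. C1 * ((cmod (r y) + cmod (r (- y))) / 2)) integrable_on {-1..1}"
        by (intro integrable_continuous_real continuous_intros cr cr') simp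
      fix y :: real assume "y \<in> {-1..1}"
      thus "norm (w y *\<^sub>R g y) \<le> C1 * ((cmod (r y) + cmod (r (- y))) / 2)"
        unfolding norm_scaleR using w(2)[of y] g(2)[of y] C1 by (intro mult_mono) auto
    qed
    also have "\<dots> = C1 * integral {-1..1} (\<lambda>y. (cmod (r y) + cmod (r (- y))) / 2)"
      by (rule Henstock_Kurzweil_Integration.integral_mult_right)
    also have "\<dots> \<le> C1 * (2 * \<epsilon>)" by (intro mult_left_mono half C1)
    finally show ?thesis .
  qed
  have tri: "cmod (re y) \<le> (cmod (r y) + cmod (r (- y))) / 2" "cmod (ro y) \<le> (cmod (r y) + cmod (r (- y))) / 2" for y
    using norm_triangle_ineq[of "r y" "r (- y)"] norm_triangle_ineq4[of "r y" "r (- y)"]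
    by (auto simp: re_def ro_def norm_divide)
  \<comment> \<open>\<open>a\<close> and \<open>b\<close> are products of \<open>rho\<close> and \<open>sg\<close> that agree for \<open>y = x\<close>; the degrees of the two kernels
    differ because of the factor \<open>sin\<^sup>2\<close> in the reproducing formula.\<close>
  have bK: "\<bar>a * K (m + 2) x y - b * K m x y\<bar> \<le> C1"
    if y: "y \<in> {-1..1}" and a: "\<bar>a\<bar> \<le> 1" and ab: "\<bar>a - b\<bar> \<le> \<bar>rho y - rho x\<bar> + \<bar>sg y - sg x\<bar>" for a b y
  proof -
    have "a * K (m + 2) x y - b * K m x y = a * (K (m + 2) x y - K m x y) + (a - b) * K m x y"
      by (simp add: algebra_simps)
    hence "\<bar>a * K (m + 2) x y - b * K m x y\<bar> \<le> \<bar>a\<bar> * \<bar>K (m + 2) x y - K m x y\<bar> + \<bar>a - b\<bar> * \<bar>K m x y\<bar>"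
      by (metis abs_mult abs_triangle_ineq)
    also have "\<dots> \<le> 1 * 4 + (\<bar>rho y - rho x\<bar> + \<bar>sg y - sg x\<bar>) * \<bar>K m x y\<bar>"
      unfolding K_def by (intro add_mono mult_mono a ab cos_kernel_add2_diff) auto
    also have "\<dots> = 4 + \<bar>rho y - rho x\<bar> * \<bar>K m x y\<bar> + \<bar>sg y - sg x\<bar> * \<bar>K m x y\<bar>"
      by (simp add: algebra_simps)
    also have "\<dots> \<le> C1"
      unfolding C1_def by (intro add_mono rho_commutator[OF x(1) y] sg_commutator[OF x(1) y x(2)] order_refl)
    finally show ?thesis .
  qed
  have rb: "0 \<le> rho y" "rho y \<le> 1" "0 \<le> sg y" "sg y \<le> 1" if "y \<in> {-1..1}" for y
    using rho_pos[OF that] rho_le_1 sg_nonneg[OF that] sg_le_1[OF that] by auto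
  have E1: "cmod (vE x *\<^sub>R re x - (sg x * rho x) *\<^sub>R integral {-1..1} (\<lambda>y. K m x y *\<^sub>R re y)) \<le> C1 * (2 * \<epsilon>)"
  proof -
    have rep: "((\<lambda>y. (rho y * sg y * K (m + 2) x y) *\<^sub>R re y) has_integral vE x *\<^sub>R re x) {-1..1}"
      using reproduced_even_part[OF rH] x(1) by (auto simp: reproduced_def re_def m_def)
    have "((\<lambda>y. (sg x * rho x) *\<^sub>R (K m x y *\<^sub>R re y)) has_integral
        (sg x * rho x) *\<^sub>R integral {-1..1} (\<lambda>y. K m x y *\<^sub>R re y)) {-1..1}"
      by (intro has_integral_cmul integrable_integral integrable_continuous_real continuous_intros cK cre)
    from has_integral_diff[OF rep this]
    have "vE x *\<^sub>R re x - (sg x * rho x) *\<^sub>R integral {-1..1} (\<lambda>y. K m x y *\<^sub>R re y)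
      = integral {-1..1} (\<lambda>y. (rho y * sg y * K (m + 2) x y - sg x * rho x * K m x y) *\<^sub>R re y)"
      by (simp add: integral_unique scaleR_diff_left)
    also have "cmod \<dots> \<le> C1 * (2 * \<epsilon>)"
    proof (rule part[OF _ _ cre tri(1)])
      show "continuous_on {-1..1} (\<lambda>y. rho y * sg y * K (m + 2) x y - sg x * rho x * K m x y)"
        by (intro continuous_intros cK)
      fix y :: real assume y: "y \<in> {-1..1}"
      show "\<bar>rho y * sg y * K (m + 2) x y - sg x * rho x * K m x y\<bar> \<le> C1"
      proof (rule bK[OF y])
        show "\<bar>rho y * sg y\<bar> \<le> 1" using rb[OF y] by (simp add: abs_mult mult_le_one)
        have "rho y * sg y - sg x * rho x = (rho y - rho x) * sg y + rho x * (sg y - sg x)"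
          by (simp add: algebra_simps)
        hence "\<bar>rho y * sg y - sg x * rho x\<bar> \<le> \<bar>rho y - rho x\<bar> * \<bar>sg y\<bar> + \<bar>rho x\<bar> * \<bar>sg y - sg x\<bar>"
          by (metis abs_mult abs_triangle_ineq)
        also have "\<dots> \<le> \<bar>rho y - rho x\<bar> * 1 + 1 * \<bar>sg y - sg x\<bar>"
          using rb[OF y] rb[OF x(1)] by (intro add_mono mult_mono) auto
        finally show "\<bar>rho y * sg y - sg x * rho x\<bar> \<le> \<bar>rho y - rho x\<bar> + \<bar>sg y - sg x\<bar>" by simp
      qed
    qed
    finally show ?thesis .
  qed
  have E2: "cmod (vE x *\<^sub>R ro x - sg x *\<^sub>R integral {-1..1} (\<lambda>y. (rho y * K m x y) *\<^sub>R ro y)) \<le> C1 * (2 * \<epsilon>)"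
  proof -
    have "((\<lambda>y. (sg y * K (m + 2) x y) *\<^sub>R ro y) has_integral vO x *\<^sub>R ro x) {-1..1}"
      using reproduced_odd_part[OF rH] x(1) by (auto simp: reproduced_def ro_def m_def)
    from has_integral_cmul[OF this, of "rho x"]
    have rep: "((\<lambda>y. rho x *\<^sub>R (sg y * K (m + 2) x y) *\<^sub>R ro y) has_integral vE x *\<^sub>R ro x) {-1..1}"
      using rho_pos[OF x(1)] by simp
    have "((\<lambda>y. sg x *\<^sub>R ((rho y * K m x y) *\<^sub>R ro y)) has_integral
        sg x *\<^sub>R integral {-1..1} (\<lambda>y. (rho y * K m x y) *\<^sub>R ro y)) {-1..1}"
      by (intro has_integral_cmul integrable_integral integrable_continuous_real continuous_intros cK cro)
    from has_integral_diff[OF rep this]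
    have "vE x *\<^sub>R ro x - sg x *\<^sub>R integral {-1..1} (\<lambda>y. (rho y * K m x y) *\<^sub>R ro y)
      = integral {-1..1} (\<lambda>y. ((rho x * sg y) * K (m + 2) x y - (sg x * rho y) * K m x y) *\<^sub>R ro y)"
      by (simp add: integral_unique scaleR_diff_left mult.assoc)
    also have "cmod \<dots> \<le> C1 * (2 * \<epsilon>)"
    proof (rule part[OF _ _ cro tri(2)])
      show "continuous_on {-1..1} (\<lambda>y. (rho x * sg y) * K (m + 2) x y - (sg x * rho y) * K m x y)"
        by (intro continuous_intros cK)
      fix y :: real assume y: "y \<in> {-1..1}"
      show "\<bar>(rho x * sg y) * K (m + 2) x y - (sg x * rho y) * K m x y\<bar> \<le> C1"
      proof (rule bK[OF y])
        show "\<bar>rho x * sg y\<bar> \<le> 1" using rb[OF y] rb[OF x(1)] by (simp add: abs_mult mult_le_one)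
        have "rho x * sg y - sg x * rho y = rho x * (sg y - sg x) - sg x * (rho y - rho x)"
          by (simp add: algebra_simps)
        hence "\<bar>rho x * sg y - sg x * rho y\<bar> \<le> \<bar>rho x\<bar> * \<bar>sg y - sg x\<bar> + \<bar>sg x\<bar> * \<bar>rho y - rho x\<bar>"
          by (metis abs_mult abs_triangle_ineq4)
        also have "\<dots> \<le> 1 * \<bar>sg y - sg x\<bar> + 1 * \<bar>rho y - rho x\<bar>"
          using rb[OF y] rb[OF x(1)] by (intro add_mono mult_mono) auto
        finally show "\<bar>rho x * sg y - sg x * rho y\<bar> \<le> \<bar>rho y - rho x\<bar> + \<bar>sg y - sg x\<bar>" by simp
      qed
    qed
    finally show ?thesis .
  qed
  have F1: "integral {-1..1} (\<lambda>y. K m x y *\<^sub>R re y) = (LINT y|LM. K_even m x y *\<^sub>R f y)"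
  proof -
    have "integral {-1..1} (\<lambda>y. K m x y *\<^sub>R re y) = integral {-1..1} (\<lambda>y. K_even m x y *\<^sub>R r y)"
      using integral_symmetrize[OF cK cr, of m 1] by (simp add: re_def K_even_def)
    also obtain h where h: "h \<in> H n" "\<And>y. y \<in> {-1..1} \<Longrightarrow> h y = complex_of_real (K_even m x y)"
      using K_even_in_H[of n x] unfolding m_def by blast
    have "integral {-1..1} (\<lambda>y. K_even m x y *\<^sub>R r y) = (LINT y|LM. K_even m x y *\<^sub>R f y)"
      by (rule is_proj_pairing[OF f r h(1,2) continuous_on_K_even_odd(1), symmetric])
    finally show ?thesis .
  qed
  have F2: "integral {-1..1} (\<lambda>y. (rho y * K m x y) *\<^sub>R ro y) = (LINT y|LM. (rho y * K_odd m x y) *\<^sub>R f y)"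
  proof -
    have c: "continuous_on {-1..1} (\<lambda>y. rho y * K m x y)" by (intro continuous_intros cK)
    have "integral {-1..1} (\<lambda>y. (rho y * K m x y) *\<^sub>R ro y) = integral {-1..1} (\<lambda>y. (rho y * K_odd m x y) *\<^sub>R r y)"
      using integral_symmetrize[OF c cr, of "-1"] by (simp add: ro_def K_odd_def algebra_simps)
    also obtain h where h: "h \<in> H n" "\<And>y. y \<in> {-1..1} \<Longrightarrow> h y = complex_of_real (rho y * K_odd m x y)"
      using K_odd_in_H[of n x] unfolding m_def by blast
    have c: "continuous_on {-1..1} (\<lambda>y. rho y * K_odd m x y)" by (intro continuous_intros continuous_on_K_even_odd)
    have "integral {-1..1} (\<lambda>y. (rho y * K_odd m x y) *\<^sub>R r y) = (LINT y|LM. (rho y * K_odd m x y) *\<^sub>R f y)"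
      by (rule is_proj_pairing[OF f r h(1,2) c, symmetric])
    finally show ?thesis .
  qed
  have E3: "cmod ((sg x * rho x) *\<^sub>R (LINT y|LM. K_even m x y *\<^sub>R f y) + sg x *\<^sub>R (LINT y|LM. (rho y * K_odd m x y) *\<^sub>R f y)
       - (sg x * rho x) *\<^sub>R (LINT y|LM. K m x y *\<^sub>R f y)) \<le> 2 / cos al * (2 * \<epsilon>)"
  proof -
    have i: "integrable LM (\<lambda>y. K_even m x y *\<^sub>R f y)" "integrable LM (\<lambda>y. (rho y * K_odd m x y) *\<^sub>R f y)"
      "integrable LM (\<lambda>y. K m x y *\<^sub>R f y)" "integrable LM (\<lambda>y. ((rho y - rho x) * K_odd m x y) *\<^sub>R f y)"
      by (intro LM_integrable_scaleR f continuous_intros continuous_on_K_even_odd cK)+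
    have "(sg x * rho x) *\<^sub>R (LINT y|LM. K_even m x y *\<^sub>R f y) + sg x *\<^sub>R (LINT y|LM. (rho y * K_odd m x y) *\<^sub>R f y)
       - (sg x * rho x) *\<^sub>R (LINT y|LM. K m x y *\<^sub>R f y)
      = (LINT y|LM. (sg x * rho x) *\<^sub>R (K_even m x y *\<^sub>R f y) + sg x *\<^sub>R ((rho y * K_odd m x y) *\<^sub>R f y)
          - (sg x * rho x) *\<^sub>R (K m x y *\<^sub>R f y))"
      using i(1-3) by (simp only: Bochner_Integration.integral_diff Bochner_Integration.integral_add
          integral_scaleR_right Bochner_Integration.integrable_add integrable_scaleR_right)
    also have "\<dots> = (LINT y|LM. sg x *\<^sub>R (((rho y - rho x) * K_odd m x y) *\<^sub>R f y))"
    proof (rule Bochner_Integration.integral_cong[OF refl])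
      fix y
      have "K m x y = K_even m x y + K_odd m x y" by (simp add: K_even_def K_odd_def field_simps)
      thus "(sg x * rho x) *\<^sub>R (K_even m x y *\<^sub>R f y) + sg x *\<^sub>R ((rho y * K_odd m x y) *\<^sub>R f y)
          - (sg x * rho x) *\<^sub>R (K m x y *\<^sub>R f y) = sg x *\<^sub>R (((rho y - rho x) * K_odd m x y) *\<^sub>R f y)"
        by (simp add: algebra_simps)
    qed
    also have "cmod \<dots> \<le> (LINT y|LM. 2 / cos al * cmod (f y))"
    proof (rule Bochner_Integration.integral_norm_bound_integral)
      show "integrable LM (\<lambda>y. sg x *\<^sub>R (((rho y - rho x) * K_odd m x y) *\<^sub>R f y))" by (intro integrable_scaleR_right i(4))
      show "integrable LM (\<lambda>y. 2 / cos al * cmod (f y))" using L1_le(1)[OF f \<epsilon>] by simp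
      fix y assume "y \<in> space LM"
      hence y: "y \<in> {-1..1}" by simp
      have "\<bar>rho y - rho x\<bar> * \<bar>K_odd m x y\<bar> \<le> \<bar>rho y - rho x\<bar> * ((\<bar>K m x y\<bar> + \<bar>K m x (- y)\<bar>) / 2)"
        by (intro mult_left_mono) (auto simp: K_odd_def)
      also have "\<dots> = (\<bar>rho y - rho x\<bar> * \<bar>K m x y\<bar> + \<bar>rho (- y) - rho x\<bar> * \<bar>K m x (- y)\<bar>) / 2"
        by (simp add: algebra_simps add_divide_distrib)
      also have "\<dots> \<le> (2 / cos al + 2 / cos al) / 2"
        by (intro divide_right_mono add_mono rho_commutator x) (use y in auto)
      finally have b: "\<bar>rho y - rho x\<bar> * \<bar>K_odd m x y\<bar> \<le> 2 / cos al" by simp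
      have "norm (sg x *\<^sub>R (((rho y - rho x) * K_odd m x y) *\<^sub>R f y)) = sg x * ((\<bar>rho y - rho x\<bar> * \<bar>K_odd m x y\<bar>) * cmod (f y))"
        using x by (simp add: abs_mult)
      also have "\<dots> \<le> 1 * (2 / cos al * cmod (f y))"
        using rb[OF x(1)] kk by (intro mult_mono b) (auto intro!: mult_nonneg_nonneg)
      finally show "norm (sg x *\<^sub>R (((rho y - rho x) * K_odd m x y) *\<^sub>R f y)) \<le> 2 / cos al * cmod (f y)" by simp
    qed
    also have "\<dots> = 2 / cos al * (LINT y|LM. cmod (f y))" by simp
    also have "\<dots> \<le> 2 / cos al * (2 * \<epsilon>)"
      by (intro mult_left_mono L1_le(2)[OF f \<epsilon>]) (use kk in auto)
    finally show ?thesis .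
  qed
  have "vE x *\<^sub>R r x - (sg x * rho x) *\<^sub>R (LINT y|LM. K m x y *\<^sub>R f y)
    = (vE x *\<^sub>R re x - (sg x * rho x) *\<^sub>R (LINT y|LM. K_even m x y *\<^sub>R f y))
     + (vE x *\<^sub>R ro x - sg x *\<^sub>R (LINT y|LM. (rho y * K_odd m x y) *\<^sub>R f y))
     + ((sg x * rho x) *\<^sub>R (LINT y|LM. K_even m x y *\<^sub>R f y) + sg x *\<^sub>R (LINT y|LM. (rho y * K_odd m x y) *\<^sub>R f y)
       - (sg x * rho x) *\<^sub>R (LINT y|LM. K m x y *\<^sub>R f y))"
  proof -
    have "r x = re x + ro x" by (simp add: re_def ro_def field_simps)
    thus ?thesis by (simp only: scaleR_add_right) simp
  qed
  also have "cmod \<dots> \<le> C1 * (2 * \<epsilon>) + C1 * (2 * \<epsilon>) + 2 / cos al * (2 * \<epsilon>)"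
    by (intro norm_triangle_le add_mono E3 E1[unfolded F1] E2[unfolded F2])
  also have "\<dots> = (16 + 12 / cos al + 16 / sg x) * \<epsilon>"
    by (simp add: C1_def algebra_simps)
  finally show ?thesis by (simp add: m_def)
qed

end

section \<open>A local bound for the projection\<close>

lemma sin_half_ge_symmetric:
  assumes "0 < \<eta>" "\<eta> \<le> t" "t \<le> 2 * pi - \<eta>"
  shows "\<eta> / pi \<le> sin (t / 2)"
proof (cases "t \<le> pi")
  case True
  have "\<eta> / pi \<le> t / pi" using assms by (simp add: divide_right_mono)
  thus ?thesis using sin_half_ge[of t] True assms by simp
next
  case False
  have "\<eta> / pi \<le> (2 * pi - t) / pi" using assms by (simp add: divide_right_mono)
  also have "\<dots> \<le> sin ((2 * pi - t) / 2)" by (rule sin_half_ge) (use False assms in auto)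
  also have "(2 * pi - t) / 2 = pi - t / 2" by simp
  finally show ?thesis by (simp only: sin_pi_minus)
qed

lemma dirichlet_minus: "dirichlet m (- t) = dirichlet m t"
  by (simp add: dirichlet_def)

lemma abs_dirichlet_le_inverse:
  assumes "0 < \<eta>" "\<eta> \<le> t" "t \<le> 2 * pi - \<eta>"
  shows "\<bar>dirichlet m t\<bar> \<le> pi / \<eta>"
proof -
  have "\<eta> / pi * \<bar>dirichlet m t\<bar> \<le> sin (t / 2) * \<bar>dirichlet m t\<bar>"
    by (intro mult_right_mono sin_half_ge_symmetric assms) auto
  also have "\<dots> \<le> \<bar>sin (t / 2) * dirichlet m t\<bar>" by (simp add: abs_mult mult_right_mono)
  also have "\<dots> \<le> 1" by (simp only: sin_half_times_dirichlet) simp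
  finally show ?thesis using assms(1) by (simp add: field_simps)
qed

text \<open>The reflected Dirichlet kernel \<open>dirichlet m (\<theta> + t)\<close> is bounded since \<open>\<theta>\<close> stays away from \<open>0\<close> and \<open>\<pi>\<close>.\<close>

lemma cos_kernel_oscillation:
  fixes F :: "real \<Rightarrow> complex"
  assumes \<eta>: "0 < \<eta>" "\<eta> \<le> 1" and \<theta>: "\<eta> \<le> \<theta>" "\<theta> \<le> pi - \<eta>"
    and cont: "continuous_on {\<theta>-\<eta>..\<theta>+\<eta>} F"
    and bd: "\<And>t. t \<in> {\<theta>-\<eta>..\<theta>+\<eta>} \<Longrightarrow> norm (F t) \<le> \<epsilon>"
    and osc: "\<And>t t'. t \<in> {\<theta>-\<eta>..\<theta>+\<eta>} \<Longrightarrow> t' \<in> {\<theta>-\<eta>..\<theta>+\<eta>} \<Longrightarrow>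
       \<bar>t - t'\<bar> \<le> pi / (real m + 1/2) \<Longrightarrow> norm (F t - F t') \<le> W"
  shows "norm (integral {\<theta>-\<eta>..\<theta>+\<eta>} (\<lambda>t. cos_kernel m \<theta> t *\<^sub>R F t)) \<le> 5 * pi * \<epsilon> + pi * W * ln (real m + 2)"
proof -
  let ?I = "{\<theta>-\<eta>..\<theta>+\<eta>}"
  let ?B = "4 * pi * \<epsilon> + pi * W * ln (real m + 2)"
  have c: "continuous_on ?I (\<lambda>t. dirichlet m (t - \<theta>) *\<^sub>R F t)" "continuous_on ?I (\<lambda>t. dirichlet m (\<theta> + t) *\<^sub>R F t)"
    by (intro continuous_intros cont)+
  have right: "norm (integral {\<theta>..\<theta>+\<eta>} (\<lambda>t. dirichlet m (t - \<theta>) *\<^sub>R F t)) \<le> ?B"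
  proof -
    have "integral {\<theta>..\<theta>+\<eta>} (\<lambda>t. dirichlet m (t - \<theta>) *\<^sub>R F t) = integral {0..\<eta>} (\<lambda>t. dirichlet m t *\<^sub>R F (t + \<theta>))"
      using integral_shift_real_ivl[of \<theta> \<theta> "\<theta> + \<eta>" "\<lambda>t. dirichlet m (t - \<theta>) *\<^sub>R F t"] by simp
    also have "norm \<dots> \<le> ?B"
    proof (rule dirichlet_oscillation[OF _ \<eta>])
      show "continuous_on {0..\<eta>} (\<lambda>t. F (t + \<theta>))"
        by (rule continuous_on_compose2[OF cont]) (auto intro!: continuous_intros)
    qed (auto intro!: bd osc)
    finally show ?thesis .
  qed
  have left: "norm (integral {\<theta>-\<eta>..\<theta>} (\<lambda>t. dirichlet m (t - \<theta>) *\<^sub>R F t)) \<le> ?B"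
  proof -
    have "integral {\<theta>-\<eta>..\<theta>} (\<lambda>t. dirichlet m (t - \<theta>) *\<^sub>R F t) = integral {-\<eta>..0} (\<lambda>t. dirichlet m t *\<^sub>R F (t + \<theta>))"
      using integral_shift_real_ivl[of "\<theta>-\<eta>" \<theta> "\<theta>" "\<lambda>t. dirichlet m (t - \<theta>) *\<^sub>R F t"] by simp
    also have "\<dots> = integral {0..\<eta>} (\<lambda>t. dirichlet m t *\<^sub>R F (\<theta> - t))"
      using Henstock_Kurzweil_Integration.integral_reflect_real[where a = 0 and b = \<eta> and f = "\<lambda>t. dirichlet m t *\<^sub>R F (\<theta> - t)"]
      by (simp add: dirichlet_minus add.commute)
    also have "norm \<dots> \<le> ?B"
    proof (rule dirichlet_oscillation[OF _ \<eta>])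
      show "continuous_on {0..\<eta>} (\<lambda>t. F (\<theta> - t))"
        by (rule continuous_on_compose2[OF cont]) (auto intro!: continuous_intros)
      fix t t' assume "t \<in> {0..\<eta>}" "t' \<in> {0..\<eta>}" "\<bar>t - t'\<bar> \<le> pi / (real m + 1/2)"
      thus "cmod (F (\<theta> - t) - F (\<theta> - t')) \<le> W"
        by (intro osc) (auto simp: abs_minus_commute)
    qed (auto intro!: bd)
    finally show ?thesis .
  qed
  have both: "norm (integral ?I (\<lambda>t. dirichlet m (t - \<theta>) *\<^sub>R F t)) \<le> ?B + ?B"
  proof -
    have "integral ?I (\<lambda>t. dirichlet m (t - \<theta>) *\<^sub>R F t) = integral {\<theta>-\<eta>..\<theta>} (\<lambda>t. dirichlet m (t - \<theta>) *\<^sub>R F t)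
       + integral {\<theta>..\<theta>+\<eta>} (\<lambda>t. dirichlet m (t - \<theta>) *\<^sub>R F t)"
      by (rule Henstock_Kurzweil_Integration.integral_combine[symmetric])
         (use \<eta> integrable_continuous_real[OF c(1)] in auto)
    thus ?thesis using norm_triangle_le[OF add_mono[OF left right]] by simp
  qed
  have refl: "norm (integral ?I (\<lambda>t. dirichlet m (\<theta> + t) *\<^sub>R F t)) \<le> 2 * pi * \<epsilon>"
  proof -
    have "norm (integral ?I (\<lambda>t. dirichlet m (\<theta> + t) *\<^sub>R F t)) \<le> (pi / \<eta> * \<epsilon>) * (\<theta> + \<eta> - (\<theta> - \<eta>))"
    proof (rule integral_bound[OF _ c(2)])
      fix t assume t: "t \<in> ?I"
      show "norm (dirichlet m (\<theta> + t) *\<^sub>R F t) \<le> pi / \<eta> * \<epsilon>"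
        unfolding norm_scaleR
        by (intro mult_mono bd t) (use t \<theta> \<eta> in \<open>auto intro!: abs_dirichlet_le_inverse\<close>)
    qed (use \<eta> in auto)
    also have "\<dots> = 2 * pi * \<epsilon>" using \<eta> by simp
    finally show ?thesis .
  qed
  have "2 *\<^sub>R integral ?I (\<lambda>t. cos_kernel m \<theta> t *\<^sub>R F t) = integral ?I (\<lambda>t. 2 *\<^sub>R (cos_kernel m \<theta> t *\<^sub>R F t))"
    by (rule integral_cmul[symmetric])
  also have "\<dots> = integral ?I (\<lambda>t. dirichlet m (t - \<theta>) *\<^sub>R F t + dirichlet m (\<theta> + t) *\<^sub>R F t)"
  proof (rule integral_cong)
    fix t
    have "2 * cos_kernel m \<theta> t = dirichlet m (t - \<theta>) + dirichlet m (\<theta> + t)"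
      unfolding cos_kernel_dirichlet using dirichlet_minus[of m "t - \<theta>"] by simp
    thus "2 *\<^sub>R (cos_kernel m \<theta> t *\<^sub>R F t) = dirichlet m (t - \<theta>) *\<^sub>R F t + dirichlet m (\<theta> + t) *\<^sub>R F t"
      by (simp only: scaleR_scaleR scaleR_add_left)
  qed
  also have "\<dots> = integral ?I (\<lambda>t. dirichlet m (t - \<theta>) *\<^sub>R F t) + integral ?I (\<lambda>t. dirichlet m (\<theta> + t) *\<^sub>R F t)"
    by (intro Henstock_Kurzweil_Integration.integral_add integrable_continuous_real c)
  finally have "norm (2 *\<^sub>R integral ?I (\<lambda>t. cos_kernel m \<theta> t *\<^sub>R F t)) \<le> (?B + ?B) + 2 * pi * \<epsilon>"
    using norm_triangle_le[OF add_mono[OF both refl]] by simp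
  thus ?thesis by simp
qed

context extension begin

lemma kernel_far_bound:
  assumes x: "x \<in> {-1..1}" and y: "y \<in> {-1..1}" and \<eta>: "0 < \<eta>" "\<eta> \<le> th x" "th x \<le> pi - \<eta>"
    and far: "\<eta> \<le> \<bar>th y - th x\<bar>"
  shows "\<bar>K m x y\<bar> \<le> (pi / \<eta>)\<^sup>2"
proof -
  have ty: "0 \<le> th y" "th y \<le> pi" using th_range[OF y] by auto
  have "\<eta> / pi \<le> sin ((th x + th y) / 2)" by (rule sin_half_ge_symmetric) (use \<eta> ty in auto)
  moreover have "\<eta> / pi \<le> sin (\<bar>th y - th x\<bar> / 2)" by (rule sin_half_ge_symmetric) (use \<eta> ty far in auto)
  moreover have "sin (\<bar>th y - th x\<bar> / 2) \<le> \<bar>sin ((th y - th x) / 2)\<bar>"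
  proof -
    have "sin (\<bar>u\<bar> / 2) \<le> \<bar>sin (u / 2)\<bar>" for u :: real
    proof (cases "u \<ge> 0")
      case False
      hence "\<bar>u\<bar> / 2 = - (u / 2)" by simp
      thus ?thesis by (simp only: sin_minus abs_ge_minus_self)
    qed simp
    thus ?thesis .
  qed
  ultimately have "(\<eta> / pi) * (\<eta> / pi) \<le> \<bar>sin ((th x + th y) / 2)\<bar> * \<bar>sin ((th y - th x) / 2)\<bar>"
    using \<eta> by (intro mult_mono) auto
  hence "2 * (\<eta> / pi)\<^sup>2 \<le> \<bar>cos (th x) - cos (th y)\<bar>"
    by (simp add: cos_diff_cos abs_mult power2_eq_square)
  hence "2 * (\<eta> / pi)\<^sup>2 * \<bar>K m x y\<bar> \<le> \<bar>cos (th x) - cos (th y)\<bar> * \<bar>K m x y\<bar>"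
    by (intro mult_right_mono) auto
  also have "\<dots> \<le> 2" unfolding K_def by (rule cos_kernel_bound)
  finally show ?thesis using \<eta> by (simp add: field_simps)
qed

text \<open>Far from \<open>x\<close> the kernel is bounded. Near \<open>x\<close> the integral is transformed to the angle, after a
  weight \<open>rho\<close> has been moved inside and before the Jacobian factor \<open>sin \<phi>\<close> is moved outside.\<close>

lemma kernel_integral_bound:
  assumes x: "x \<in> {-1..1}" and \<eta>: "0 < \<eta>" "\<eta> \<le> 1" "\<eta> \<le> th x" "th x \<le> pi - \<eta>"
    and f: "L2_function f" and \<epsilon>: "L2_norm f \<le> \<epsilon>" "\<epsilon> > 0"
    and I: "\<And>y. \<bar>y - x\<bar> \<le> XL * \<eta> \<Longrightarrow> y \<in> {c..d}"
    and cont: "continuous_on {c..d} f" and bd: "\<And>y. y \<in> {c..d} \<Longrightarrow> cmod (f y) \<le> \<epsilon>"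
    and osc: "\<And>y y'. y \<in> {c..d} \<Longrightarrow> y' \<in> {c..d} \<Longrightarrow> \<bar>y - y'\<bar> \<le> XL * (pi / (real m + 1/2)) \<Longrightarrow>
       cmod (f y - f y') \<le> W"
  shows "rho x * cmod (LINT y|LM. K m x y *\<^sub>R f y)
     \<le> (2 / cos al + (pi / \<eta>)\<^sup>2) * (2 * \<epsilon>)
       + kk / al * (5 * pi * \<epsilon> + pi * W * ln (real m + 2) + 8 / sg x * \<epsilon>)"
proof -
  define \<theta> where "\<theta> = th x"
  define p where "p = X (\<theta> + \<eta>)"
  define q where "q = X (\<theta> - \<eta>)"
  define C where "C = 2 / cos al + (pi / \<eta>)\<^sup>2"
  have C0: "C \<ge> 0" using kk by (simp add: C_def)
  have \<theta>: "\<eta> \<le> \<theta>" "\<theta> \<le> pi - \<eta>" using \<eta> by (auto simp: \<theta>_def)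
  have sgx: "sg x > 0" using sin_gt_zero[of "th x"] sin_th[OF x] \<eta> by simp
  have Xin: "X \<phi> \<in> {c..d}" if "\<phi> \<in> {\<theta>-\<eta>..\<theta>+\<eta>}" for \<phi>
  proof (rule I)
    have "\<bar>X \<phi> - X \<theta>\<bar> \<le> XL * \<bar>\<phi> - \<theta>\<bar>" by (rule X_Lipschitz)
    also have "\<dots> \<le> XL * \<eta>" using that XL_pos by (intro mult_left_mono) auto
    finally show "\<bar>X \<phi> - x\<bar> \<le> XL * \<eta>" by (simp add: \<theta>_def X_th[OF x])
  qed
  have pq: "{p..q} \<subseteq> {c..d}" using Xin[of "\<theta> + \<eta>"] Xin[of "\<theta> - \<eta>"] \<eta> by (auto simp: p_def q_def)
  have pq1: "{p..q} \<subseteq> {-1..1}" using X_range[of "\<theta>+\<eta>"] X_range[of "\<theta>-\<eta>"] by (auto simp: p_def q_def)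
  have far: "\<eta> \<le> \<bar>th y - th x\<bar>" if y: "y \<in> {-1..1}" "y \<notin> {p..q}" for y
  proof (rule ccontr)
    assume "\<not> ?thesis"
    hence h: "\<theta> - \<eta> \<le> th y" "th y \<le> \<theta> + \<eta>" by (auto simp: \<theta>_def)
    have "p \<le> X (th y)" "X (th y) \<le> q"
      unfolding p_def q_def by (intro X_antimono; use h \<theta> th_range[OF y(1)] in auto)+
    thus False using y X_th[OF y(1)] by simp
  qed
  have cK: "continuous_on A (K m x)" if "A \<subseteq> {-1..1}" for A by (rule continuous_on_K[OF that])
  define g where "g = (\<lambda>y. if y \<in> {p..q} then (rho y * K m x y) *\<^sub>R f y else 0)"
  have g_eq: "g = (\<lambda>y. indicator {p..q} y *\<^sub>R ((rho y * K m x y) *\<^sub>R f y))"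
    by (auto simp: g_def fun_eq_iff)
  have i1: "integrable LM (\<lambda>y. (rho y * K m x y) *\<^sub>R f y)"
    by (intro LM_integrable_scaleR f continuous_intros cK) simp
  have i2: "integrable LM g"
    unfolding g_eq
  proof (rule Bochner_Integration.integrable_bound[OF i1])
    have "{p..q} \<inter> space LM \<in> sets LM" by (simp add: sets_restrict_space_iff)
    hence "(\<lambda>y. indicator {p..q} y :: real) \<in> borel_measurable LM"
      by (simp add: borel_measurable_indicator_iff)
    thus "(\<lambda>y. indicator {p..q} y *\<^sub>R ((rho y * K m x y) *\<^sub>R f y)) \<in> borel_measurable LM"
      using borel_measurable_integrable[OF i1] by (rule borel_measurable_scaleR)
  qed (auto simp: indicator_def)
  have i3: "integrable LM (\<lambda>y. rho x *\<^sub>R (K m x y *\<^sub>R f y))"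
    by (intro integrable_scaleR_right LM_integrable_scaleR f cK) simp
  have near_far: "cmod (rho x *\<^sub>R (LINT y|LM. K m x y *\<^sub>R f y) - (LINT y|LM. g y)) \<le> C * (2 * \<epsilon>)"
  proof -
    have "rho x *\<^sub>R (LINT y|LM. K m x y *\<^sub>R f y) - (LINT y|LM. g y) = (LINT y|LM. rho x *\<^sub>R (K m x y *\<^sub>R f y) - g y)"
      by (simp only: Bochner_Integration.integral_diff[OF i3 i2] integral_scaleR_right)
    also have "cmod \<dots> \<le> (LINT y|LM. C * cmod (f y))"
    proof (rule Bochner_Integration.integral_norm_bound_integral)
      show "integrable LM (\<lambda>y. rho x *\<^sub>R (K m x y *\<^sub>R f y) - g y)"
        by (intro Bochner_Integration.integrable_diff i3 i2)
      show "integrable LM (\<lambda>y. C * cmod (f y))" using L1_le(1)[OF f \<epsilon>] by simp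
      fix y assume "y \<in> space LM"
      hence y: "y \<in> {-1..1}" by simp
      show "norm (rho x *\<^sub>R (K m x y *\<^sub>R f y) - g y) \<le> C * cmod (f y)"
      proof (cases "y \<in> {p..q}")
        case True
        hence "rho x *\<^sub>R (K m x y *\<^sub>R f y) - g y = ((rho x - rho y) * K m x y) *\<^sub>R f y"
          by (simp add: g_def algebra_simps)
        hence "norm (rho x *\<^sub>R (K m x y *\<^sub>R f y) - g y) = (\<bar>rho y - rho x\<bar> * \<bar>K m x y\<bar>) * cmod (f y)"
          by (simp add: abs_mult abs_minus_commute)
        also have "\<dots> \<le> C * cmod (f y)"
        proof (rule mult_right_mono)
          show "\<bar>rho y - rho x\<bar> * \<bar>K m x y\<bar> \<le> C"
            unfolding C_def using rho_commutator[OF x y, of m] zero_le_power2[of "pi / \<eta>"] by linarith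
        qed simp
        finally show ?thesis .
      next
        case False
        have "norm (rho x *\<^sub>R (K m x y *\<^sub>R f y) - g y) = (rho x * \<bar>K m x y\<bar>) * cmod (f y)"
        proof -
          have "g y = 0" unfolding g_def using False by (rule if_not_P)
          thus ?thesis using rho_pos[OF x] by (simp add: abs_mult)
        qed
        also have "\<dots> \<le> (1 * (pi / \<eta>)\<^sup>2) * cmod (f y)"
          using rho_pos[OF x] rho_le_1
          by (intro mult_right_mono mult_mono kernel_far_bound x y \<eta> far False) auto
        also have "\<dots> \<le> C * cmod (f y)" using kk by (intro mult_right_mono) (auto simp: C_def)
        finally show ?thesis .
      qed
    qed
    also have "\<dots> = C * (LINT y|LM. cmod (f y))" by simp
    also have "\<dots> \<le> C * (2 * \<epsilon>)" by (intro mult_left_mono L1_le(2)[OF f \<epsilon>] C0)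
    finally show ?thesis .
  qed
  define F where "F = (\<lambda>\<phi>. f (X \<phi>))"
  have cF: "continuous_on {\<theta>-\<eta>..\<theta>+\<eta>} F"
    unfolding F_def by (rule continuous_on_compose2[OF cont]) (auto intro!: continuous_intros Xin simp del: atLeastAtMost_iff)
  have ck: "continuous_on A (cos_kernel m \<theta>)" for A
    using continuous_on_cos_kernel[of A "\<lambda>_. \<theta>" "\<lambda>x. x" m] by simp
  have g_int: "(LINT y|LM. g y) = (kk / al) *\<^sub>R integral {\<theta>-\<eta>..\<theta>+\<eta>} (\<lambda>\<phi>. sin \<phi> *\<^sub>R (cos_kernel m \<theta> \<phi> *\<^sub>R F \<phi>))"
  proof -
    have "(LINT y|LM. g y) = integral {-1<..<1} g"
      by (rule lebesgue_integral_eq_integral[OF i2]) simp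
    also have "\<dots> = integral {-1..1} g" by (rule integral_open_interval_real[symmetric])
    also have "\<dots> = integral ({p..q} \<inter> {-1..1}) (\<lambda>y. (rho y * K m x y) *\<^sub>R f y)"
      unfolding g_def by (rule integral_restrict_Int)
    also have "{p..q} \<inter> {-1..1} = {p..q}" using pq1 by blast
    also have "integral {p..q} (\<lambda>y. (rho y * K m x y) *\<^sub>R f y) = integral {p..q} (\<lambda>y. rho y *\<^sub>R (K m x y *\<^sub>R f y))"
      by simp
    also have "\<dots> = (kk / al) *\<^sub>R integral {\<theta>-\<eta>..\<theta>+\<eta>} (\<lambda>\<phi>. sin \<phi> *\<^sub>R (K m x (X \<phi>) *\<^sub>R f (X \<phi>)))"
      unfolding p_def q_def
      by (rule integral_X)
         (use \<theta> \<eta> pq pq1 in \<open>auto simp: p_def[symmetric] q_def[symmetric] intro!: continuous_intros cK continuous_on_subset[OF cont]\<close>)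
    also have "integral {\<theta>-\<eta>..\<theta>+\<eta>} (\<lambda>\<phi>. sin \<phi> *\<^sub>R (K m x (X \<phi>) *\<^sub>R f (X \<phi>)))
       = integral {\<theta>-\<eta>..\<theta>+\<eta>} (\<lambda>\<phi>. sin \<phi> *\<^sub>R (cos_kernel m \<theta> \<phi> *\<^sub>R F \<phi>))"
      by (rule integral_cong) (use \<theta> in \<open>simp add: K_def th_X F_def \<theta>_def[symmetric]\<close>)
    finally show ?thesis .
  qed
  have Fbd: "cmod (F \<phi>) \<le> \<epsilon>" if "\<phi> \<in> {\<theta>-\<eta>..\<theta>+\<eta>}" for \<phi>
    unfolding F_def by (intro bd Xin that)
  have main: "cmod (integral {\<theta>-\<eta>..\<theta>+\<eta>} (\<lambda>\<phi>. cos_kernel m \<theta> \<phi> *\<^sub>R F \<phi>)) \<le> 5 * pi * \<epsilon> + pi * W * ln (real m + 2)"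
  proof (rule cos_kernel_oscillation[OF \<eta>(1,2) \<theta> cF Fbd])
    fix t t' assume t: "t \<in> {\<theta>-\<eta>..\<theta>+\<eta>}" "t' \<in> {\<theta>-\<eta>..\<theta>+\<eta>}" "\<bar>t - t'\<bar> \<le> pi / (real m + 1/2)"
    have "\<bar>X t - X t'\<bar> \<le> XL * \<bar>t - t'\<bar>" by (rule X_Lipschitz)
    also have "\<dots> \<le> XL * (pi / (real m + 1/2))" using t XL_pos by (intro mult_left_mono) auto
    finally show "cmod (F t - F t') \<le> W" unfolding F_def by (intro osc Xin t)
  qed
  have comm: "cmod (integral {\<theta>-\<eta>..\<theta>+\<eta>} (\<lambda>\<phi>. ((sin \<phi> - sin \<theta>) * cos_kernel m \<theta> \<phi>) *\<^sub>R F \<phi>)) \<le> 8 / sg x * \<epsilon>"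
  proof -
    have "cmod (integral {\<theta>-\<eta>..\<theta>+\<eta>} (\<lambda>\<phi>. ((sin \<phi> - sin \<theta>) * cos_kernel m \<theta> \<phi>) *\<^sub>R F \<phi>))
       \<le> (4 / sg x * \<epsilon>) * (\<theta> + \<eta> - (\<theta> - \<eta>))"
    proof (rule integral_bound)
      show "continuous_on {\<theta>-\<eta>..\<theta>+\<eta>} (\<lambda>\<phi>. ((sin \<phi> - sin \<theta>) * cos_kernel m \<theta> \<phi>) *\<^sub>R F \<phi>)"
        by (intro continuous_intros ck cF)
      fix \<phi> assume p: "\<phi> \<in> {\<theta>-\<eta>..\<theta>+\<eta>}"
      hence p': "\<phi> \<in> {0..pi}" using \<theta> by auto
      have "sin \<phi> = sg (X \<phi>)" "sin \<theta> = sg x"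
        using sin_th[OF X_range, of \<phi>] th_X[OF p'] sin_th[OF x] by (auto simp: \<theta>_def)
      hence "\<bar>sin \<phi> - sin \<theta>\<bar> * \<bar>cos_kernel m \<theta> \<phi>\<bar> \<le> 4 / sg x"
        using sg_commutator[OF x X_range sgx, of \<phi> m] by (simp add: K_def th_X[OF p'] \<theta>_def)
      thus "norm (((sin \<phi> - sin \<theta>) * cos_kernel m \<theta> \<phi>) *\<^sub>R F \<phi>) \<le> 4 / sg x * \<epsilon>"
        unfolding norm_scaleR abs_mult using sgx by (intro mult_mono Fbd p) auto
    qed (use \<eta> in auto)
    also have "\<dots> \<le> 8 / sg x * \<epsilon>"
    proof -
      have "(4 / sg x * \<epsilon>) * (2 * \<eta>) \<le> (4 / sg x * \<epsilon>) * 2"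
        using \<eta> \<epsilon> sgx by (intro mult_left_mono) auto
      thus ?thesis by simp
    qed
    finally show ?thesis .
  qed
  have "integral {\<theta>-\<eta>..\<theta>+\<eta>} (\<lambda>\<phi>. sin \<phi> *\<^sub>R (cos_kernel m \<theta> \<phi> *\<^sub>R F \<phi>))
      = integral {\<theta>-\<eta>..\<theta>+\<eta>} (\<lambda>\<phi>. sin \<theta> *\<^sub>R (cos_kernel m \<theta> \<phi> *\<^sub>R F \<phi>) + ((sin \<phi> - sin \<theta>) * cos_kernel m \<theta> \<phi>) *\<^sub>R F \<phi>)"
    by (intro integral_cong) (simp add: algebra_simps)
  also have "\<dots> = sin \<theta> *\<^sub>R integral {\<theta>-\<eta>..\<theta>+\<eta>} (\<lambda>\<phi>. cos_kernel m \<theta> \<phi> *\<^sub>R F \<phi>)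
      + integral {\<theta>-\<eta>..\<theta>+\<eta>} (\<lambda>\<phi>. ((sin \<phi> - sin \<theta>) * cos_kernel m \<theta> \<phi>) *\<^sub>R F \<phi>)"
    by (subst Henstock_Kurzweil_Integration.integral_add)
       (auto intro!: integrable_continuous_real continuous_intros ck cF simp only: integral_cmul)
  also have "cmod \<dots> \<le> (5 * pi * \<epsilon> + pi * W * ln (real m + 2)) + 8 / sg x * \<epsilon>"
  proof (intro norm_triangle_le add_mono comm)
    have "cmod (sin \<theta> *\<^sub>R integral {\<theta>-\<eta>..\<theta>+\<eta>} (\<lambda>\<phi>. cos_kernel m \<theta> \<phi> *\<^sub>R F \<phi>))
       \<le> 1 * cmod (integral {\<theta>-\<eta>..\<theta>+\<eta>} (\<lambda>\<phi>. cos_kernel m \<theta> \<phi> *\<^sub>R F \<phi>))"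
      unfolding norm_scaleR by (intro mult_right_mono) auto
    with main show "cmod (sin \<theta> *\<^sub>R integral {\<theta>-\<eta>..\<theta>+\<eta>} (\<lambda>\<phi>. cos_kernel m \<theta> \<phi> *\<^sub>R F \<phi>)) \<le> 5 * pi * \<epsilon> + pi * W * ln (real m + 2)"
      by simp
  qed
  finally have "kk / al * cmod (integral {\<theta>-\<eta>..\<theta>+\<eta>} (\<lambda>\<phi>. sin \<phi> *\<^sub>R (cos_kernel m \<theta> \<phi> *\<^sub>R F \<phi>)))
      \<le> kk / al * (5 * pi * \<epsilon> + pi * W * ln (real m + 2) + 8 / sg x * \<epsilon>)"
    by (rule mult_left_mono) (use kk al in simp)
  moreover have "\<bar>kk / al\<bar> = kk / al" using kk al by simp
  ultimately have "cmod (LINT y|LM. g y) \<le> kk / al * (5 * pi * \<epsilon> + pi * W * ln (real m + 2) + 8 / sg x * \<epsilon>)"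
    unfolding g_int norm_scaleR by (simp only:)
  moreover have "rho x * cmod (LINT y|LM. K m x y *\<^sub>R f y) = cmod (rho x *\<^sub>R (LINT y|LM. K m x y *\<^sub>R f y))"
    using rho_pos[OF x] by simp
  moreover have "cmod (rho x *\<^sub>R (LINT y|LM. K m x y *\<^sub>R f y))
      \<le> cmod (rho x *\<^sub>R (LINT y|LM. K m x y *\<^sub>R f y) - (LINT y|LM. g y)) + cmod (LINT y|LM. g y)"
    using norm_triangle_sub[of "rho x *\<^sub>R (LINT y|LM. K m x y *\<^sub>R f y)" "LINT y|LM. g y"] by linarith
  ultimately show ?thesis using near_far unfolding C_def by linarith
qed

text \<open>Away from the endpoints, the projection is controlled by the norm of \<open>f\<close>, the supremum of \<open>f\<close>
  on a slightly larger interval, and the modulus of continuity of \<open>f\<close> at scale \<open>1/n\<close> on that interval,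
  the last with a logarithmic factor. The constant does not depend on \<open>f\<close> and \<open>n\<close>.\<close>

lemma projection_local_bound:
  assumes "-1 \<le> c'" "c' < c" "c \<le> d" "d < d'" "d' \<le> 1"
  obtains C where "C > 0"
    "\<And>n f r \<epsilon> W x. \<lbrakk>L2_function f; is_proj n f r; L2_norm f \<le> \<epsilon>; \<epsilon> > 0; continuous_on {c'..d'} f;
       \<And>y. y \<in> {c'..d'} \<Longrightarrow> cmod (f y) \<le> \<epsilon>;
       \<And>y y'. y \<in> {c'..d'} \<Longrightarrow> y' \<in> {c'..d'} \<Longrightarrow> \<bar>y - y'\<bar> \<le> XL * (pi / (real (2 * n) + 1/2)) \<Longrightarrow>
         cmod (f y - f y') \<le> W; x \<in> {c..d}\<rbrakk> \<Longrightarrow> cmod (r x) \<le> C * (\<epsilon> + W * ln (real (2 * n) + 2))"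
proof -
  define gap where "gap = min (c - c') (d' - d)"
  define \<eta> where "\<eta> = min 1 (gap / XL)"
  have gap: "gap > 0" using assms by (simp add: gap_def)
  have \<eta>: "\<eta> > 0" "\<eta> \<le> 1" "XL * \<eta> \<le> gap"
    using gap XL_pos by (auto simp: \<eta>_def min_def field_simps)
  define s0 where "s0 = 2 * \<eta> / pi"
  have s0: "s0 > 0" using \<eta> by (simp add: s0_def)
  define A where "A = 16 + 12 / cos al + 16 / s0 + (2 / cos al + (pi / \<eta>)\<^sup>2) * 2 + kk / al * (5 * pi + 8 / s0)"
  define B where "B = kk / al * pi"
  define C where "C = (A + B) / (B * s0\<^sup>2)"
  have B0: "B > 0" using kk al by (simp add: B_def)
  have A0: "A > 0" unfolding A_def using kk al s0 by (intro add_pos_nonneg) auto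
  have C0: "C > 0" using A0 B0 s0 by (simp add: C_def)
  show ?thesis
  proof (rule that[OF C0])
    fix n f r \<epsilon> W x
    assume f: "L2_function f" and r: "is_proj n f r" and \<epsilon>: "L2_norm f \<le> \<epsilon>" "\<epsilon> > 0" and cont: "continuous_on {c'..d'} f"
      and bd: "\<And>y. y \<in> {c'..d'} \<Longrightarrow> cmod (f y) \<le> \<epsilon>"
      and osc: "\<And>y y'. y \<in> {c'..d'} \<Longrightarrow> y' \<in> {c'..d'} \<Longrightarrow> \<bar>y - y'\<bar> \<le> XL * (pi / (real (2 * n) + 1/2)) \<Longrightarrow>
         cmod (f y - f y') \<le> W" and xcd: "x \<in> {c..d}"
    have x: "x \<in> {-1..1}" using xcd assms by auto
    have gapx: "gap \<le> 1 - x" "gap \<le> x + 1" using xcd assms by (auto simp: gap_def)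
    have tx: "\<eta> \<le> th x" "th x \<le> pi - \<eta>"
    proof -
      have "gap \<le> \<bar>X (th x) - X 0\<bar>" "gap \<le> \<bar>X (th x) - X pi\<bar>" using gapx by (auto simp: X_th[OF x] X_ends)
      hence "gap \<le> XL * \<bar>th x - 0\<bar>" "gap \<le> XL * \<bar>th x - pi\<bar>"
        using X_Lipschitz[of "th x" 0] X_Lipschitz[of "th x" pi] by linarith+
      hence "XL * \<eta> \<le> XL * th x" "XL * \<eta> \<le> XL * (pi - th x)" using th_range[OF x] \<eta>(3) by auto
      hence "\<eta> \<le> th x" "\<eta> \<le> pi - th x" using XL_pos by auto
      thus "\<eta> \<le> th x" "th x \<le> pi - \<eta>" by auto
    qed
    have sgx: "sg x \<ge> s0"
    proof -
      have "2 * \<eta> / pi \<le> sin ((2 * th x) / 2)" by (rule sin_half_ge_symmetric) (use \<eta> tx in auto)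
      thus ?thesis by (simp add: s0_def sin_th[OF x])
    qed
    hence sg0: "sg x > 0" using s0 by simp
    have W0: "W \<ge> 0" using osc[of x x] xcd assms XL_pos by auto
    define l where "l = ln (real (2 * n) + 2)"
    have l0: "l \<ge> 0" by (simp add: l_def)
    have inv: "1 / sg x \<le> 1 / s0" using sgx s0 by (intro divide_left_mono) auto
    have ker: "rho x * cmod (LINT y|LM. K (2 * n) x y *\<^sub>R f y)
     \<le> (2 / cos al + (pi / \<eta>)\<^sup>2) * (2 * \<epsilon>) + kk / al * (5 * pi * \<epsilon> + pi * W * l + 8 / sg x * \<epsilon>)"
      unfolding l_def
    proof (rule kernel_integral_bound[OF x \<eta>(1,2) tx f \<epsilon> _ cont bd osc])
      fix y assume "\<bar>y - x\<bar> \<le> XL * \<eta>"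
      hence "\<bar>y - x\<bar> \<le> gap" using \<eta> by simp
      thus "y \<in> {c'..d'}" using xcd by (auto simp: gap_def abs_le_iff)
    qed
    have "vE x * cmod (r x) = cmod (vE x *\<^sub>R r x)" using kk al by simp
    also have "\<dots> \<le> cmod (vE x *\<^sub>R r x - (sg x * rho x) *\<^sub>R (LINT y|LM. K (2 * n) x y *\<^sub>R f y))
       + cmod ((sg x * rho x) *\<^sub>R (LINT y|LM. K (2 * n) x y *\<^sub>R f y))"
      using norm_triangle_sub[of "vE x *\<^sub>R r x" "(sg x * rho x) *\<^sub>R (LINT y|LM. K (2 * n) x y *\<^sub>R f y)"]
      by linarith
    also have "\<dots> \<le> (16 + 12 / cos al + 16 / sg x) * \<epsilon> + 1 * (rho x * cmod (LINT y|LM. K (2 * n) x y *\<^sub>R f y))"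
    proof (intro add_mono projection_vs_kernel f r \<epsilon> x sg0)
      have "cmod ((sg x * rho x) *\<^sub>R (LINT y|LM. K (2 * n) x y *\<^sub>R f y)) = sg x * (rho x * cmod (LINT y|LM. K (2 * n) x y *\<^sub>R f y))"
        using sg0 rho_pos[OF x] by simp
      also have "\<dots> \<le> 1 * (rho x * cmod (LINT y|LM. K (2 * n) x y *\<^sub>R f y))"
        using sg_le_1[OF x] rho_pos[OF x] by (intro mult_right_mono) auto
      finally show "cmod ((sg x * rho x) *\<^sub>R (LINT y|LM. K (2 * n) x y *\<^sub>R f y)) \<le> 1 * (rho x * cmod (LINT y|LM. K (2 * n) x y *\<^sub>R f y))" .
    qed
    also have "\<dots> \<le> (16 + 12 / cos al + 16 / s0) * \<epsilon>
       + ((2 / cos al + (pi / \<eta>)\<^sup>2) * (2 * \<epsilon>) + kk / al * (5 * pi * \<epsilon> + pi * W * l + 8 / s0 * \<epsilon>))"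
    proof (intro add_mono)
      show "(16 + 12 / cos al + 16 / sg x) * \<epsilon> \<le> (16 + 12 / cos al + 16 / s0) * \<epsilon>"
        using inv \<epsilon> by (intro mult_right_mono) auto
      have "8 / sg x * \<epsilon> \<le> 8 / s0 * \<epsilon>" using inv \<epsilon> by (intro mult_right_mono) auto
      hence "kk / al * (5 * pi * \<epsilon> + pi * W * l + 8 / sg x * \<epsilon>) \<le> kk / al * (5 * pi * \<epsilon> + pi * W * l + 8 / s0 * \<epsilon>)"
        using kk al by (intro mult_left_mono) auto
      thus "1 * (rho x * cmod (LINT y|LM. K (2 * n) x y *\<^sub>R f y)) \<le> 
        (2 / cos al + (pi / \<eta>)\<^sup>2) * (2 * \<epsilon>) + kk / al * (5 * pi * \<epsilon> + pi * W * l + 8 / s0 * \<epsilon>)"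
        using ker by simp
    qed
    also have "\<dots> = A * \<epsilon> + B * (W * l)"
      by (simp add: A_def B_def algebra_simps)
    also have "\<dots> \<le> (A + B) * \<epsilon> + (A + B) * (W * l)"
      using A0 B0 \<epsilon> W0 l0 by (intro add_mono mult_right_mono) auto
    also have "\<dots> = (A + B) * (\<epsilon> + W * l)" by (simp add: algebra_simps)
    finally have "B * (sg x)\<^sup>2 * cmod (r x) \<le> (A + B) * (\<epsilon> + W * l)" by (simp add: B_def)
    moreover have "B * s0\<^sup>2 * cmod (r x) \<le> B * (sg x)\<^sup>2 * cmod (r x)"
      using sgx s0 B0 by (intro mult_right_mono mult_left_mono power_mono) auto
    ultimately have "B * s0\<^sup>2 * cmod (r x) \<le> (A + B) * (\<epsilon> + W * l)" by linarith
    thus "cmod (r x) \<le> C * (\<epsilon> + W * ln (real (2 * n) + 2))"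
      using B0 s0 unfolding C_def l_def[symmetric] by (simp add: field_simps)
  qed
qed

end

section \<open>Density of trigonometric polynomials\<close>

lemma L2_norm_add_le:
  assumes "L2_function f" "L2_function g" "L2_norm f \<le> \<epsilon> / 2" "L2_norm g \<le> \<epsilon> / 2"
  shows "L2_norm (\<lambda>x. f x + g x) \<le> \<epsilon>"
proof -
  have e: "\<epsilon> \<ge> 0" using assms(3) L2_norm_nonneg[of f] by simp
  have sq: "(L2_norm h)\<^sup>2 = (LINT x|LM. (cmod (h x))\<^sup>2)" for h by (simp add: L2_norm_def)
  have "(L2_norm (\<lambda>x. f x + g x))\<^sup>2 \<le> (LINT x|LM. 2 * (cmod (f x))\<^sup>2 + 2 * (cmod (g x))\<^sup>2)"
    unfolding sq
  proof (rule integral_mono)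
    show "integrable LM (\<lambda>x. (cmod (f x + g x))\<^sup>2)" by (intro L2_integrable_square L2_add assms)
    show "integrable LM (\<lambda>x. 2 * (cmod (f x))\<^sup>2 + 2 * (cmod (g x))\<^sup>2)"
      by (intro Bochner_Integration.integrable_add integrable_mult_right L2_integrable_square assms)
    fix x
    have "(cmod (f x + g x))\<^sup>2 \<le> (cmod (f x) + cmod (g x))\<^sup>2" by (intro power_mono norm_triangle_ineq) auto
    also have "\<dots> \<le> 2 * (cmod (f x))\<^sup>2 + 2 * (cmod (g x))\<^sup>2"
      using sum_squares_bound[of "cmod (f x)" "cmod (g x)"] by (simp add: power2_sum)
    finally show "(cmod (f x + g x))\<^sup>2 \<le> 2 * (cmod (f x))\<^sup>2 + 2 * (cmod (g x))\<^sup>2" .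
  qed
  also have "\<dots> = 2 * (L2_norm f)\<^sup>2 + 2 * (L2_norm g)\<^sup>2"
    using L2_integrable_square[OF assms(1)] L2_integrable_square[OF assms(2)]
    unfolding sq by (simp add: Bochner_Integration.integral_add)
  also have "\<dots> \<le> 2 * (\<epsilon> / 2)\<^sup>2 + 2 * (\<epsilon> / 2)\<^sup>2"
    by (intro add_mono mult_left_mono power_mono assms L2_norm_nonneg) auto
  also have "\<dots> = \<epsilon>\<^sup>2" by (simp add: power2_eq_square)
  finally show ?thesis using e by (rule power2_le_imp_le)
qed

lemma L2_norm_mono:
  assumes "L2_function f" "L2_function g" "\<And>x. x \<in> {-1<..<1} \<Longrightarrow> cmod (f x) \<le> cmod (g x)"
  shows "L2_norm f \<le> L2_norm g"
  unfolding L2_norm_def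
  by (intro real_sqrt_le_mono integral_mono L2_integrable_square assms power_mono) auto

lemma L2_norm_le_bound:
  assumes f: "L2_function f" and b: "\<And>x. x \<in> {-1<..<1} \<Longrightarrow> cmod (f x) \<le> \<delta>" and d: "\<delta> \<ge> 0"
  shows "L2_norm f \<le> 2 * \<delta>"
proof -
  have "L2_norm f \<le> L2_norm (\<lambda>x. complex_of_real \<delta>)"
    by (rule L2_norm_mono[OF f]) (use b d in \<open>auto intro!: L2_continuous\<close>)
  also have "\<dots> = sqrt (2 * \<delta>\<^sup>2)" by (simp add: L2_norm_def measure_LM[simplified])
  also have "\<dots> \<le> sqrt ((2 * \<delta>)\<^sup>2)" by (rule real_sqrt_le_mono) (simp add: power_mult_distrib)
  also have "\<dots> = 2 * \<delta>" by (simp only: real_sqrt_abs) (use d in simp)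
  finally show ?thesis .
qed

text \<open>Dominated convergence in mean square.\<close>

lemma L2_norm_tendsto_0:
  assumes f: "f \<in> borel_measurable LM" and u: "\<And>n. u n \<in> borel_measurable LM"
    and lim: "AE x in LM. (\<lambda>n. u n x) \<longlonglongrightarrow> f x"
    and w: "integrable LM (\<lambda>x. (w x)\<^sup>2)" and dom: "\<And>n. AE x in LM. cmod (f x - u n x) \<le> w x"
  shows "(\<lambda>n. L2_norm (\<lambda>x. f x - u n x)) \<longlonglongrightarrow> 0"
proof -
  have "(\<lambda>n. LINT x|LM. (cmod (f x - u n x))\<^sup>2) \<longlonglongrightarrow> (LINT x|LM. 0)"
  proof (rule integral_dominated_convergence[OF _ _ w])
    show "(\<lambda>x. (cmod (f x - u n x))\<^sup>2) \<in> borel_measurable LM" for n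
      using f u[of n] by measurable
    show "AE x in LM. (\<lambda>n. (cmod (f x - u n x))\<^sup>2) \<longlonglongrightarrow> 0"
      using lim
    proof eventually_elim
      case (elim x)
      hence "(\<lambda>n. (cmod (f x - u n x))\<^sup>2) \<longlonglongrightarrow> (cmod (f x - f x))\<^sup>2" by (intro tendsto_intros)
      thus ?case by simp
    qed
    show "AE x in LM. norm ((cmod (f x - u n x))\<^sup>2) \<le> (w x)\<^sup>2" for n
      using dom[of n] by eventually_elim (auto intro: power_mono)
  qed simp
  hence "(\<lambda>n. sqrt (LINT x|LM. (cmod (f x - u n x))\<^sup>2)) \<longlonglongrightarrow> sqrt (LINT x|LM. 0)"
    by (rule tendsto_real_sqrt)
  thus ?thesis by (simp add: L2_norm_def)
qed

text \<open>Radial truncation at modulus \<open>K\<close>.\<close>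

definition clamp_norm :: "real \<Rightarrow> complex \<Rightarrow> complex" where
  "clamp_norm K z = (K / max K (cmod z)) *\<^sub>R z"

lemma clamp_norm_bound: "K > 0 \<Longrightarrow> cmod (clamp_norm K z) \<le> K"
  by (auto simp: clamp_norm_def max_def divide_simps)

lemma clamp_norm_eq: "K > 0 \<Longrightarrow> cmod z \<le> K \<Longrightarrow> clamp_norm K z = z"
  by (simp add: clamp_norm_def max_def)

lemma continuous_on_clamp_norm: "K > 0 \<Longrightarrow> continuous_on A (clamp_norm K)"
  unfolding clamp_norm_def by (intro continuous_intros) auto

lemma clamp_norm_diff: assumes "K > 0" shows "cmod (z - clamp_norm K z) \<le> cmod z"
proof -
  have "z - clamp_norm K z = (1 - K / max K (cmod z)) *\<^sub>R z"
    by (simp add: clamp_norm_def algebra_simps)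
  hence "cmod (z - clamp_norm K z) = \<bar>1 - K / max K (cmod z)\<bar> * cmod z" by simp
  also have "\<dots> \<le> 1 * cmod z"
    by (intro mult_right_mono) (use assms in \<open>auto simp: abs_le_iff max_def divide_simps\<close>)
  finally show ?thesis by simp
qed

lemma clamp_norm_measurable:
  assumes "K > 0" "f \<in> borel_measurable M" shows "(\<lambda>x. clamp_norm K (f x)) \<in> borel_measurable M"
  by (rule measurable_compose[OF assms(2) borel_measurable_continuous_onI[OF continuous_on_clamp_norm[OF assms(1)]]])

lemma L2_bounded:
  assumes "f \<in> borel_measurable LM" "\<And>x. cmod (f x) \<le> K" shows "L2_function f"
  unfolding L2_function_def
proof
  interpret finite_measure LM by (rule finite_measure_LM)
  show "integrable LM (\<lambda>x. (cmod (f x))\<^sup>2)"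
  proof (rule integrable_const_bound[where B = "K\<^sup>2"])
    show "AE x in LM. norm ((cmod (f x))\<^sup>2) \<le> K\<^sup>2" using assms(2) by (auto intro!: power_mono)
    show "(\<lambda>x. (cmod (f x))\<^sup>2) \<in> borel_measurable LM" using assms(1) by measurable
  qed
qed (rule assms)

text \<open>Truncate \<open>f\<close>, and approximate the truncation by truncations of continuous functions that converge
  to \<open>f\<close> almost everywhere.\<close>

lemma continuous_dense_in_L2:
  assumes f: "L2_function f" and \<epsilon>: "\<epsilon> > 0"
  obtains g where "continuous_on UNIV g" "L2_function g" "L2_norm (\<lambda>x. f x - g x) \<le> \<epsilon>"
proof -
  interpret finite_measure LM by (rule finite_measure_LM)
  note fm = L2_measurable[OF f]
  have "(\<lambda>n. L2_norm (\<lambda>x. f x - clamp_norm (real (Suc n)) (f x))) \<longlonglongrightarrow> 0"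
  proof (rule L2_norm_tendsto_0[OF fm])
    show "(\<lambda>x. clamp_norm (real (Suc n)) (f x)) \<in> borel_measurable LM" for n
      by (rule clamp_norm_measurable[OF _ fm]) simp
    show "integrable LM (\<lambda>x. (cmod (f x))\<^sup>2)" by (rule L2_integrable_square[OF f])
    show "AE x in LM. cmod (f x - clamp_norm (real (Suc n)) (f x)) \<le> cmod (f x)" for n
      by (intro AE_I2 clamp_norm_diff) simp
    show "AE x in LM. (\<lambda>n. clamp_norm (real (Suc n)) (f x)) \<longlonglongrightarrow> f x"
    proof (rule AE_I2)
      fix x
      have "eventually (\<lambda>n. clamp_norm (real (Suc n)) (f x) = f x) sequentially"
        using eventually_ge_at_top[of "nat \<lceil>cmod (f x)\<rceil>"]
      proof eventually_elim
        case (elim n)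
        show ?case by (rule clamp_norm_eq) (use elim in linarith)+
      qed
      thus "(\<lambda>n. clamp_norm (real (Suc n)) (f x)) \<longlonglongrightarrow> f x" by (rule tendsto_eventually)
    qed
  qed
  hence "eventually (\<lambda>n. L2_norm (\<lambda>x. f x - clamp_norm (real (Suc n)) (f x)) < \<epsilon> / 2) sequentially"
    by (rule order_tendstoD) (use \<epsilon> in simp)
  then obtain k where k: "L2_norm (\<lambda>x. f x - clamp_norm (real (Suc k)) (f x)) < \<epsilon> / 2"
    by (auto simp: eventually_sequentially)
  define K where "K = real (Suc k)"
  have K: "K > 0" by (simp add: K_def)
  define b where "b = (\<lambda>x. clamp_norm K (f x))"
  have bm: "b \<in> borel_measurable LM" unfolding b_def by (rule clamp_norm_measurable[OF K fm])
  have bb: "cmod (b x) \<le> K" for x unfolding b_def by (rule clamp_norm_bound[OF K])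
  have "f measurable_on {-1<..<1}" using fm by (subst measurable_on_iff_borel_measurable) auto
  then obtain N u where N: "negligible N" and u: "\<And>n. continuous_on UNIV (u n)"
    and lim: "\<And>x. x \<notin> N \<Longrightarrow> (\<lambda>n. u n x) \<longlonglongrightarrow> (if x \<in> {-1<..<1} then f x else 0)"
    unfolding measurable_on_def by blast
  have cu: "continuous_on A (\<lambda>x. clamp_norm K (u n x))" for n A
    by (rule continuous_on_compose2[OF continuous_on_clamp_norm[OF K, of UNIV] continuous_on_subset[OF u]]) auto
  have um: "(\<lambda>x. clamp_norm K (u n x)) \<in> borel_measurable LM" for n
    by (rule borel_measurable_integrable[OF continuous_integrable_LM(1)[OF cu]])
  have AEN: "AE x in LM. x \<notin> N"
  proof -
    have "N \<in> null_sets lebesgue" using N by (simp add: negligible_iff_null_sets)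
    hence "AE x in lebesgue. x \<notin> N" by (rule AE_not_in)
    thus ?thesis by (subst AE_restrict_space_iff) auto
  qed
  have "(\<lambda>n. L2_norm (\<lambda>x. b x - clamp_norm K (u n x))) \<longlonglongrightarrow> 0"
  proof (rule L2_norm_tendsto_0[OF bm um])
    show "AE x in LM. (\<lambda>n. clamp_norm K (u n x)) \<longlonglongrightarrow> b x"
      using AEN AE_space
    proof eventually_elim
      case (elim x)
      hence "(\<lambda>n. u n x) \<longlonglongrightarrow> f x" using lim[of x] by simp
      moreover have "isCont (clamp_norm K) (f x)"
        using continuous_on_clamp_norm[OF K, of UNIV] by (simp add: continuous_on_eq_continuous_at)
      ultimately show ?case unfolding b_def by (rule isCont_tendsto_compose[rotated])
    qed
    show "AE x in LM. cmod (b x - clamp_norm K (u n x)) \<le> 2 * K" for n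
    proof (rule AE_I2)
      fix x
      show "cmod (b x - clamp_norm K (u n x)) \<le> 2 * K"
        using norm_triangle_ineq4[of "b x" "clamp_norm K (u n x)"] bb[of x] clamp_norm_bound[OF K, of "u n x"]
        by linarith
    qed
    show "integrable LM (\<lambda>x. (2 * K)\<^sup>2)" by (rule integrable_const)
  qed
  hence "eventually (\<lambda>n. L2_norm (\<lambda>x. b x - clamp_norm K (u n x)) < \<epsilon> / 2) sequentially"
    by (rule order_tendstoD) (use \<epsilon> in simp)
  then obtain n where n: "L2_norm (\<lambda>x. b x - clamp_norm K (u n x)) < \<epsilon> / 2"
    by (auto simp: eventually_sequentially)
  define g where "g = (\<lambda>x. clamp_norm K (u n x))"
  have Lb: "L2_function b" by (rule L2_bounded[OF bm bb])
  have Lg: "L2_function g" unfolding g_def by (rule L2_continuous[OF cu])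
  have "L2_norm (\<lambda>x. (f x - b x) + (b x - g x)) \<le> \<epsilon>"
  proof (intro L2_norm_add_le L2_diff f Lb Lg)
    show "L2_norm (\<lambda>x. f x - b x) \<le> \<epsilon> / 2" using k by (simp only: b_def K_def)
    show "L2_norm (\<lambda>x. b x - g x) \<le> \<epsilon> / 2" using n by (simp only: g_def)
  qed
  hence "L2_norm (\<lambda>x. f x - g x) \<le> \<epsilon>" by simp
  thus ?thesis using that[of g] cu[of UNIV n] Lg by (simp add: g_def)
qed

text \<open>The approximation can be taken to agree with \<open>f\<close> on a compact interval in whose
  neighbourhood \<open>f\<close> is continuous: glue \<open>f\<close> to an approximation by means of a cut-off function.\<close>

lemma continuous_dense_in_L2_local:
  assumes f: "L2_function f" and cont: "continuous_on {a..b} f" and ab: "{a..b} \<subseteq> {-1..1}"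
    and o: "a < c" "c \<le> d" "d < b" and \<epsilon>: "\<epsilon> > 0"
  obtains g where "continuous_on {-1..1} g" "\<And>x. x \<in> {c..d} \<Longrightarrow> g x = f x" "L2_norm (\<lambda>x. f x - g x) \<le> \<epsilon>"
proof -
  obtain h where h: "continuous_on UNIV h" "L2_function h" "L2_norm (\<lambda>x. f x - h x) \<le> \<epsilon>"
    by (rule continuous_dense_in_L2[OF f \<epsilon>])
  define cut where "cut = (\<lambda>x. max 0 (min 1 (min ((x - a) / (c - a)) ((b - x) / (b - d)))))"
  have cut01: "0 \<le> cut x" "cut x \<le> 1" for x by (auto simp: cut_def)
  have cut1: "cut x = 1" if "x \<in> {c..d}" for x
  proof -
    have "1 \<le> (x - a) / (c - a)" "1 \<le> (b - x) / (b - d)" using that o by (auto simp: field_simps)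
    thus ?thesis by (simp add: cut_def)
  qed
  have cut0: "cut x = 0" if "x \<le> a \<or> b \<le> x" for x
  proof -
    have "(x - a) / (c - a) \<le> 0 \<or> (b - x) / (b - d) \<le> 0"
      using that o by (auto intro!: divide_nonpos_pos)
    thus ?thesis by (auto simp: cut_def)
  qed
  have ccut: "continuous_on A cut" for A unfolding cut_def by (intro continuous_intros) (use o in auto)
  have ccutf: "continuous_on {-1..1} (\<lambda>x. cut x *\<^sub>R f x)"
  proof -
    have 1: "continuous_on {-1..a} (\<lambda>x. cut x *\<^sub>R f x)"
      by (rule continuous_on_eq[of _ "\<lambda>x. 0"]) (auto simp: cut0)
    have 2: "continuous_on {a..b} (\<lambda>x. cut x *\<^sub>R f x)"
      by (intro continuous_intros ccut cont)
    have 3: "continuous_on {b..1} (\<lambda>x. cut x *\<^sub>R f x)"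
      by (rule continuous_on_eq[of _ "\<lambda>x. 0"]) (auto simp: cut0)
    have "continuous_on (({-1..a} \<union> {a..b}) \<union> {b..1}) (\<lambda>x. cut x *\<^sub>R f x)"
      by (intro continuous_on_closed_Un closed_Un closed_atLeastAtMost 1 2 3)
    thus ?thesis by (rule continuous_on_subset) auto
  qed
  define g where "g = (\<lambda>x. cut x *\<^sub>R f x + (1 - cut x) *\<^sub>R h x)"
  have cg: "continuous_on {-1..1} g"
    unfolding g_def by (intro continuous_intros ccutf ccut continuous_on_subset[OF h(1)]) auto
  have "L2_norm (\<lambda>x. f x - g x) \<le> L2_norm (\<lambda>x. f x - h x)"
  proof (rule L2_norm_mono)
    fix x
    have "f x - g x = (1 - cut x) *\<^sub>R (f x - h x)" by (simp add: g_def algebra_simps)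
    hence "cmod (f x - g x) = (1 - cut x) * cmod (f x - h x)" using cut01[of x] by simp
    also have "\<dots> \<le> 1 * cmod (f x - h x)" using cut01[of x] by (intro mult_right_mono) auto
    finally show "cmod (f x - g x) \<le> cmod (f x - h x)" by simp
  qed (intro L2_diff f h L2_continuous cg)+
  thus ?thesis using that[of g] cg h(3) cut1 by (simp add: g_def)
qed

context extension begin

lemma H_uniformly_dense_real:
  fixes u :: "real \<Rightarrow> real"
  assumes u: "continuous_on {-1..1} u" and \<epsilon>: "\<epsilon> > 0"
  obtains n q where "q \<in> H n" "\<And>x. x \<in> {-1..1} \<Longrightarrow> cmod (complex_of_real (u x) - q x) < \<epsilon>"
proof -
  define P where "P = (\<lambda>v. \<exists>n. (\<lambda>x. complex_of_real (v x)) \<in> H n)"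
  have "\<exists>v. P v \<and> (\<forall>x\<in>{-1..1}. \<bar>u x - v x\<bar> < \<epsilon>)"
  proof (rule Stone_Weierstrass_HOL[OF _ _ _ _ _ _ u \<epsilon>])
    show "P (\<lambda>x. c)" for c
      unfolding P_def using H_cmult[OF H_cos[of 0 0], of "complex_of_real c"] by auto
    show "continuous_on {-1..1} v" if "P v" for v
    proof -
      from that obtain n where "(\<lambda>x. complex_of_real (v x)) \<in> H n" by (auto simp: P_def)
      from continuous_on_Re[OF H_continuous[OF this, of "{-1..1}"]] show ?thesis by simp
    qed
    show "P (\<lambda>x. v x + w x)" if "P v \<and> P w" for v w
    proof -
      from that obtain n m where nm: "(\<lambda>x. complex_of_real (v x)) \<in> H n" "(\<lambda>x. complex_of_real (w x)) \<in> H m"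
        by (auto simp: P_def)
      have "(\<lambda>x. complex_of_real (v x) + complex_of_real (w x)) \<in> H (max n m)"
        by (intro H_add H_mono[OF nm(1)] H_mono[OF nm(2)]) auto
      thus ?thesis by (auto simp: P_def)
    qed
    show "P (\<lambda>x. v x * w x)" if "P v \<and> P w" for v w
    proof -
      from that obtain n m where nm: "(\<lambda>x. complex_of_real (v x)) \<in> H n" "(\<lambda>x. complex_of_real (w x)) \<in> H m"
        by (auto simp: P_def)
      from H_mult[OF this] show ?thesis by (auto simp: P_def)
    qed
    show "\<exists>v. P v \<and> v x \<noteq> v y" if xy: "x \<in> {-1..1} \<and> y \<in> {-1..1} \<and> x \<noteq> y" for x y
    proof -
      have "P (\<lambda>x. cos (real 1 * (2 * al * x)))" "P (\<lambda>x. sin (real 1 * (2 * al * x)))"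
        unfolding P_def using H_cos[of 1 1] H_sin[of 1 1] by blast+
      moreover have "ee 1 x \<noteq> ee 1 y" using inj_on_ee_1 xy by (meson inj_onD)
      hence "cos (real 1 * (2 * al * x)) \<noteq> cos (real 1 * (2 * al * y)) \<or> sin (real 1 * (2 * al * x)) \<noteq> sin (real 1 * (2 * al * y))"
        by (auto simp: ee_def complex_eq_iff)
      ultimately show ?thesis by blast
    qed
  qed simp
  then obtain v n where v: "(\<lambda>x. complex_of_real (v x)) \<in> H n" "\<And>x. x \<in> {-1..1} \<Longrightarrow> \<bar>u x - v x\<bar> < \<epsilon>"
    by (auto simp: P_def)
  show ?thesis
    by (rule that[OF v(1)]) (use v(2) in \<open>simp flip: of_real_diff\<close>)
qed

lemma H_uniformly_dense:
  assumes g: "continuous_on {-1..1} g" and \<epsilon>: "\<epsilon> > 0"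
  obtains n q where "q \<in> H n" "\<And>x. x \<in> {-1..1} \<Longrightarrow> cmod (g x - q x) \<le> \<epsilon>"
proof -
  have c: "continuous_on {-1..1} (\<lambda>x. Re (g x))" "continuous_on {-1..1} (\<lambda>x. Im (g x))"
    by (intro continuous_intros g)+
  have e: "\<epsilon> / 2 > 0" using \<epsilon> by simp
  obtain n p where p: "p \<in> H n" "\<And>x. x \<in> {-1..1} \<Longrightarrow> cmod (complex_of_real (Re (g x)) - p x) < \<epsilon> / 2"
    using H_uniformly_dense_real[OF c(1) e] by blast
  obtain m q where q: "q \<in> H m" "\<And>x. x \<in> {-1..1} \<Longrightarrow> cmod (complex_of_real (Im (g x)) - q x) < \<epsilon> / 2"
    using H_uniformly_dense_real[OF c(2) e] by blast
  have "(\<lambda>x. p x + \<i> * q x) \<in> H (max n m)"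
    by (intro H_add H_cmult H_mono[OF p(1)] H_mono[OF q(1)]) auto
  thus ?thesis
  proof (rule that)
    fix x :: real assume x: "x \<in> {-1..1}"
    have "g x - (p x + \<i> * q x) = (complex_of_real (Re (g x)) - p x) + \<i> * (complex_of_real (Im (g x)) - q x)"
      by (subst (1) complex_eq[of "g x"]) (simp add: algebra_simps)
    also have "cmod \<dots> \<le> cmod (complex_of_real (Re (g x)) - p x) + cmod (\<i> * (complex_of_real (Im (g x)) - q x))"
      by (rule norm_triangle_ineq)
    also have "\<dots> \<le> \<epsilon>" using p(2)[OF x] q(2)[OF x] by (simp add: norm_mult)
    finally show "cmod (g x - (p x + \<i> * q x)) \<le> \<epsilon>" .
  qed
qed

lemma H_dense_local:
  assumes f: "L2_function f" and cont: "continuous_on {a..b} f" and ab: "{a..b} \<subseteq> {-1..1}"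
    and o: "a < c" "c \<le> d" "d < b" and \<epsilon>: "\<epsilon> > 0"
  obtains n q where "q \<in> H n" "L2_norm (\<lambda>x. f x - q x) \<le> \<epsilon>" "\<And>x. x \<in> {c..d} \<Longrightarrow> cmod (f x - q x) \<le> \<epsilon>"
proof -
  have e: "\<epsilon> / 2 > 0" "\<epsilon> / 4 > 0" using \<epsilon> by auto
  obtain g where g: "continuous_on {-1..1} g" "\<And>x. x \<in> {c..d} \<Longrightarrow> g x = f x" "L2_norm (\<lambda>x. f x - g x) \<le> \<epsilon> / 2"
    using continuous_dense_in_L2_local[OF f cont ab o e(1)] by blast
  obtain n q where q: "q \<in> H n" "\<And>x. x \<in> {-1..1} \<Longrightarrow> cmod (g x - q x) \<le> \<epsilon> / 4"
    using H_uniformly_dense[OF g(1) e(2)] by blast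
  have L: "L2_function g" "L2_function q" by (rule L2_continuous[OF g(1)], rule L2_H[OF q(1)])
  have gq: "L2_norm (\<lambda>x. g x - q x) \<le> \<epsilon> / 2"
    using L2_norm_le_bound[of "\<lambda>x. g x - q x" "\<epsilon> / 4"] q(2) e L2_diff[OF L] by auto
  have "L2_norm (\<lambda>x. (f x - g x) + (g x - q x)) \<le> \<epsilon>"
    by (intro L2_norm_add_le L2_diff f L g gq)
  hence 1: "L2_norm (\<lambda>x. f x - q x) \<le> \<epsilon>" by simp
  have 2: "cmod (f x - q x) \<le> \<epsilon>" if "x \<in> {c..d}" for x
    using q(2)[of x] g(2)[OF that] that o ab \<epsilon> by (auto simp: subset_iff)
  show ?thesis by (rule that[OF q(1) 1 2])
qed

lemma H_Lipschitz:
  assumes "q \<in> H n" obtains L where "L \<ge> 0" "\<And>x y. cmod (q x - q y) \<le> L * \<bar>x - y\<bar>"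
proof -
  from assms obtain c where c: "\<And>x. q x = (\<Sum>k\<in>{-int n..int n}. c k * ee k x)" by (rule HE) blast
  define L where "L = (\<Sum>k\<in>{-int n..int n}. cmod (c k) * (2 * \<bar>real_of_int k * (2 * al)\<bar>))"
  have cis: "cmod (cis s - cis t) \<le> 2 * \<bar>s - t\<bar>" for s t
  proof -
    have "\<bar>cos s - cos t\<bar> \<le> \<bar>s - t\<bar>"
      using abs_sin_diff_le[of "s + pi/2" "t + pi/2"] by (simp add: sin_add)
    moreover have "\<bar>sin s - sin t\<bar> \<le> \<bar>s - t\<bar>" by (rule abs_sin_diff_le)
    ultimately show ?thesis using cmod_le[of "cis s - cis t"] by simp
  qed
  show ?thesis
  proof (rule that)
    show "L \<ge> 0" by (auto simp: L_def intro!: sum_nonneg)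
    fix x y
    have "q x - q y = (\<Sum>k\<in>{-int n..int n}. c k * (ee k x - ee k y))"
      by (simp add: c sum_subtractf algebra_simps)
    also have "cmod \<dots> \<le> (\<Sum>k\<in>{-int n..int n}. cmod (c k) * (2 * \<bar>real_of_int k * (2 * al)\<bar>) * \<bar>x - y\<bar>)"
    proof (rule sum_norm_le)
      fix k
      have "cmod (ee k x - ee k y) \<le> 2 * \<bar>real_of_int k * (2 * al * x) - real_of_int k * (2 * al * y)\<bar>"
        unfolding ee_def by (rule cis)
      also have "\<dots> = 2 * \<bar>real_of_int k * (2 * al)\<bar> * \<bar>x - y\<bar>"
        by (simp flip: abs_mult add: algebra_simps)
      finally show "cmod (c k * (ee k x - ee k y)) \<le> cmod (c k) * (2 * \<bar>real_of_int k * (2 * al)\<bar>) * \<bar>x - y\<bar>"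
        by (simp add: norm_mult mult_left_mono mult.assoc)
    qed
    also have "\<dots> = L * \<bar>x - y\<bar>" by (simp add: L_def sum_distrib_right)
    finally show "cmod (q x - q y) \<le> L * \<bar>x - y\<bar>" .
  qed
qed

end

section \<open>Uniform convergence\<close>

lemma uniformly_Dini_Lipschitz_modulus:
  assumes "uniformly_Dini_Lipschitz a b f" "\<epsilon> > 0"
  obtains \<delta>0 where "\<delta>0 > 0" "\<And>\<delta> x y. 0 < \<delta> \<Longrightarrow> \<delta> < \<delta>0 \<Longrightarrow> x \<in> {a..b} \<Longrightarrow> y \<in> {a..b} \<Longrightarrow> \<bar>x - y\<bar> < \<delta> \<Longrightarrow>
     cmod (f x - f y) * \<bar>ln \<delta>\<bar> \<le> \<epsilon>"
proof -
  have "eventually (\<lambda>\<delta>. (SUP (x, y) \<in> {(x, y). x \<in> {a..b} \<and> y \<in> {a..b} \<and> \<bar>x - y\<bar> < \<delta>}.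
             ennreal (cmod ((f x - f y) * of_real (ln \<delta>)))) < ennreal \<epsilon>) (at_right 0)"
    using assms unfolding uniformly_Dini_Lipschitz_def by (intro order_tendstoD(2)) auto
  then obtain \<delta>0 where \<delta>0: "\<delta>0 > 0" and sup: "\<And>\<delta>. 0 < \<delta> \<Longrightarrow> \<delta> < \<delta>0 \<Longrightarrow>
      (SUP (x, y) \<in> {(x, y). x \<in> {a..b} \<and> y \<in> {a..b} \<and> \<bar>x - y\<bar> < \<delta>}.
             ennreal (cmod ((f x - f y) * of_real (ln \<delta>)))) < ennreal \<epsilon>"
    unfolding eventually_at_right_field by auto
  show ?thesis
  proof (rule that[OF \<delta>0])
    fix \<delta> x y assume *: "0 < \<delta>" "\<delta> < \<delta>0" "x \<in> {a..b}" "y \<in> {a..b}" "\<bar>x - y\<bar> < \<delta>"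
    have "ennreal (cmod ((f x - f y) * of_real (ln \<delta>)))
      \<le> (SUP (x, y) \<in> {(x, y). x \<in> {a..b} \<and> y \<in> {a..b} \<and> \<bar>x - y\<bar> < \<delta>}. ennreal (cmod ((f x - f y) * of_real (ln \<delta>))))"
      by (rule SUP_upper2[of "(x, y)"]) (use * in auto)
    also have "\<dots> < ennreal \<epsilon>" by (rule sup) (use * in auto)
    finally have "cmod ((f x - f y) * of_real (ln \<delta>)) < \<epsilon>" by (subst (asm) ennreal_less_iff) auto
    thus "cmod (f x - f y) * \<bar>ln \<delta>\<bar> \<le> \<epsilon>" by (simp add: norm_mult)
  qed
qed

lemma uniformly_Dini_Lipschitz_continuous:
  assumes "uniformly_Dini_Lipschitz a b f" shows "continuous_on {a..b} f"
  unfolding continuous_on_iff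
proof (intro ballI allI impI)
  fix x and e :: real assume x: "x \<in> {a..b}" and e: "e > 0"
  obtain \<delta>0 where d: "\<delta>0 > 0" "\<And>\<delta> x y. 0 < \<delta> \<Longrightarrow> \<delta> < \<delta>0 \<Longrightarrow> x \<in> {a..b} \<Longrightarrow> y \<in> {a..b} \<Longrightarrow> \<bar>x - y\<bar> < \<delta> \<Longrightarrow>
     cmod (f x - f y) * \<bar>ln \<delta>\<bar> \<le> e / 2"
    using uniformly_Dini_Lipschitz_modulus[OF assms, of "e / 2"] e by auto
  define \<delta> where "\<delta> = min (\<delta>0 / 2) (exp (-1))"
  have \<delta>: "0 < \<delta>" "\<delta> < \<delta>0" "\<delta> \<le> exp (-1)" using d(1) by (auto simp: \<delta>_def)
  have "ln \<delta> \<le> ln (exp (-1))" using \<delta> by (subst ln_le_cancel_iff) auto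
  hence l: "\<bar>ln \<delta>\<bar> \<ge> 1" by simp
  show "\<exists>d>0. \<forall>y\<in>{a..b}. dist y x < d \<longrightarrow> dist (f y) (f x) < e"
  proof (intro exI[of _ \<delta>] conjI ballI impI \<delta>)
    fix y assume y: "y \<in> {a..b}" "dist y x < \<delta>"
    have "cmod (f y - f x) * 1 \<le> cmod (f y - f x) * \<bar>ln \<delta>\<bar>" using l by (intro mult_left_mono) auto
    also have "\<dots> \<le> e / 2" by (rule d(2)) (use \<delta> x y in \<open>auto simp: dist_real_def\<close>)
    finally show "dist (f y) (f x) < e" using e by (simp add: dist_norm)
  qed
qed

lemma Linf_norm_le:
  assumes "g \<in> borel_measurable (lebesgue_on {c<..<d})" "\<And>x. x \<in> {c<..<d} \<Longrightarrow> cmod (g x) \<le> \<epsilon>"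
  shows "Linf_norm c d g \<le> ennreal \<epsilon>"
  unfolding Linf_norm_def
proof (rule esssup_I)
  show "(\<lambda>x. ennreal (cmod (g x))) \<in> borel_measurable (lebesgue_on {c<..<d})" using assms(1) by measurable
  show "AE x in lebesgue_on {c<..<d}. ennreal (cmod (g x)) \<le> ennreal \<epsilon>"
    using assms(2) by (intro AE_I2 ennreal_leI) simp
qed

context extension begin

text \<open>Subtracting a suitable \<open>q\<close> of fixed degree leaves a function that is small both in norm and
  uniformly near \<open>[c, d]\<close>. The local bound then applies to it for all large degrees, and its modulus of
  continuity, to which the Lipschitz function \<open>q\<close> contributes only \<open>O(1/n)\<close>, still beats the logarithm.\<close>

lemma fourier_extension_converges:
  assumes f: "L2_function f" and ab: "{a..b} \<subseteq> {-1..1}" and DL: "uniformly_Dini_Lipschitz a b f"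
    and o: "a < c" "c \<le> d" "d < b" and \<epsilon>: "\<epsilon> > 0"
  shows "eventually (\<lambda>n. \<forall>x\<in>{c..d}. cmod (f x - fourier_extension T (2 * n + 1) f x) \<le> \<epsilon>) sequentially"
proof -
  define c' where "c' = (a + c) / 2"
  define d' where "d' = (d + b) / 2"
  have ab1: "-1 \<le> a" "b \<le> 1" using ab o by auto
  have cd': "-1 \<le> c'" "c' < c" "d < d'" "d' \<le> 1" "a < c'" "c' \<le> d'" "d' < b"
    using o ab1 by (auto simp: c'_def d'_def)
  obtain C where C: "C > 0"
    "\<And>n f r \<epsilon> W x. \<lbrakk>L2_function f; is_proj n f r; L2_norm f \<le> \<epsilon>; \<epsilon> > 0; continuous_on {c'..d'} f;
       \<And>y. y \<in> {c'..d'} \<Longrightarrow> cmod (f y) \<le> \<epsilon>;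
       \<And>y y'. y \<in> {c'..d'} \<Longrightarrow> y' \<in> {c'..d'} \<Longrightarrow> \<bar>y - y'\<bar> \<le> XL * (pi / (real (2 * n) + 1/2)) \<Longrightarrow>
         cmod (f y - f y') \<le> W; x \<in> {c..d}\<rbrakk> \<Longrightarrow> cmod (r x) \<le> C * (\<epsilon> + W * ln (real (2 * n) + 2))"
    using projection_local_bound[OF cd'(1,2) o(2) cd'(3,4)] by blast
  \<comment> \<open>\<open>e\<close> for \<open>f - q\<close> itself, and \<open>C * (e + 3 * e)\<close> for its projection\<close>
  define e where "e = \<epsilon> / (1 + 4 * C)"
  have e: "e > 0" "e * (1 + 4 * C) = \<epsilon>" using \<epsilon> C(1) by (auto simp: e_def)
  note cont = uniformly_Dini_Lipschitz_continuous[OF DL]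
  obtain M q where q: "q \<in> H M" "L2_norm (\<lambda>x. f x - q x) \<le> e" "\<And>x. x \<in> {c'..d'} \<Longrightarrow> cmod (f x - q x) \<le> e"
    using H_dense_local[OF f cont ab cd'(5,6,7) e(1)] by blast
  obtain L where L: "L \<ge> 0" "\<And>x y. cmod (q x - q y) \<le> L * \<bar>x - y\<bar>"
    using H_Lipschitz[OF q(1)] by blast
  obtain \<delta>0 where \<delta>0: "\<delta>0 > 0" "\<And>\<delta> x y. 0 < \<delta> \<Longrightarrow> \<delta> < \<delta>0 \<Longrightarrow> x \<in> {a..b} \<Longrightarrow> y \<in> {a..b} \<Longrightarrow> \<bar>x - y\<bar> < \<delta> \<Longrightarrow>
     cmod (f x - f y) * \<bar>ln \<delta>\<bar> \<le> e"
    using uniformly_Dini_Lipschitz_modulus[OF DL e(1)] by blast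
  define h where "h = (\<lambda>n::nat. XL * (pi / (real (2 * n) + 1/2)))"
  have hpos: "h n > 0" for n using XL_pos by (simp add: h_def)
  have "eventually (\<lambda>n. 2 * h n < \<delta>0) sequentially"
  proof -
    have "(\<lambda>n. 2 * h n) \<longlonglongrightarrow> 0" unfolding h_def by real_asymp
    thus ?thesis by (rule order_tendstoD(2)) (use \<delta>0 in simp)
  qed
  moreover have "eventually (\<lambda>n. ln (real (2 * n) + 2) \<le> 2 * \<bar>ln (2 * h n)\<bar> \<and> \<bar>ln (2 * h n)\<bar> > 0) sequentially"
  proof -
    have "eventually (\<lambda>n. ln (real (2 * n) + 2) \<le> - 2 * ln (2 * h n)) sequentially"
      unfolding h_def using XL_pos by real_asymp
    moreover have "eventually (\<lambda>n. 0 < ln (real (2 * n) + 2)) sequentially" by real_asymp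
    ultimately show ?thesis by eventually_elim auto
  qed
  moreover have "eventually (\<lambda>n. L * h n * ln (real (2 * n) + 2) < e) sequentially"
  proof -
    have "(\<lambda>n. L * h n * ln (real (2 * n) + 2)) \<longlonglongrightarrow> 0" unfolding h_def by real_asymp
    thus ?thesis by (rule order_tendstoD(2)) (use e in simp)
  qed
  ultimately show ?thesis using eventually_ge_at_top[of M]
  proof eventually_elim
    case (elim n)
    define l where "l = ln (real (2 * n) + 2)"
    define f1 where "f1 = (\<lambda>x. f x - q x)"
    define r where "r = fourier_extension T (2 * n + 1) f"
    \<comment> \<open>Distances at most \<open>h n\<close> are strictly below \<open>2 * h n\<close>, the scale at which the Dini--Lipschitz
      condition is used.\<close>
    define W where "W = e / \<bar>ln (2 * h n)\<bar> + L * h n"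
    have l0: "l \<ge> 0" by (simp add: l_def)
    have qn: "q \<in> H n" by (rule H_mono[OF q(1)]) (use elim in simp)
    have proj: "is_proj n f1 (\<lambda>x. r x - q x)"
      unfolding f1_def r_def by (rule is_proj_diff[OF fourier_extension_is_proj[OF f] qn])
    have Lf1: "L2_function f1" unfolding f1_def by (rule L2_diff[OF f L2_H[OF qn]])
    have cf1: "continuous_on {c'..d'} f1"
      unfolding f1_def by (intro continuous_intros continuous_on_subset[OF cont] H_continuous[OF qn]) (use cd' in auto)
    show ?case
    proof
      fix x assume x: "x \<in> {c..d}"
      have "cmod (r x - q x) \<le> C * (e + W * ln (real (2 * n) + 2))"
      proof (rule C(2)[OF Lf1 proj _ e(1) cf1 _ _ x])
        show "L2_norm f1 \<le> e" using q(2) by (simp add: f1_def)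
        show "cmod (f1 y) \<le> e" if "y \<in> {c'..d'}" for y using q(3)[OF that] by (simp add: f1_def)
        fix y y' assume y: "y \<in> {c'..d'}" "y' \<in> {c'..d'}" and yy: "\<bar>y - y'\<bar> \<le> XL * (pi / (real (2 * n) + 1/2))"
        hence yh: "\<bar>y - y'\<bar> \<le> h n" by (simp add: h_def)
        have "cmod (f y - f y') * \<bar>ln (2 * h n)\<bar> \<le> e"
          by (rule \<delta>0(2)) (use y yh cd' elim hpos[of n] in auto)
        hence 1: "cmod (f y - f y') \<le> e / \<bar>ln (2 * h n)\<bar>" using elim by (simp add: pos_le_divide_eq)
        have "cmod (q y - q y') \<le> L * \<bar>y - y'\<bar>" by (rule L(2))
        also have "\<dots> \<le> L * h n" using yh L(1) by (intro mult_left_mono) auto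
        finally have 2: "cmod (q y - q y') \<le> L * h n" .
        have "f1 y - f1 y' = (f y - f y') - (q y - q y')" by (simp add: f1_def)
        hence "cmod (f1 y - f1 y') \<le> cmod (f y - f y') + cmod (q y - q y')"
          using norm_triangle_ineq4 by metis
        thus "cmod (f1 y - f1 y') \<le> W" using 1 2 by (simp add: W_def)
      qed
      also have "\<dots> \<le> C * (e + 3 * e)"
      proof (intro mult_left_mono add_left_mono)
        have "e / \<bar>ln (2 * h n)\<bar> * l \<le> e / \<bar>ln (2 * h n)\<bar> * (2 * \<bar>ln (2 * h n)\<bar>)"
          using elim e by (intro mult_left_mono) (auto simp: l_def)
        also have "\<dots> = 2 * e" using elim by simp
        finally have "e / \<bar>ln (2 * h n)\<bar> * l \<le> 2 * e" .
        moreover have "L * h n * l \<le> e" using elim by (simp add: l_def)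
        ultimately show "W * ln (real (2 * n) + 2) \<le> 3 * e"
          unfolding W_def l_def[symmetric] by (simp add: ring_distribs)
      qed (use C(1) in simp)
      finally have "cmod (r x - q x) \<le> 4 * C * e" by simp
      moreover have "cmod (f x - q x) \<le> e" by (rule q(3)) (use x cd' in auto)
      moreover have "cmod (f x - r x) \<le> cmod (f x - q x) + cmod (r x - q x)"
        using norm_triangle_ineq4[of "f x - q x" "r x - q x"] by simp
      ultimately show "cmod (f x - fourier_extension T (2 * n + 1) f x) \<le> \<epsilon>"
        using e(2) by (simp add: r_def algebra_simps)
    qed
  qed
qed

lemma Linf_norm_fourier_extension_tendsto_0:
  assumes f: "L2_function f" and ab: "{a..b} \<subseteq> {-1..1}" and DL: "uniformly_Dini_Lipschitz a b f"
    and cd: "{c..d} \<subseteq> {a<..<b}"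
  shows "(\<lambda>n. Linf_norm c d (\<lambda>x. f x - fourier_extension T (2 * n + 1) f x)) \<longlonglongrightarrow> 0"
proof (rule order_tendstoI)
  fix u :: ennreal assume "0 < u"
  then obtain z where z: "0 < z" "z < u" using dense by blast
  then obtain \<epsilon> where \<epsilon>: "z = ennreal \<epsilon>" "\<epsilon> > 0"
    by (cases z) auto
  \<comment> \<open>The interval is empty if \<open>d \<le> c\<close>, and \<open>c\<close>, \<open>d\<close> need not lie in \<open>(a, b)\<close> if \<open>d < c\<close>.\<close>
  have ev: "eventually (\<lambda>n. \<forall>x\<in>{c<..<d}. cmod (f x - fourier_extension T (2 * n + 1) f x) \<le> \<epsilon>) sequentially"
  proof (cases "c < d")
    case True
    hence "c \<in> {c..d}" "d \<in> {c..d}" by simp_all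
    hence "c \<in> {a<..<b}" "d \<in> {a<..<b}" using cd by blast+
    hence "a < c" "c \<le> d" "d < b" using True by auto
    from fourier_extension_converges[OF f ab DL this \<epsilon>(2)] show ?thesis
      by eventually_elim auto
  qed auto
  have sub: "{c<..<d} \<subseteq> {-1<..<1}"
  proof (cases "c < d")
    case True
    hence "c \<in> {c..d}" "d \<in> {c..d}" by simp_all
    hence "c \<in> {a<..<b}" "d \<in> {a<..<b}" using cd by blast+
    thus ?thesis using True ab by auto
  qed auto
  have m: "(\<lambda>x. f x - fourier_extension T (2 * n + 1) f x) \<in> borel_measurable (lebesgue_on {c<..<d})" for n
  proof -
    have "fourier_extension T (2 * n + 1) f \<in> H n" using fourier_extension_is_proj[OF f] by (simp add: is_proj_def)
    from L2_measurable[OF L2_diff[OF f L2_H[OF this]]] show ?thesis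
      by (rule measurable_restrict_mono[OF _ sub])
  qed
  show "eventually (\<lambda>n. Linf_norm c d (\<lambda>x. f x - fourier_extension T (2 * n + 1) f x) < u) sequentially"
    using ev
  proof eventually_elim
    case (elim n)
    have "Linf_norm c d (\<lambda>x. f x - fourier_extension T (2 * n + 1) f x) \<le> z"
      unfolding \<epsilon>(1) by (rule Linf_norm_le[OF m]) (use elim in auto)
    thus ?case using z(2) by (rule le_less_trans)
  qed
qed simp

end

theorem theorem3p5:
  fixes T a b :: real and f :: "real \<Rightarrow> complex"
  assumes "T > 1"
    and "L2_function f"
    and "{a..b} \<subseteq> {-1..1}"
    and "uniformly_Dini_Lipschitz a b f"
  shows "\<forall>c d. {c..d} \<subseteq> {a<..<b} \<longrightarrow>
           (\<lambda>n. Linf_norm c d (\<lambda>x. f x - fourier_extension T (2 * n + 1) f x)) \<longlonglongrightarrow> 0"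
proof -
  interpret extension T by unfold_locales (rule assms(1))
  show ?thesis
    using Linf_norm_fourier_extension_tendsto_0[OF assms(2-4)] by blast
qed

end
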